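(* Let $p$, $q$ and $n_1,\ldots,n_q$ be positive integers with total sample size $n=\sum_{j=1}^qn_j$, where $p$, $q$ and the $n_j$ may depend on $n$ and all limits are taken as $n\to\infty$. Let $X_{ji}$, $1\le i\le n_j$, $1\le j\le q$, be independent random vectors with $X_{ji}\sim\mathcal{N}(\mu_j,\Sigma_j)$, where $\mu_j\in\mathbb{R}^p$ and $\Sigma_j\in\mathbb{R}^{p\times p}$ is positive definite (these parameters may depend on $n$). Let $\Lambda_n$ be the likelihood ratio statistic (defined in the context) for the null hypothesis $$H_0:\ \mu_1=\ldots=\mu_q,\quad \Sigma_1=\ldots=\Sigma_q .$$ Assume that $n_j>p+1$ for all $1\le j\le q$, $p\to\infty$, $q=o(\sqrt{pn})$, $p=o(n)$, that $$\limsup_{n\to\infty}\ \sup_{1\le j\le q}\frac{p}{n_j}<1,$$ and that $$\tilde\sigma_n^2=\frac12\sum_{j=1}^q\frac{n_j^2}{pn}\log\Big(\frac{n_j-1}{n_j-p-1}\Big)-\frac12$$ converges to a positive limit $\sigma^2>0$. Then, under the null hypothesis $H_0$, $$\frac{\log\Lambda_n-\tilde s_n}{\sqrt{pn}}\ \xrightarrow{\mathcal{D}}\ \mathcal{N}(0,\sigma^2),$$ where $$\begin{aligned}\tilde s_n={}&\sum_{j=1}^q\frac{n_j}{2}\Big\{\Big(n_j-p-\frac32\Big)\log\Big(\frac{n_j-2}{n_j-p-2}\Big)+p\log\Big(\frac{n_j-2}{n-q}\Big)-p\log(n_j)\Big\}\\ &+\frac n2\Big\{p\log\Big(\frac{\frac12n-1}{\frac12n+\frac12q-\frac32}\Big)+(n-q-p)\log\Big(\frac{n-q-p}{n-q}\Big)+p\log(n)\\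 &\quad+\Big(\frac12n-p-1\Big)\log\Big(\frac{\frac12n-1}{\frac12n-p-1}\Big)+\Big(\frac12n-p+\frac12q-\frac32\Big)\log\Big(\frac{\frac12n-p+\frac12q-\frac32}{\frac12n+\frac12q-\frac32}\Big)\Big\}.\end{aligned}$$
   Context: $\mathcal{N}(\mu,\Sigma)$ denotes the multivariate normal distribution, $|\cdot|$ the determinant, and $\xrightarrow{\mathcal{D}}$ weak convergence (convergence in distribution). With $\bar X_j=\frac1{n_j}\sum_{k=1}^{n_j}X_{jk}$ and $\bar X=\frac1n\sum_{j=1}^q\sum_{i=1}^{n_j}X_{ji}$ define the $p\times p$ matrices $$A_j=\sum_{k=1}^{n_j}(X_{jk}-\bar X_j)(X_{jk}-\bar X_j)^\top,\qquad A=\sum_{j=1}^qA_j,$$ $$B=\sum_{j=1}^q\sum_{i=1}^{n_j}(X_{ji}-\bar X)(X_{ji}-\bar X)^\top=A+\sum_{j=1}^qn_j(\bar X_j-\bar X)(\bar X_j-\bar X)^\top .$$ The likelihood ratio statistic is $$\Lambda_n=\frac{\prod_{j=1}^q|A_j/n_j|^{\frac12n_j}}{|B/n|^{\frac12n}} .$$ Under the stated assumptions all expressions are (almost surely) well defined for all sufficiently large $n$, which is all that is needed for the asymptotic statement. *)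

theory Defs
  imports
    "HOL-Probability.Probability"
    "HOL-Library.Landau_Symbols"
    "Jordan_Normal_Form.Gauss_Jordan_Elimination"
    "Jordan_Normal_Form.Determinant"
begin

no_notation Finite_Cartesian_Product.vec_nth (infixl "$" 90)
no_notation Inner_Product.real_inner_class.inner (infix "\<bullet>" 70)

text \<open>
  The dimension \<open>p\<close> varies with the sample size, so random vectors take values in
  \<^term>\<open>carrier_vec p\<close>, whose coordinates are indexed by \<^term>\<open>{..<p}\<close>. The Borel sets and the
  Lebesgue measure are transported along the bijection \<^term>\<open>vec p\<close> from the extensional
  functions on \<^term>\<open>{..<p}\<close>.
\<close>

definition borel_vec :: "nat \<Rightarrow> real vec measure" where
  "borel_vec p =
     vimage_algebra (carrier_vec p) (\<lambda>v. \<lambda>i\<in>{..<p}. v $ i) (\<Pi>\<^sub>M i\<in>{..<p}. borel)"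

definition lborel_vec :: "nat \<Rightarrow> real vec measure" where
  "lborel_vec p = distr (\<Pi>\<^sub>M i\<in>{..<p}. lborel) (borel_vec p) (vec p)"

definition positive_definite_mat :: "nat \<Rightarrow> real mat \<Rightarrow> bool" where
  "positive_definite_mat p S \<longleftrightarrow>
     S \<in> carrier_mat p p \<and> transpose_mat S = S \<and>
     (\<forall>v\<in>carrier_vec p. v \<noteq> 0\<^sub>v p \<longrightarrow> v \<bullet> (S *\<^sub>v v) > 0)"

definition mvnormal_density :: "nat \<Rightarrow> real vec \<Rightarrow> real mat \<Rightarrow> real vec \<Rightarrow> real" where
  "mvnormal_density p m S x =
     exp (- ((x - m) \<bullet> (the (mat_inverse S) *\<^sub>v (x - m))) / 2) / sqrt ((2 * pi) ^ p * det S)"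

context
  fixes p :: nat and q :: nat and N :: "nat \<Rightarrow> nat" and x :: "nat \<Rightarrow> nat \<Rightarrow> real vec"
begin

text \<open>
  A realisation of the sample: \<open>x j i\<close> is the \<open>i\<close>-th observation (\<open>1 \<le> i \<le> N j\<close>) of the
  \<open>j\<close>-th group (\<open>1 \<le> j \<le> q\<close>).
\<close>

definition total_size :: nat where
  "total_size = (\<Sum>j=1..q. N j)"

definition group_mean :: "nat \<Rightarrow> real vec" where
  "group_mean j = vec p (\<lambda>a. (\<Sum>k=1..N j. x j k $ a) / real (N j))"

definition overall_mean :: "real vec" where
  "overall_mean = vec p (\<lambda>a. (\<Sum>j=1..q. \<Sum>i=1..N j. x j i $ a) / real total_size)"

definition within_scatter :: "nat \<Rightarrow> real mat" where
  "within_scatter j = mat p p (\<lambda>(a, b).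
     \<Sum>k=1..N j. (x j k - group_mean j) $ a * (x j k - group_mean j) $ b)"

definition total_scatter :: "real mat" where
  "total_scatter = mat p p (\<lambda>(a, b).
     \<Sum>j=1..q. \<Sum>i=1..N j. (x j i - overall_mean) $ a * (x j i - overall_mean) $ b)"

definition likelihood_ratio :: real where
  "likelihood_ratio =
     (\<Prod>j=1..q. det ((1 / real (N j)) \<cdot>\<^sub>m within_scatter j) powr (real (N j) / 2))
     / det ((1 / real total_size) \<cdot>\<^sub>m total_scatter) powr (real total_size / 2)"

end

definition sigma_tilde_sq :: "nat \<Rightarrow> nat \<Rightarrow> nat \<Rightarrow> (nat \<Rightarrow> nat) \<Rightarrow> real" where
  "sigma_tilde_sq n p q N =
     1 / 2 * (\<Sum>j=1..q. (real (N j))\<^sup>2 / (real p * real n)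
                * ln ((real (N j) - 1) / (real (N j) - real p - 1))) - 1 / 2"

text \<open>
  The arguments are real numbers, so that no subtraction below is truncated.
\<close>

definition s_tilde :: "real \<Rightarrow> real \<Rightarrow> nat \<Rightarrow> (nat \<Rightarrow> real) \<Rightarrow> real" where
  "s_tilde n p q N =
     (\<Sum>j=1..q. N j / 2 *
        ((N j - p - 3 / 2) * ln ((N j - 2) / (N j - p - 2))
         + p * ln ((N j - 2) / (n - q)) - p * ln (N j)))
     + n / 2 *
        (p * ln ((n / 2 - 1) / (n / 2 + q / 2 - 3 / 2))
         + (n - q - p) * ln ((n - q - p) / (n - q))
         + p * ln n
         + (n / 2 - p - 1) * ln ((n / 2 - 1) / (n / 2 - p - 1))
         + (n / 2 - p + q / 2 - 3 / 2)
             * ln ((n / 2 - p + q / 2 - 3 / 2) / (n / 2 + q / 2 - 3 / 2)))"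

end

theory Submission
  imports Defs "HOL-Real_Asymp.Real_Asymp"
begin

text \<open>
  The likelihood ratio statistic is invariant under affine maps of the observations, so under the null
  hypothesis the observations may be taken to be standard normal. Border the \<open>p \<times> n\<close> data matrix by a
  row of ones: the determinants of the scatter matrices become Gram determinants of the bordered rows,
  and these are products of squared residuals of each row with respect to the previous ones. Given the
  previous rows, a rotation turns the squared residuals of row \<open>i\<close> into sums \<open>Q\<^sub>j\<close> of squares of
  \<open>n\<^sub>j - i\<close> standard normal coordinates, and the residual for the total scatter into a sum \<open>Q\<close> of
  \<open>n - i\<close> squares which contains all of these. As \<open>\<Prod>\<^sub>j Q\<^sub>j\<^bsup>n\<^sub>j/2\<^esup> / Q\<^bsup>n/2\<^esup>\<close> is homogeneous of degree
  \<open>0\<close>, it is independent of \<open>Q\<close>. So the characteristic function of \<open>ln \<Lambda>\<^sub>n\<close> is an explicit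
  product of quotients of values of the Gamma function. A second-order Taylor expansion of \<open>ln \<Gamma>\<close> off
  the real axis gives its limit: the first-order terms match \<open>s_tilde\<close> up to \<open>O(p + q)\<close>, which is
  \<open>o(\<surd>(p n))\<close>; the second-order terms match \<open>sigma_tilde_sq\<close>, the summand \<open>- 1 / 2\<close> coming from the
  total scatter. Levy's continuity theorem concludes.
\<close>

section \<open>Lebesgue measure and linear maps\<close>

text \<open>Only imaginary powers \<open>xi w\<close> occur. They are bounded by \<open>1\<close>,
  so every expectation exists and no continuation from real moments is involved. The row of ones is
  row \<open>0\<close>; projecting it off is the centring at the means. It is not random, so the
  random rows are \<open>1..p\<close>, and row \<open>i\<close> has \<open>i\<close> predecessors:
  hence the degrees of freedom \<open>N j - i\<close> and \<open>n - i\<close>. The obstacle in a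
  single row step is that the projections of all groups and of the total have to be diagonalised
  together, although each group loses \<open>i\<close> dimensions and the total loses only
  \<open>i\<close>, not \<open>q * i\<close>.

  The sizes of the errors explain the assumptions. With \<open>s = t / sqrt (p * n)\<close>, a group
  of size \<open>N\<close> enters with the exponent \<open>s * N / 2\<close>. The condition on
  \<open>p / N\<close> leaves it at least \<open>\<epsilon> * N\<close> degrees of freedom, so its
  cubic Taylor remainder is \<open>O(s^3 * N)\<close>; summed over groups and rows this is
  \<open>O(1 / sqrt (p * n))\<close>. The centring is met up to \<open>O(p + q)\<close>, where
  \<open>p = o(n)\<close> and \<open>q = o(sqrt (p * n))\<close> enter.\<close>

abbreviation lebP :: "'i set \<Rightarrow> ('i \<Rightarrow> real) measure" where
  "lebP I \<equiv> \<Pi>\<^sub>M i\<in>I. lborel"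

interpretation lebP: product_sigma_finite "\<lambda>_::'i. lborel :: real measure"
  by standard

text \<open>\<open>lborel_real_affine\<close> expresses \<open>lborel\<close> through the image
  measure; the constant density \<open>1 / \<bar>r\<bar>\<close> turns the relation round.\<close>

lemma distr_lborel_affine:
  fixes a r :: real assumes "r \<noteq> 0"
  shows "distr lborel lborel (\<lambda>x. a + r * x) = density lborel (\<lambda>_. ennreal (1 / \<bar>r\<bar>))"
proof -
  have "density lborel (\<lambda>_. ennreal (1 / \<bar>r\<bar>))
      = density (density (distr lborel borel (\<lambda>x. a + r * x)) (\<lambda>_. ennreal \<bar>r\<bar>)) (\<lambda>_. ennreal (1 / \<bar>r\<bar>))"
    using lborel_real_affine[OF assms, of a] by simp
  also have "\<dots> = density (distr lborel borel (\<lambda>x. a + r * x)) (\<lambda>_. 1)"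
    using assms by (subst density_density_eq) (auto simp: ennreal_mult[symmetric])
  also have "\<dots> = distr lborel lborel (\<lambda>x. a + r * x)"
    by (simp add: density_1 cong: distr_cong)
  finally show ?thesis by simp
qed

text \<open>The map acts on each coordinate separately, so boxes suffice.
  \<open>lebP.PiM_eqI\<close> characterises \<open>lebP I\<close> itself, which is why the factor is
  first moved to the side of the image measure.\<close>

lemma distr_lebP_affine:
  fixes a :: "'i \<Rightarrow> real" and r :: real
  assumes I: "finite I" and r: "r \<noteq> 0"
  shows "distr (lebP I) (lebP I) (\<lambda>x. \<lambda>k\<in>I. a k + r * x k)
    = density (lebP I) (\<lambda>_. ennreal ((1 / \<bar>r\<bar>) ^ card I))"
proof -
  let ?D = "distr (lebP I) (lebP I) (\<lambda>x. \<lambda>k\<in>I. a k + r * x k)"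
  let ?c = "ennreal ((1 / \<bar>r\<bar>) ^ card I)"
  have m[measurable]: "(\<lambda>x. \<lambda>k\<in>I. a k + r * x k) \<in> measurable (lebP I) (lebP I)"
    by measurable
  have "density ?D (\<lambda>_. ennreal (\<bar>r\<bar> ^ card I)) = lebP I"
  proof (rule lebP.PiM_eqI[OF I])
    fix A :: "'i \<Rightarrow> real set" assume A: "\<And>i. i \<in> I \<Longrightarrow> A i \<in> sets lborel"
    have AI: "Pi\<^sub>E I A \<in> sets (lebP I)" using A by (intro sets_PiM_I_finite I) auto
    have mm: "(\<lambda>x. a i + r * x) \<in> measurable lborel lborel" for i by measurable
    have "emeasure ?D (Pi\<^sub>E I A) = emeasure (lebP I) ((\<lambda>x. \<lambda>k\<in>I. a k + r * x k) -` Pi\<^sub>E I A \<inter> space (lebP I))"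
      using AI by (simp add: emeasure_distr)
    also have "(\<lambda>x. \<lambda>k\<in>I. a k + r * x k) -` Pi\<^sub>E I A \<inter> space (lebP I) = (\<Pi>\<^sub>E k\<in>I. (\<lambda>x. a k + r * x) -` A k)"
      by (auto simp: space_PiM PiE_iff extensional_def)
    also have "emeasure (lebP I) \<dots> = (\<Prod>k\<in>I. emeasure lborel ((\<lambda>x. a k + r * x) -` A k))"
      using A measurable_sets[OF mm] by (intro lebP.emeasure_PiM I) simp
    also have "\<dots> = (\<Prod>k\<in>I. emeasure (distr lborel lborel (\<lambda>x. a k + r * x)) (A k))"
      using A by (intro prod.cong) (auto simp: emeasure_distr mm)
    also have "\<dots> = (\<Prod>k\<in>I. ennreal (1 / \<bar>r\<bar>) * emeasure lborel (A k))"
      using A r by (intro prod.cong) (auto simp: distr_lborel_affine emeasure_density_const)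
    finally have e: "emeasure ?D (Pi\<^sub>E I A) = ennreal (1 / \<bar>r\<bar>) ^ card I * (\<Prod>k\<in>I. emeasure lborel (A k))"
      by (simp only: prod.distrib prod_constant)
    have "emeasure (density ?D (\<lambda>_. ennreal (\<bar>r\<bar> ^ card I))) (Pi\<^sub>E I A)
       = ennreal (\<bar>r\<bar> ^ card I) * (ennreal (1 / \<bar>r\<bar>) ^ card I * (\<Prod>k\<in>I. emeasure lborel (A k)))"
      using AI by (simp add: emeasure_density_const e)
    also have "\<dots> = (\<Prod>k\<in>I. emeasure lborel (A k))"
      using r by (simp add: mult.assoc[symmetric] ennreal_mult[symmetric] power_divide ennreal_power)
    finally show "emeasure (density ?D (\<lambda>_. ennreal (\<bar>r\<bar> ^ card I))) (Pi\<^sub>E I A) = (\<Prod>k\<in>I. emeasure lborel (A k))" .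
  qed simp
  then have "density (lebP I) (\<lambda>_. ?c) = density (density ?D (\<lambda>_. ennreal (\<bar>r\<bar> ^ card I))) (\<lambda>_. ?c)" by simp
  also have "\<dots> = density ?D (\<lambda>_. 1)"
    using r by (subst density_density_eq) (auto simp: ennreal_mult[symmetric] power_divide)
  also have "\<dots> = ?D" by (simp add: density_1)
  finally show ?thesis by simp
qed

text \<open>Needed for \<open>r = 1\<close> (translations), \<open>r = -1\<close> (the Haar
  argument) and \<open>r = sqrt t\<close> (polar coordinates).\<close>

lemma nn_integral_lebP_affine:
  fixes a :: "'i \<Rightarrow> real" and r :: real
  assumes I: "finite I" and r: "r \<noteq> 0" and f: "f \<in> borel_measurable (lebP I)"
  shows "(\<integral>\<^sup>+x. f (\<lambda>k\<in>I. a k + r * x k) \<partial>lebP I) = ennreal ((1 / \<bar>r\<bar>) ^ card I) * (\<integral>\<^sup>+x. f x \<partial>lebP I)"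
proof -
  have m[measurable]: "(\<lambda>x. \<lambda>k\<in>I. a k + r * x k) \<in> measurable (lebP I) (lebP I)"
    by measurable
  have "(\<integral>\<^sup>+x. f (\<lambda>k\<in>I. a k + r * x k) \<partial>lebP I) = (\<integral>\<^sup>+x. f x \<partial>distr (lebP I) (lebP I) (\<lambda>x. \<lambda>k\<in>I. a k + r * x k))"
    using f by (simp add: nn_integral_distr)
  also have "\<dots> = ennreal ((1 / \<bar>r\<bar>) ^ card I) * (\<integral>\<^sup>+x. f x \<partial>lebP I)"
    using f by (simp add: distr_lebP_affine[OF I r] nn_integral_density nn_integral_cmult)
  finally show ?thesis .
qed

text \<open>
  Uniqueness of Haar measure: shifting in both variables of the double integral below shows that
  \<open>B \<mapsto> \<lambda>(T\<^sup>-\<^sup>1 B)\<close> is proportional to Lebesgue measure.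
\<close>

lemma distr_lebP_linear:
  fixes T S :: "('i \<Rightarrow> real) \<Rightarrow> ('i \<Rightarrow> real)"
  assumes I: "finite I"
    and T[measurable]: "T \<in> measurable (lebP I) (lebP I)" and S[measurable]: "S \<in> measurable (lebP I) (lebP I)"
    and ST: "\<And>x. x \<in> space (lebP I) \<Longrightarrow> S (T x) = x" and TS: "\<And>x. x \<in> space (lebP I) \<Longrightarrow> T (S x) = x"
    and add: "\<And>x y. x \<in> space (lebP I) \<Longrightarrow> y \<in> space (lebP I) \<Longrightarrow> T (\<lambda>k\<in>I. x k + y k) = (\<lambda>k\<in>I. T x k + T y k)"
  shows "\<exists>c. c \<noteq> 0 \<and> c \<noteq> \<infinity> \<and> distr (lebP I) (lebP I) T = density (lebP I) (\<lambda>_. c)"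
proof -
  interpret P: finite_product_sigma_finite "\<lambda>_::'i. lborel :: real measure" I by standard (rule I)
  interpret PP: pair_sigma_finite "lebP I" "lebP I" by standard
  have sp: "space (lebP I) = extensional I" by (auto simp: space_PiM PiE_def)
  have Tsp: "T x \<in> extensional I" if "x \<in> extensional I" for x
    using measurable_space[OF T] that sp by auto
  have Ssp: "S x \<in> extensional I" if "x \<in> extensional I" for x
    using measurable_space[OF S] that sp by auto
  let ?m = "\<lambda>A. (\<integral>\<^sup>+x. indicator A (T x) \<partial>lebP I)"
  \<comment> \<open>Both sides equal the double integral of the indicator of \<open>A\<close> at
    \<open>T x\<close> times the indicator of \<open>B\<close> at \<open>T x + y\<close>.\<close>
  have key: "?m A * emeasure (lebP I) B = ?m B * emeasure (lebP I) A"
    if A[measurable]: "A \<in> sets (lebP I)" and B[measurable]: "B \<in> sets (lebP I)" for A B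
  proof -
    let ?iA = "indicator A :: _ \<Rightarrow> ennreal" and ?iB = "indicator B :: _ \<Rightarrow> ennreal"
    have iA[measurable]: "?iA \<in> borel_measurable (lebP I)" and iB[measurable]: "?iB \<in> borel_measurable (lebP I)"
      by auto
    have shB: "(\<integral>\<^sup>+y. ?iB y \<partial>lebP I) = (\<integral>\<^sup>+y. ?iB (\<lambda>k\<in>I. a k + y k) \<partial>lebP I)" for a
      using nn_integral_lebP_affine[OF I, of 1 ?iB a] by simp
    have shA: "(\<integral>\<^sup>+y. ?iA (\<lambda>k\<in>I. a k - y k) \<partial>lebP I) = (\<integral>\<^sup>+y. ?iA y \<partial>lebP I)" for a
      using nn_integral_lebP_affine[OF I, of "-1" ?iA a] by simp
    have mT: "(\<lambda>z. T (fst z)) \<in> measurable (lebP I \<Otimes>\<^sub>M lebP I) (lebP I)" 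
      "(\<lambda>z. T (snd z)) \<in> measurable (lebP I \<Otimes>\<^sub>M lebP I) (lebP I)" by measurable
    have mTk: "(\<lambda>z. T (fst z) k) \<in> borel_measurable (lebP I \<Otimes>\<^sub>M lebP I)"
      "(\<lambda>z. snd z k) \<in> borel_measurable (lebP I \<Otimes>\<^sub>M lebP I)" if "k \<in> I" for k
      using measurable_compose[OF mT(1) measurable_component_singleton[OF that]]
        measurable_compose[OF measurable_snd[of "lebP I" "lebP I"] measurable_component_singleton[OF that]] by simp_all
    have p1: "(\<lambda>z. \<lambda>k\<in>I. T (fst z) k + snd z k) \<in> measurable (lebP I \<Otimes>\<^sub>M lebP I) (lebP I)"
      and p2: "(\<lambda>z. \<lambda>k\<in>I. T (fst z) k - snd z k) \<in> measurable (lebP I \<Otimes>\<^sub>M lebP I) (lebP I)"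
      using mTk by (auto intro!: measurable_restrict borel_measurable_add borel_measurable_diff simp: measurable_lborel1 measurable_lborel2)
    have mm1: "(\<lambda>z. ?iA (T (fst z)) * ?iB (\<lambda>k\<in>I. T (fst z) k + snd z k)) \<in> borel_measurable (lebP I \<Otimes>\<^sub>M lebP I)"
      by (rule borel_measurable_times_ennreal[OF measurable_compose[OF mT(1) iA] measurable_compose[OF p1 iB]])
    have mm2: "(\<lambda>z. ?iA (\<lambda>k\<in>I. T (fst z) k - snd z k) * ?iB (T (fst z))) \<in> borel_measurable (lebP I \<Otimes>\<^sub>M lebP I)"
      by (rule borel_measurable_times_ennreal[OF measurable_compose[OF p2 iA] measurable_compose[OF mT(1) iB]])
    have "?m A * emeasure (lebP I) B = (\<integral>\<^sup>+x. ?iA (T x) * (\<integral>\<^sup>+y. ?iB y \<partial>lebP I) \<partial>lebP I)"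
      by (simp add: nn_integral_multc)
    also have "\<dots> = (\<integral>\<^sup>+x. (\<integral>\<^sup>+y. ?iA (T x) * ?iB (\<lambda>k\<in>I. T x k + y k) \<partial>lebP I) \<partial>lebP I)"
    proof (rule nn_integral_cong)
      fix x assume "x \<in> space (lebP I)"
      show "?iA (T x) * (\<integral>\<^sup>+y. ?iB y \<partial>lebP I) = (\<integral>\<^sup>+y. ?iA (T x) * ?iB (\<lambda>k\<in>I. T x k + y k) \<partial>lebP I)"
        by (subst nn_integral_cmult) (auto simp: shB[of "T x", symmetric])
    qed
    also have "\<dots> = (\<integral>\<^sup>+y. (\<integral>\<^sup>+x. ?iA (T x) * ?iB (\<lambda>k\<in>I. T x k + y k) \<partial>lebP I) \<partial>lebP I)"
      using PP.Fubini'[of "\<lambda>x y. ?iA (T x) * ?iB (\<lambda>k\<in>I. T x k + y k)"] mm1 by (simp add: split_beta')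
    \<comment> \<open>For fixed \<open>y\<close> the translation of \<open>x\<close> by
      \<open>S y\<close> replaces \<open>T x\<close> by \<open>y + T x\<close>; this is where
      additivity of \<open>T\<close> enters.\<close>
    also have "\<dots> = (\<integral>\<^sup>+y. (\<integral>\<^sup>+x. ?iA (\<lambda>k\<in>I. T x k - y k) * ?iB (T x) \<partial>lebP I) \<partial>lebP I)"
    proof (rule nn_integral_cong)
      fix y assume y: "y \<in> space (lebP I)"
      let ?g = "\<lambda>x. ?iA (\<lambda>k\<in>I. T x k - y k) * ?iB (T x)"
      have y': "y \<in> extensional I" using y sp by simp
      have mmT: "(\<lambda>x. T x k) \<in> borel_measurable (lebP I)" if "k \<in> I" for k
        using measurable_compose[OF T measurable_component_singleton[OF that]] by simp
      have p: "(\<lambda>x. \<lambda>k\<in>I. T x k - y k) \<in> measurable (lebP I) (lebP I)"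
        using mmT by (auto intro!: measurable_restrict)
      have g: "?g \<in> borel_measurable (lebP I)"
        by (rule borel_measurable_times_ennreal[OF measurable_compose[OF p iA] measurable_compose[OF T iB]])
      have "(\<integral>\<^sup>+x. ?g x \<partial>lebP I) = (\<integral>\<^sup>+x. ?g (\<lambda>k\<in>I. S y k + x k) \<partial>lebP I)"
        using nn_integral_lebP_affine[OF I, of 1 ?g "S y"] g by simp
      also have "\<dots> = (\<integral>\<^sup>+x. ?iA (T x) * ?iB (\<lambda>k\<in>I. T x k + y k) \<partial>lebP I)"
      proof (rule nn_integral_cong)
        fix x assume x: "x \<in> space (lebP I)"
        have e: "T (\<lambda>k\<in>I. S y k + x k) = (\<lambda>k\<in>I. y k + T x k)"
          using add[of "S y" x] x y TS Ssp sp y' by simp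
        have "(\<lambda>k\<in>I. T (\<lambda>k\<in>I. S y k + x k) k - y k) = T x"
          using Tsp[of x] x sp unfolding e by (auto simp: extensional_def fun_eq_iff)
        then show "?g (\<lambda>k\<in>I. S y k + x k) = ?iA (T x) * ?iB (\<lambda>k\<in>I. T x k + y k)"
          unfolding e by (simp add: add.commute)
      qed
      finally show "(\<integral>\<^sup>+x. ?iA (T x) * ?iB (\<lambda>k\<in>I. T x k + y k) \<partial>lebP I) = (\<integral>\<^sup>+x. ?g x \<partial>lebP I)" by simp
    qed
    also have "\<dots> = (\<integral>\<^sup>+x. (\<integral>\<^sup>+y. ?iA (\<lambda>k\<in>I. T x k - y k) * ?iB (T x) \<partial>lebP I) \<partial>lebP I)"
      using PP.Fubini'[of "\<lambda>x y. ?iA (\<lambda>k\<in>I. T x k - y k) * ?iB (T x)"] mm2 by (simp add: split_beta')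
    also have "\<dots> = (\<integral>\<^sup>+x. ?iB (T x) * emeasure (lebP I) A \<partial>lebP I)"
    proof (rule nn_integral_cong)
      fix x assume "x \<in> space (lebP I)"
      have m: "(\<lambda>y. ?iA (\<lambda>k\<in>I. T x k - y k)) \<in> borel_measurable (lebP I)"
        using measurable_compose[OF _ iA, of "(\<lambda>y. \<lambda>k\<in>I. T x k - y k)" "lebP I"] by measurable
      show "(\<integral>\<^sup>+y. ?iA (\<lambda>k\<in>I. T x k - y k) * ?iB (T x) \<partial>lebP I) = ?iB (T x) * emeasure (lebP I) A"
        by (subst nn_integral_multc) (auto simp: shA mult.commute m)
    qed
    also have "\<dots> = ?m B * emeasure (lebP I) A"
      by (simp add: nn_integral_multc)
    finally show ?thesis .
  qed
  define B where "B = (\<Pi>\<^sub>E k\<in>I. {0..1::real})"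
  have B[measurable]: "B \<in> sets (lebP I)" unfolding B_def by (intro sets_PiM_I_finite I) auto
  have B1: "emeasure (lebP I) B = 1"
    unfolding B_def using lebP.emeasure_PiM[OF I, of "\<lambda>_. {0..1}"] by simp
  define c where "c = ?m B"
  \<comment> \<open>The image of the unit cube under \<open>T\<close>. It has
    \<open>?m A = 1\<close>, so \<open>key\<close> gives \<open>1 = c * emeasure (lebP I) A\<close>,
    which excludes the values \<open>0\<close> and infinity for \<open>c\<close>.\<close>
  define A where "A = S -` B \<inter> space (lebP I)"
  have A: "A \<in> sets (lebP I)" unfolding A_def by measurable
  have "?m A = (\<integral>\<^sup>+x. indicator B x \<partial>lebP I)"
    by (intro nn_integral_cong) (auto simp: A_def indicator_def ST sp Tsp)
  then have "1 = c * emeasure (lebP I) A"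
    using key[OF A B] B1 by (simp add: c_def)
  then have c: "c \<noteq> 0" "c \<noteq> \<infinity>"
    by (metis mult_zero_left zero_neq_one) (metis \<open>1 = c * emeasure (lebP I) A\<close> ennreal_mult_eq_top_iff ennreal_one_neq_top infinity_ennreal_def mult_zero_right zero_neq_one)
  have "distr (lebP I) (lebP I) T = density (lebP I) (\<lambda>_. c)"
  proof (rule measure_eqI)
    fix A assume "A \<in> sets (distr (lebP I) (lebP I) T)"
    then have A: "A \<in> sets (lebP I)" by simp
    have "emeasure (distr (lebP I) (lebP I) T) A = ?m A"
      using A nn_integral_distr[OF T, of "indicator A"] by simp
    also have "\<dots> = c * emeasure (lebP I) A" using key[OF A B] B1 by (simp add: c_def)
    finally show "emeasure (distr (lebP I) (lebP I) T) A = emeasure (density (lebP I) (\<lambda>_. c)) A"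
      using A by (simp add: emeasure_density_const)
  qed simp
  with c show ?thesis by blast
qed

section \<open>Standard normal vectors\<close>

definition gauss :: "'i set \<Rightarrow> ('i \<Rightarrow> real) measure" where
  "gauss I = (\<Pi>\<^sub>M i\<in>I. density lborel std_normal_density)"

lemma prob_space_std_normal: "prob_space (density lborel std_normal_density)"
  by (rule prob_space_normal_density) simp

interpretation gauss: product_sigma_finite "\<lambda>_::'i. density lborel std_normal_density"
  by (intro product_sigma_finite.intro prob_space_imp_sigma_finite prob_space_std_normal)

lemma prob_space_gauss: "prob_space (gauss I)"
  unfolding gauss_def by (rule prob_space_PiM) (rule prob_space_std_normal)

lemma sets_gauss: "sets (gauss I) = sets (\<Pi>\<^sub>M i\<in>I. borel)"
  unfolding gauss_def by (intro sets_PiM_cong) auto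

lemma sets_gauss_lebP: "sets (gauss I) = sets (lebP I)"
  unfolding gauss_def by (intro sets_PiM_cong) auto

lemma space_gauss: "space (gauss I) = extensional I"
  unfolding gauss_def by (auto simp: space_PiM PiE_def)

lemma measurable_gauss_component:
  "k \<in> I \<Longrightarrow> (\<lambda>x. x k) \<in> borel_measurable (gauss I)"
  using measurable_component_singleton[of k I "\<lambda>_. borel"]
  by (simp add: measurable_cong_sets[OF sets_gauss refl])

lemma measurable_gauss_restrict:
  "(\<And>k. k \<in> I \<Longrightarrow> (\<lambda>x. f x k) \<in> borel_measurable M) \<Longrightarrow> (\<lambda>x. \<lambda>k\<in>I. f x k) \<in> measurable M (gauss I)"
  using measurable_restrict[of I "\<lambda>k x. f x k" M "\<lambda>_. borel"]
  by (simp add: measurable_cong_sets[OF refl sets_gauss])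

lemma gauss_eq_density:
  assumes I: "finite I"
  shows "gauss I = density (lebP I) (\<lambda>x. \<Prod>k\<in>I. ennreal (std_normal_density (x k)))"
  unfolding gauss_def
proof (rule gauss.PiM_eqI[OF I, symmetric])
  show "sets (density (lebP I) (\<lambda>x. \<Prod>k\<in>I. ennreal (std_normal_density (x k)))) =
    sets (\<Pi>\<^sub>M i\<in>I. density lborel std_normal_density)"
    by (simp cong: sets_PiM_cong)
  fix A :: "'a \<Rightarrow> real set" assume A: "\<And>i. i \<in> I \<Longrightarrow> A i \<in> sets (density lborel std_normal_density)"
  have AI: "Pi\<^sub>E I A \<in> sets (lebP I)" using A by (intro sets_PiM_I_finite I) auto
  have "emeasure (density (lebP I) (\<lambda>x. \<Prod>k\<in>I. ennreal (std_normal_density (x k)))) (Pi\<^sub>E I A)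
    = (\<integral>\<^sup>+x. (\<Prod>k\<in>I. ennreal (std_normal_density (x k))) * indicator (Pi\<^sub>E I A) x \<partial>lebP I)"
    using AI by (subst emeasure_density) auto
  also have "\<dots> = (\<integral>\<^sup>+x. (\<Prod>k\<in>I. ennreal (std_normal_density (x k)) * indicator (A k) (x k)) \<partial>lebP I)"
  proof (rule nn_integral_cong)
    fix x :: "'a \<Rightarrow> real" assume "x \<in> space (lebP I)"
    then have "indicator (Pi\<^sub>E I A) x = (\<Prod>k\<in>I. indicator (A k) (x k) :: ennreal)"
      using I by (auto simp: indicator_def space_PiM PiE_iff prod_zero_iff)
    then show "(\<Prod>k\<in>I. ennreal (std_normal_density (x k))) * indicator (Pi\<^sub>E I A) x = (\<Prod>k\<in>I. ennreal (std_normal_density (x k)) * indicator (A k) (x k))"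
      by (simp add: prod.distrib)
  qed
  also have "\<dots> = (\<Prod>k\<in>I. \<integral>\<^sup>+x. ennreal (std_normal_density x) * indicator (A k) x \<partial>lborel)"
    using A by (intro lebP.product_nn_integral_prod I) auto
  also have "\<dots> = (\<Prod>k\<in>I. emeasure (density lborel std_normal_density) (A k))"
    using A by (intro prod.cong refl) (auto simp: emeasure_density)
  finally show "emeasure (density (lebP I) (\<lambda>x. \<Prod>k\<in>I. ennreal (std_normal_density (x k)))) (Pi\<^sub>E I A)
     = (\<Prod>k\<in>I. emeasure (density lborel std_normal_density) (A k))" .
qed

text \<open>The density depends on \<open>x\<close> only through the sum of squares. Hence
  isometries leave it invariant, and it can be absorbed into the radial function in polar
  coordinates.\<close>

lemma gauss_density_eq:
  assumes I: "finite I"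
  shows "(\<Prod>k\<in>I. ennreal (std_normal_density (x k))) =
    ennreal ((1 / sqrt (2 * pi)) ^ card I * exp (- (\<Sum>k\<in>I. (x k)\<^sup>2) / 2))"
proof -
  have "(\<Prod>k\<in>I. ennreal (std_normal_density (x k))) = ennreal (\<Prod>k\<in>I. std_normal_density (x k))"
    by (intro prod_ennreal) (auto simp: std_normal_density_def)
  also have "(\<Prod>k\<in>I. std_normal_density (x k)) = (1 / sqrt (2 * pi)) ^ card I * (\<Prod>k\<in>I. exp (- (x k)\<^sup>2 / 2))"
    by (simp add: std_normal_density_def prod.distrib prod_dividef power_divide)
  also have "(\<Prod>k\<in>I. exp (- (x k)\<^sup>2 / 2)) = exp (- (\<Sum>k\<in>I. (x k)\<^sup>2) / 2)"
    using I by (simp add: exp_sum[symmetric] sum_negf sum_divide_distrib)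
  finally show ?thesis .
qed

section \<open>Isometries and Householder reflections\<close>

definition gauss_preserving :: "'i set \<Rightarrow> (('i \<Rightarrow> real) \<Rightarrow> 'i \<Rightarrow> real) \<Rightarrow> bool" where
  "gauss_preserving I T \<longleftrightarrow> T \<in> measurable (gauss I) (gauss I) \<and> distr (gauss I) (gauss I) T = gauss I"

lemma gauss_preserving_id: "gauss_preserving I (\<lambda>x. x)"
  unfolding gauss_preserving_def by (simp add: distr_id)

lemma gauss_preserving_comp:
  assumes "gauss_preserving I S" "gauss_preserving I T"
  shows "gauss_preserving I (\<lambda>x. S (T x))"
proof -
  have "distr (gauss I) (gauss I) (S \<circ> T) = distr (distr (gauss I) (gauss I) T) (gauss I) S"
    using assms by (intro distr_distr[symmetric]) (auto simp: gauss_preserving_def)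
  then show ?thesis
    using assms by (auto simp: gauss_preserving_def comp_def)
qed

text \<open>\<open>T\<close> multiplies Lebesgue measure by some constant and leaves the Gaussian
  density unchanged. Both measures have mass \<open>1\<close>, so the constant is \<open>1\<close>;
  no determinant is computed.\<close>

lemma gauss_preserving_isometry:
  fixes T S :: "('i \<Rightarrow> real) \<Rightarrow> ('i \<Rightarrow> real)"
  assumes I: "finite I"
    and T: "T \<in> measurable (lebP I) (lebP I)" and S: "S \<in> measurable (lebP I) (lebP I)"
    and ST: "\<And>x. x \<in> space (lebP I) \<Longrightarrow> S (T x) = x" and TS: "\<And>x. x \<in> space (lebP I) \<Longrightarrow> T (S x) = x"
    and add: "\<And>x y. x \<in> space (lebP I) \<Longrightarrow> y \<in> space (lebP I) \<Longrightarrow> T (\<lambda>k\<in>I. x k + y k) = (\<lambda>k\<in>I. T x k + T y k)"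
    and iso: "\<And>x. x \<in> space (lebP I) \<Longrightarrow> (\<Sum>k\<in>I. (T x k)\<^sup>2) = (\<Sum>k\<in>I. (x k)\<^sup>2)"
  shows "gauss_preserving I T"
proof -
  let ?g = "\<lambda>x. \<Prod>k\<in>I. ennreal (std_normal_density (x k))"
  obtain c where c: "distr (lebP I) (lebP I) T = density (lebP I) (\<lambda>_. c)"
    using distr_lebP_linear[OF I T S ST TS add] by blast
  have T': "T \<in> measurable (gauss I) (gauss I)"
    using T by (simp add: measurable_cong_sets[OF sets_gauss_lebP sets_gauss_lebP])
  have g: "?g \<in> borel_measurable (lebP I)" by measurable
  have gT: "density (lebP I) ?g = density (lebP I) (\<lambda>x. ?g (T x))"
    by (rule density_cong[OF g measurable_compose[OF T g]]) (auto simp: gauss_density_eq[OF I] iso)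
  have "distr (gauss I) (gauss I) T = distr (density (lebP I) (\<lambda>x. ?g (T x))) (lebP I) T"
    unfolding gT[symmetric] by (rule distr_cong) (simp_all add: gauss_eq_density[OF I])
  also have "\<dots> = density (density (lebP I) (\<lambda>_. c)) ?g"
    by (subst density_distr[symmetric, OF g T]) (simp add: c)
  also have "\<dots> = density (gauss I) (\<lambda>_. c)"
    unfolding gauss_eq_density[OF I] using g by (simp add: density_density_eq mult.commute)
  finally have d: "distr (gauss I) (gauss I) T = density (gauss I) (\<lambda>_. c)" .
  interpret G: prob_space "gauss I" by (rule prob_space_gauss)
  interpret G': prob_space "density (gauss I) (\<lambda>_. c)"
    unfolding d[symmetric] by (rule G.prob_space_distr[OF T'])
  have "c = 1"
    using G'.emeasure_space_1 by (simp add: emeasure_density_const G.emeasure_space_1)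
  then show ?thesis using d T' by (simp add: gauss_preserving_def density_1)
qed

text \<open>The Householder reflection in the hyperplane orthogonal to \<open>u\<close>. If
  \<open>u\<close> vanishes on \<open>I\<close>, the quotient is \<open>0\<close> by the convention
  for division and the map is the restriction to \<open>I\<close>, so the lemmas below hold for
  every \<open>u\<close>.\<close>

definition reflect :: "'i set \<Rightarrow> ('i \<Rightarrow> real) \<Rightarrow> ('i \<Rightarrow> real) \<Rightarrow> ('i \<Rightarrow> real)" where
  "reflect I u x = (\<lambda>k\<in>I. x k - 2 * (\<Sum>l\<in>I. u l * x l) / (\<Sum>l\<in>I. u l * u l) * u k)"

lemma sum_reflect:
  assumes "finite I"
  shows "(\<Sum>l\<in>I. reflect I u x l * reflect I u y l) = (\<Sum>l\<in>I. x l * y l)"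
proof -
  let ?i = "\<lambda>x y. \<Sum>l\<in>I. x l * y l :: real"
  let ?a = "2 * ?i u x / ?i u u" and ?b = "2 * ?i u y / ?i u u"
  have "(\<Sum>l\<in>I. reflect I u x l * reflect I u y l) = (\<Sum>l\<in>I. x l * y l - ?a * (u l * y l) - ?b * (u l * x l) + ?a * ?b * (u l * u l))"
    by (intro sum.cong) (auto simp: reflect_def algebra_simps)
  also have "\<dots> = ?i x y - ?a * ?i u y - ?b * ?i u x + ?a * ?b * ?i u u"
    by (simp only: sum.distrib sum_subtractf sum_distrib_left[symmetric])
  also have "\<dots> = ?i x y"
    by (cases "?i u u = 0") (simp_all add: field_simps)
  finally show ?thesis .
qed

lemma sum_mult_reflect:
  assumes "finite I"
  shows "(\<Sum>l\<in>I. u l * reflect I u x l) = - (\<Sum>l\<in>I. u l * x l)"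
proof (cases "(\<Sum>l\<in>I. u l * u l) = 0")
  case True
  then have "u l = 0" if "l \<in> I" for l
    using assms that by (subst (asm) sum_nonneg_eq_0_iff) auto
  then show ?thesis by (simp add: reflect_def)
next
  case False
  let ?i = "\<lambda>x y. \<Sum>l\<in>I. x l * y l :: real"
  let ?a = "2 * ?i u x / ?i u u"
  have "(\<Sum>l\<in>I. u l * reflect I u x l) = (\<Sum>l\<in>I. u l * x l - ?a * (u l * u l))"
    by (intro sum.cong) (auto simp: reflect_def algebra_simps)
  also have "\<dots> = ?i u x - ?a * ?i u u"
    by (simp only: sum_subtractf sum_distrib_left[symmetric])
  finally show ?thesis using False by simp
qed

lemma reflect_reflect:
  assumes "finite I" "x \<in> extensional I"
  shows "reflect I u (reflect I u x) = x"
proof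
  fix k
  show "reflect I u (reflect I u x) k = x k"
  proof (cases "k \<in> I")
    case True
    have "reflect I u (reflect I u x) k = reflect I u x k - 2 * (\<Sum>l\<in>I. u l * reflect I u x l) / (\<Sum>l\<in>I. u l * u l) * u k"
      using True by (subst reflect_def) simp
    then show ?thesis unfolding sum_mult_reflect[OF assms(1)] using True by (simp add: reflect_def)
  next
    case False
    then show ?thesis using assms by (simp add: reflect_def extensional_def)
  qed
qed

lemma gauss_preserving_reflect:
  fixes I :: "'i set"
  assumes I: "finite I"
  shows "gauss_preserving I (reflect I u)"
proof -
  have m: "reflect I u \<in> measurable (lebP I) (lebP I)"
    unfolding reflect_def[abs_def] by measurable
  have sp: "space (lebP I) = extensional I" by (auto simp: space_PiM PiE_def)
  show ?thesis
  proof (rule gauss_preserving_isometry[OF I m m])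
    fix x :: "'i \<Rightarrow> real" assume x: "x \<in> space (lebP I)"
    show "reflect I u (reflect I u x) = x" using reflect_reflect[OF I] x sp by auto
    then show "reflect I u (reflect I u x) = x" .
    show "(\<Sum>k\<in>I. (reflect I u x k)\<^sup>2) = (\<Sum>k\<in>I. (x k)\<^sup>2)"
      using sum_reflect[OF I, of u x x] by (simp add: power2_eq_square)
    fix y :: "'i \<Rightarrow> real"
    have "(\<Sum>l\<in>I. u l * (\<lambda>k\<in>I. x k + y k) l) = (\<Sum>l\<in>I. u l * x l) + (\<Sum>l\<in>I. u l * y l)"
      by (simp add: sum.distrib[symmetric] algebra_simps)
    then show "reflect I u (\<lambda>k\<in>I. x k + y k) = (\<lambda>k\<in>I. reflect I u x k + reflect I u y k)"
      by (auto simp: reflect_def fun_eq_iff add_divide_distrib algebra_simps)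
  qed
qed

text \<open>With \<open>s\<close> the norm of \<open>x\<close> on \<open>D\<close>, the reflection
  along \<open>x - s e_k\<close>, cut off to \<open>D\<close>, sends the part of \<open>x\<close> on
  \<open>D\<close> to \<open>s e_k\<close>. As a reflection it also keeps the inner products over
  \<open>D\<close> of all other vectors, which Gram matrices require.\<close>

lemma ex_gauss_preserving_householder:
  fixes I D :: "'i set"
  assumes I: "finite I" and D: "D \<subseteq> I" and k: "k \<in> D"
  shows "\<exists>H. gauss_preserving I H \<and> (\<forall>y. \<forall>l\<in>I - D. H y l = y l)
    \<and> (\<forall>y y'. (\<Sum>l\<in>D. H y l * H y' l) = (\<Sum>l\<in>D. y l * y' l)) \<and> (\<forall>l\<in>D - {k}. H x l = 0)"
proof -
  have fD: "finite D" using I D finite_subset by blast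
  define s where "s = sqrt (\<Sum>l\<in>D. x l * x l)"
  define v where "v l = x l - (if l = k then s else 0)" for l
  define u where "u l = (if l \<in> D then v l else 0)" for l
  have ss: "s * s = (\<Sum>l\<in>D. x l * x l)" unfolding s_def by (simp add: sum_nonneg)
  have sD: "(\<Sum>l\<in>I. u l * y l) = (\<Sum>l\<in>D. v l * y l)" for y
    using D I by (intro sum.mono_neutral_cong_right) (auto simp: u_def)
  have sum_v: "(\<Sum>l\<in>D. v l * y l) = (\<Sum>l\<in>D. x l * y l) - s * y k" for y
  proof -
    have "(\<Sum>l\<in>D. v l * y l) = (\<Sum>l\<in>D. x l * y l - (if l = k then s * y k else 0))"
      by (intro sum.cong) (auto simp: v_def algebra_simps)
    then show ?thesis using k fD by (simp add: sum_subtractf)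
  qed
  have uu: "(\<Sum>l\<in>I. u l * u l) = (\<Sum>l\<in>D. v l * v l)"
    unfolding sD by (intro sum.cong) (auto simp: u_def)
  \<comment> \<open>Since \<open>x\<close> and \<open>s e_k\<close> have equal norms on
    \<open>D\<close>, the reflection subtracts exactly \<open>v\<close> from
    \<open>x\<close>.\<close>
  have vv: "(\<Sum>l\<in>D. v l * v l) = 2 * (\<Sum>l\<in>D. v l * x l)"
  proof -
    have "(\<Sum>l\<in>D. v l * v l) = (\<Sum>l\<in>D. v l * x l) - s * v k"
      using sum_v[of v] by (simp add: mult.commute)
    moreover have "s * v k = s * x k - s * s" by (simp add: v_def algebra_simps)
    ultimately show ?thesis using sum_v[of x] ss by simp
  qed
  have ul: "u l = v l" if "l \<in> D" for l using that by (simp add: u_def)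
  have eqD: "reflect I u y l = reflect D v y l" if "l \<in> D" for y l
    using that D by (auto simp: reflect_def sD uu ul)
  let ?H = "reflect I u"
  have "gauss_preserving I ?H" by (rule gauss_preserving_reflect[OF I])
  moreover have "\<forall>y. \<forall>l\<in>I - D. ?H y l = y l" by (auto simp: reflect_def u_def)
  moreover have "\<forall>y y'. (\<Sum>l\<in>D. ?H y l * ?H y' l) = (\<Sum>l\<in>D. y l * y' l)"
    using sum_reflect[OF fD, of v] by (simp add: eqD)
  moreover have "\<forall>l\<in>D - {k}. ?H x l = 0"
  proof
    fix l assume l: "l \<in> D - {k}"
    then have vl: "v l = x l" by (simp add: v_def)
    have H: "?H x l = x l - 2 * (\<Sum>l\<in>D. v l * x l) / (\<Sum>l\<in>D. v l * v l) * v l"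
      using l by (simp add: eqD) (simp add: reflect_def)
    show "?H x l = 0"
    proof (cases "(\<Sum>l\<in>D. v l * v l) = 0")
      case True
      then have "\<forall>l\<in>D. v l * v l = 0" using fD by (subst (asm) sum_nonneg_eq_0_iff) auto
      then have "v l = 0" using l by auto
      then show ?thesis using vl by (simp add: H)
    next
      case False
      then show ?thesis unfolding H vl vv by simp
    qed
  qed
  ultimately show ?thesis by blast
qed

section \<open>Squared norms and polar coordinates\<close>

definition sqn :: "'i set \<Rightarrow> ('i \<Rightarrow> real) \<Rightarrow> real" where
  "sqn D x = (\<Sum>k\<in>D. (x k)\<^sup>2)"

lemma sqn_nonneg: "0 \<le> sqn D x"
  by (simp add: sqn_def sum_nonneg)

lemma measurable_sqn:
  assumes "D \<subseteq> I"
  shows "sqn D \<in> borel_measurable (gauss I)"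
proof -
  have "(\<lambda>x. x k) \<in> borel_measurable (gauss I)" if "k \<in> D" for k
    using that assms by (intro measurable_gauss_component) auto
  then show ?thesis unfolding sqn_def[abs_def] by (intro borel_measurable_sum borel_measurable_power)
qed

lemma sqn_scale: "finite D \<Longrightarrow> sqn D (\<lambda>k\<in>D. r * x k) = r\<^sup>2 * sqn D x"
  by (simp add: sqn_def power_mult_distrib sum_distrib_left)

lemma nn_integral_lborel_mult:
  fixes c :: real assumes c: "0 < c" and f: "f \<in> borel_measurable borel"
  shows "(\<integral>\<^sup>+t. f (c * t) * indicator {0<..} t \<partial>lborel) = ennreal (1 / c) * (\<integral>\<^sup>+t. f t * indicator {0<..} t \<partial>lborel)"
proof -
  have "(\<integral>\<^sup>+t. f t * indicator {0<..} t \<partial>lborel) = ennreal c * (\<integral>\<^sup>+t. f (c * t) * indicator {0<..} (c * t) \<partial>lborel)"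
    using nn_integral_real_affine[of "\<lambda>t. f t * indicator {0<..} t" c 0] f c by simp
  also have "(\<integral>\<^sup>+t. f (c * t) * indicator {0<..} (c * t) \<partial>lborel) = (\<integral>\<^sup>+t. f (c * t) * indicator {0<..} t \<partial>lborel)"
    using c by (intro nn_integral_cong) (auto simp: indicator_def zero_less_mult_iff)
  finally show ?thesis using c by (simp add: mult.assoc[symmetric] ennreal_mult[symmetric])
qed

text \<open>
  Polar coordinates for a function that is homogeneous of degree \<open>0\<close>: insert
  \<open>1 = \<integral>\<^sub>0\<^bsup>sqn x\<^esup> dt / sqn x\<close>, exchange the integrals and substitute \<open>x = \<surd>t y\<close>.
\<close>

lemma nn_integral_lebP_polar:
  fixes D :: "'i set" and g :: "('i \<Rightarrow> real) \<Rightarrow> ennreal"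
  assumes D: "finite D" "D \<noteq> {}"
    and g: "g \<in> borel_measurable (lebP D)"
    and hom: "\<And>r x. 0 < r \<Longrightarrow> x \<in> extensional D \<Longrightarrow> g (\<lambda>k\<in>D. r * x k) = g x"
  shows "\<exists>C. \<forall>F\<in>borel_measurable borel. (\<integral>\<^sup>+x. g x * F (sqn D x) \<partial>lebP D)
    = C * (\<integral>\<^sup>+t. F t * ennreal (t powr (card D / 2 - 1)) * indicator {0<..} t \<partial>lborel)"
proof -
  interpret P: finite_product_sigma_finite "\<lambda>_::'i. lborel :: real measure" D by standard (rule D)
  interpret PP: pair_sigma_finite "lebP D" lborel by standard
  have sp: "space (lebP D) = extensional D" by (auto simp: space_PiM PiE_def)
  let ?d = "real (card D)"
  have Q[measurable]: "sqn D \<in> borel_measurable (lebP D)"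
    unfolding sqn_def[abs_def] by measurable
  \<comment> \<open>Under \<open>x = sqrt t * y\<close> the condition \<open>t \<le> sqn D x\<close>
    becomes \<open>1 \<le> sqn D y\<close>, and \<open>1 / sqn D x\<close> splits into
    \<open>1 / sqn D y\<close> and \<open>1 / t\<close>. \<open>h\<close> collects the factors in
    \<open>y\<close> other than \<open>F\<close>.\<close>
  define h where "h x = g x * indicator {1..} (sqn D x) * ennreal (1 / sqn D x)" for x
  define C where "C = (\<integral>\<^sup>+x. h x * ennreal (sqn D x powr (- ?d / 2)) \<partial>lebP D)"
  note g[measurable]
  have h[measurable]: "h \<in> borel_measurable (lebP D)" unfolding h_def[abs_def] by measurable
  have AE0: "AE x in lebP D. sqn D x > 0"
  proof (rule AE_I)
    show "(\<Pi>\<^sub>E k\<in>D. {0::real}) \<in> sets (lebP D)" by (intro sets_PiM_I_finite D) auto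
    show "emeasure (lebP D) (\<Pi>\<^sub>E k\<in>D. {0::real}) = 0"
      using D lebP.emeasure_PiM[OF D(1), of "\<lambda>_. {0}"] by (simp add: card_gt_0_iff)
    have "x k = 0" if "x \<in> extensional D" "\<not> 0 < sqn D x" "k \<in> D" for x k
    proof -
      have "sqn D x = 0" using that sqn_nonneg[of D x] by simp
      then show ?thesis using that D unfolding sqn_def by (subst (asm) sum_nonneg_eq_0_iff) auto
    qed
    then show "{x \<in> space (lebP D). \<not> 0 < sqn D x} \<subseteq> (\<Pi>\<^sub>E k\<in>D. {0::real})"
      by (auto simp: sp PiE_iff extensional_def fun_eq_iff)
  qed
  show ?thesis
  proof (intro exI[of _ C] ballI)
    fix F :: "real \<Rightarrow> ennreal" assume F[measurable]: "F \<in> borel_measurable borel"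
    let ?p = "\<lambda>x t. g x * F (sqn D x) * ennreal (1 / sqn D x) * indicator {t..} (sqn D x) * indicator {0<..} t"
    let ?W = "\<lambda>t. F t * ennreal (t powr (?d / 2 - 1))"
    have "(\<integral>\<^sup>+x. g x * F (sqn D x) \<partial>lebP D) = (\<integral>\<^sup>+x. (\<integral>\<^sup>+t. ?p x t \<partial>lborel) \<partial>lebP D)"
    proof (rule nn_integral_cong_AE, use AE0 in eventually_elim)
      fix x :: "'i \<Rightarrow> real" assume q: "0 < sqn D x"
      have "(\<integral>\<^sup>+t. ?p x t \<partial>lborel) = (\<integral>\<^sup>+t. g x * F (sqn D x) * ennreal (1 / sqn D x) * indicator {0<..sqn D x} t \<partial>lborel)"
        by (intro nn_integral_cong) (auto simp: indicator_def)
      also have "\<dots> = g x * F (sqn D x) * ennreal (1 / sqn D x) * ennreal (sqn D x)"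
        using q by (simp add: nn_integral_cmult)
      also have "\<dots> = g x * F (sqn D x)" using q by (simp add: mult.assoc ennreal_mult[symmetric])
      finally show "g x * F (sqn D x) = (\<integral>\<^sup>+t. ?p x t \<partial>lborel)" by simp
    qed
    also have "\<dots> = (\<integral>\<^sup>+t. (\<integral>\<^sup>+x. ?p x t \<partial>lebP D) \<partial>lborel)"
    proof -
      have "(\<lambda>(x, t). ?p x t) = (\<lambda>z. g (fst z) * F (sqn D (fst z)) * ennreal (1 / sqn D (fst z)) *
          (if snd z \<le> sqn D (fst z) then 1 else 0) * (if 0 < snd z then 1 else 0))"
        by (auto simp: indicator_def fun_eq_iff)
      also have "\<dots> \<in> borel_measurable (lebP D \<Otimes>\<^sub>M lborel)" by measurable
      finally show ?thesis by (rule PP.Fubini'[symmetric])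
    qed
    also have "\<dots> = (\<integral>\<^sup>+t. (\<integral>\<^sup>+y. h y * ennreal (t powr (?d / 2 - 1)) * F (sqn D y * t) * indicator {0<..} t \<partial>lebP D) \<partial>lborel)"
    proof (rule nn_integral_cong)
      fix t :: real
      show "(\<integral>\<^sup>+x. ?p x t \<partial>lebP D) = (\<integral>\<^sup>+y. h y * ennreal (t powr (?d / 2 - 1)) * F (sqn D y * t) * indicator {0<..} t \<partial>lebP D)"
      proof (cases "0 < t")
        case t: True
        have pm: "(\<lambda>x. ?p x t) \<in> borel_measurable (lebP D)" by measurable
        have "ennreal ((1 / sqrt t) ^ card D) * (\<integral>\<^sup>+x. ?p x t \<partial>lebP D) = (\<integral>\<^sup>+y. ?p (\<lambda>k\<in>D. sqrt t * y k) t \<partial>lebP D)"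
          using nn_integral_lebP_affine[OF D(1) _ pm, of "sqrt t" "\<lambda>_. 0"] t by simp
        also have "\<dots> = (\<integral>\<^sup>+y. h y * ennreal (1 / t) * F (sqn D y * t) \<partial>lebP D)"
        proof (rule nn_integral_cong)
          fix y assume "y \<in> space (lebP D)"
          then have "g (\<lambda>k\<in>D. sqrt t * y k) = g y" using hom[of "sqrt t" y] t sp by simp
          moreover have "sqn D (\<lambda>k\<in>D. sqrt t * y k) = t * sqn D y" using t D by (simp add: sqn_scale)
          moreover have "ennreal (1 / (t * sqn D y)) = ennreal (1 / sqn D y) * ennreal (1 / t)"
            using t sqn_nonneg[of D y] by (simp add: ennreal_mult[symmetric] mult.commute)
          ultimately show "?p (\<lambda>k\<in>D. sqrt t * y k) t = h y * ennreal (1 / t) * F (sqn D y * t)"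
            using t by (auto simp: h_def indicator_def mult_ac)
        qed
        finally have e: "ennreal ((1 / sqrt t) ^ card D) * (\<integral>\<^sup>+x. ?p x t \<partial>lebP D) = (\<integral>\<^sup>+y. h y * ennreal (1 / t) * F (sqn D y * t) \<partial>lebP D)" .
        \<comment> \<open>The Jacobian of the substitution times the \<open>1 / t\<close> left over
          from \<open>1 / sqn D x\<close>.\<close>
        have pw: "sqrt t ^ card D * (1 / t) = t powr (?d / 2 - 1)"
          using t by (simp add: powr_diff powr_half_sqrt[symmetric] powr_realpow[symmetric] powr_powr)
        have "(\<integral>\<^sup>+x. ?p x t \<partial>lebP D) = ennreal (sqrt t ^ card D) * (ennreal ((1 / sqrt t) ^ card D) * (\<integral>\<^sup>+x. ?p x t \<partial>lebP D))"
          using t by (simp add: mult.assoc[symmetric] ennreal_mult[symmetric] power_divide)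
        also have "\<dots> = (\<integral>\<^sup>+y. ennreal (sqrt t ^ card D) * (h y * ennreal (1 / t) * F (sqn D y * t)) \<partial>lebP D)"
          unfolding e by (rule nn_integral_cmult[symmetric]) measurable
        also have "\<dots> = (\<integral>\<^sup>+y. h y * ennreal (t powr (?d / 2 - 1)) * F (sqn D y * t) * indicator {0<..} t \<partial>lebP D)"
        proof (rule nn_integral_cong)
          fix y
          have "ennreal (t powr (?d / 2 - 1)) = ennreal (sqrt t ^ card D) * ennreal (1 / t)"
            using t by (simp add: pw[symmetric] ennreal_mult[symmetric])
          then show "ennreal (sqrt t ^ card D) * (h y * ennreal (1 / t) * F (sqn D y * t)) = h y * ennreal (t powr (?d / 2 - 1)) * F (sqn D y * t) * indicator {0<..} t"
            using t by (simp add: mult_ac)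
        qed
        finally show ?thesis .
      qed simp
    qed
    also have "\<dots> = (\<integral>\<^sup>+y. (\<integral>\<^sup>+t. h y * ennreal (t powr (?d / 2 - 1)) * F (sqn D y * t) * indicator {0<..} t \<partial>lborel) \<partial>lebP D)"
    proof -
      have "(\<lambda>(y, t). h y * ennreal (t powr (?d / 2 - 1)) * F (sqn D y * t) * indicator {0<..} t)
         = (\<lambda>z. h (fst z) * ennreal (snd z powr (?d / 2 - 1)) * F (sqn D (fst z) * snd z) * (if 0 < snd z then 1 else 0))"
        by (auto simp: indicator_def fun_eq_iff)
      also have "\<dots> \<in> borel_measurable (lebP D \<Otimes>\<^sub>M lborel)" by measurable
      finally show ?thesis by (rule PP.Fubini')
    qed
    \<comment> \<open>A second substitution, \<open>t\<close> to \<open>t / sqn D y\<close>, frees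
      \<open>F\<close> from \<open>y\<close>; what remains in \<open>y\<close> integrates to
      \<open>C\<close>.\<close>
    also have "\<dots> = (\<integral>\<^sup>+y. h y * ennreal (sqn D y powr (- ?d / 2)) * (\<integral>\<^sup>+t. ?W t * indicator {0<..} t \<partial>lborel) \<partial>lebP D)"
    proof (rule nn_integral_cong_AE, use AE0 in eventually_elim)
      fix y :: "'i \<Rightarrow> real" assume q: "0 < sqn D y"
      let ?q = "sqn D y"
      have "(\<integral>\<^sup>+t. h y * ennreal (t powr (?d / 2 - 1)) * F (?q * t) * indicator {0<..} t \<partial>lborel)
        = (\<integral>\<^sup>+t. h y * ennreal (?q powr (1 - ?d / 2)) * (?W (?q * t) * indicator {0<..} t) \<partial>lborel)"
      proof (rule nn_integral_cong)
        fix t :: real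
        have "ennreal (t powr (?d / 2 - 1)) = ennreal (?q powr (1 - ?d / 2)) * ennreal ((?q * t) powr (?d / 2 - 1))" if "0 < t"
          using q that by (simp add: ennreal_mult[symmetric] powr_mult powr_diff)
        then show "h y * ennreal (t powr (?d / 2 - 1)) * F (?q * t) * indicator {0<..} t = 
          h y * ennreal (?q powr (1 - ?d / 2)) * (?W (?q * t) * indicator {0<..} t)"
          by (auto simp: indicator_def mult_ac)
      qed
      also have "\<dots> = h y * ennreal (?q powr (1 - ?d / 2)) * (\<integral>\<^sup>+t. ?W (?q * t) * indicator {0<..} t \<partial>lborel)"
        by (rule nn_integral_cmult) measurable
      also have "(\<integral>\<^sup>+t. ?W (?q * t) * indicator {0<..} t \<partial>lborel) = ennreal (1 / ?q) * (\<integral>\<^sup>+t. ?W t * indicator {0<..} t \<partial>lborel)"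
        by (rule nn_integral_lborel_mult[OF q]) measurable
      also have "h y * ennreal (?q powr (1 - ?d / 2)) * (ennreal (1 / ?q) * (\<integral>\<^sup>+t. ?W t * indicator {0<..} t \<partial>lborel))
        = h y * (ennreal (?q powr (1 - ?d / 2)) * ennreal (1 / ?q)) * (\<integral>\<^sup>+t. ?W t * indicator {0<..} t \<partial>lborel)"
        by (simp add: mult_ac)
      also have "ennreal (?q powr (1 - ?d / 2)) * ennreal (1 / ?q) = ennreal (?q powr (- ?d / 2))"
        using q powr_add[of ?q "- ?d / 2" 1] by (simp add: ennreal_mult[symmetric])
      finally show "(\<integral>\<^sup>+t. h y * ennreal (t powr (?d / 2 - 1)) * F (?q * t) * indicator {0<..} t \<partial>lborel)
        = h y * ennreal (?q powr (- ?d / 2)) * (\<integral>\<^sup>+t. ?W t * indicator {0<..} t \<partial>lborel)" .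
    qed
    also have "\<dots> = C * (\<integral>\<^sup>+t. ?W t * indicator {0<..} t \<partial>lborel)"
      unfolding C_def by (rule nn_integral_multc) measurable
    finally show "(\<integral>\<^sup>+x. g x * F (sqn D x) \<partial>lebP D) = C * (\<integral>\<^sup>+t. ?W t * indicator {0<..} t \<partial>lborel)" .
  qed
qed

text \<open>
  The power \<open>\<bar>x\<bar>\<^bsup>\<i>w\<^esup>\<close>. The value \<open>0\<close> at \<open>x = 0\<close> keeps it multiplicative, so that degenerate
  Gram matrices need no separate treatment.
\<close>

definition xi :: "real \<Rightarrow> real \<Rightarrow> complex" where
  "xi w x = (if x = 0 then 0 else exp (\<i> * of_real (w * ln \<bar>x\<bar>)))"

lemma xi_mult: "xi w (x * y) = xi w x * xi w y"
  by (auto simp: xi_def abs_mult ln_mult exp_add[symmetric] ring_distribs)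

lemma xi_0 [simp]: "xi w 0 = 0" by (simp add: xi_def)

lemma norm_xi_le: "norm (xi w x) \<le> 1" by (simp add: xi_def)

lemma xi_add: "xi (v + w) x = xi v x * xi w x"
  by (auto simp: xi_def exp_add[symmetric] ring_distribs)

lemma xi_sum:
  assumes "finite J" "J \<noteq> {}"
  shows "xi (\<Sum>j\<in>J. w j) x = (\<Prod>j\<in>J. xi (w j) x)"
  using assms by (induction rule: finite_ne_induct) (auto simp: xi_add)

lemma measurable_xi [measurable]: "xi w \<in> borel_measurable borel"
  unfolding xi_def[abs_def] by measurable

text \<open>
  The characteristic function of the logarithm of a chi-square variable with \<open>d\<close> degrees of freedom.
\<close>

definition chi_char :: "nat \<Rightarrow> real \<Rightarrow> complex" where
  "chi_char d w = exp (\<i> * of_real (w * ln 2)) * Gamma (Complex (d / 2) w) / Gamma (of_real (d / 2))"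

text \<open>Euler's integral, carried over from the gauge integral to the Lebesgue integral by
  absolute integrability and Borel measurability.\<close>

lemma LINT_Gamma:
  assumes z: "Re z > 0"
  shows "set_integrable lborel {0<..} (\<lambda>t. complex_of_real t powr (z - 1) / of_real (exp t))"
    and "(LINT t:{0<..}|lborel. complex_of_real t powr (z - 1) / of_real (exp t)) = Gamma z"
proof -
  let ?f = "\<lambda>t. complex_of_real t powr (z - 1) / of_real (exp t)"
  have m: "(\<lambda>t. indicator {0<..} t *\<^sub>R ?f t) \<in> borel_measurable lborel"
  proof -
    have "(\<lambda>t. indicator {0<..} t *\<^sub>R ?f t) = (\<lambda>t. indicator {0<..} t *\<^sub>R (exp ((z - 1) * of_real (ln t)) / of_real (exp t)))"
      by (auto simp: indicator_def powr_def Ln_of_real fun_eq_iff)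
    then show ?thesis by simp
  qed
  show i: "set_integrable lborel {0<..} ?f"
    using absolutely_integrable_Gamma_integral'[OF z] m
    unfolding set_integrable_def by (simp add: integrable_completion)
  show "(LINT t:{0<..}|lborel. ?f t) = Gamma z"
    using set_borel_integral_eq_integral(2)[OF i] Gamma_integral_complex'[OF z] by (simp add: integral_unique)
qed

text \<open>The substitution \<open>t = 2 * u\<close> leads to Euler's integral at
  \<open>Complex (d / 2) w\<close>. The power of \<open>2\<close> cancels later, in the
  normalisation at \<open>w = 0\<close>.\<close>

lemma LINT_chi:
  assumes "0 < d"
  shows "(\<integral>t. (indicator {0<..} t * (t powr (real d / 2 - 1) * exp (- t / 2))) *\<^sub>R xi w t \<partial>lborel)
    = of_real (2 powr (d / 2)) * (exp (\<i> * of_real (w * ln 2)) * Gamma (Complex (d / 2) w))"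
proof -
  let ?f = "\<lambda>t. (indicator {0<..} t * (t powr (real d / 2 - 1) * exp (- t / 2))) *\<^sub>R xi w t"
  let ?z = "Complex (d / 2) w"
  let ?c = "of_real (2 powr (real d / 2 - 1)) * exp (\<i> * of_real (w * ln 2))"
  have "(\<integral>t. ?f t \<partial>lborel) = 2 *\<^sub>R (\<integral>u. ?f (2 * u) \<partial>lborel)"
    using lborel_integral_real_affine[of 2 ?f 0] by simp
  also have "(\<lambda>u. ?f (2 * u)) = (\<lambda>u. ?c * (indicator {0<..} u *\<^sub>R (complex_of_real u powr (?z - 1) / of_real (exp u))))"
  proof
    fix u :: real
    show "?f (2 * u) = ?c * (indicator {0<..} u *\<^sub>R (complex_of_real u powr (?z - 1) / of_real (exp u)))"
    proof (cases "0 < u")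
      case True
      have "complex_of_real u powr (?z - 1) = exp (of_real ((real d / 2 - 1) * ln u) + \<i> * of_real (w * ln u))"
        using True by (simp add: powr_def Ln_of_real complex_eq_iff Re_exp Im_exp)
      also have "\<dots> = of_real (u powr (real d / 2 - 1)) * exp (\<i> * of_real (w * ln u))"
        using True by (simp add: exp_add powr_def exp_of_real[symmetric])
      finally have 1: "complex_of_real u powr (?z - 1) = of_real (u powr (real d / 2 - 1)) * exp (\<i> * of_real (w * ln u))" .
      have 2: "xi w (2 * u) = exp (\<i> * of_real (w * ln 2)) * exp (\<i> * of_real (w * ln u))"
        using True by (simp add: xi_def ln_mult exp_add[symmetric] ring_distribs)
      have 3: "(2 * u) powr (real d / 2 - 1) = 2 powr (real d / 2 - 1) * u powr (real d / 2 - 1)"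
        using True by (simp add: powr_mult)
      show ?thesis
        using True unfolding 1 2 3 by (simp add: scaleR_conv_of_real exp_minus divide_simps)
    qed simp
  qed
  also have "(\<integral>u. ?c * (indicator {0<..} u *\<^sub>R (complex_of_real u powr (?z - 1) / of_real (exp u))) \<partial>lborel) = ?c * Gamma ?z"
    unfolding integral_mult_right_zero using LINT_Gamma(2)[of ?z] assms by (simp add: set_lebesgue_integral_def)
  also have "2 *\<^sub>R (?c * Gamma ?z) = of_real (2 * 2 powr (real d / 2 - 1)) * (exp (\<i> * of_real (w * ln 2)) * Gamma ?z)"
    by (simp add: scaleR_conv_of_real)
  also have "2 * 2 powr (real d / 2 - 1) = (2::real) powr (d / 2)"
    using powr_add[of "2::real" 1 "d / 2 - 1"] by simp
  finally show ?thesis .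
qed

text \<open>The Gaussian density is a function of \<open>sqn D x\<close>, so it joins
  \<open>F\<close>, and its constant joins \<open>C\<close>. Only \<open>C\<close> depends on
  \<open>g\<close>; the radial weight is the same for every \<open>g\<close>.\<close>

lemma nn_integral_gauss_polar:
  fixes D :: "'i set" and g :: "('i \<Rightarrow> real) \<Rightarrow> ennreal"
  assumes D: "finite D" "D \<noteq> {}"
    and g: "g \<in> borel_measurable (gauss D)"
    and hom: "\<And>r x. 0 < r \<Longrightarrow> x \<in> extensional D \<Longrightarrow> g (\<lambda>k\<in>D. r * x k) = g x"
  shows "\<exists>C. \<forall>F\<in>borel_measurable borel. (\<integral>\<^sup>+x. g x * F (sqn D x) \<partial>gauss D)
    = C * (\<integral>\<^sup>+t. F t * ennreal (indicator {0<..} t * (t powr (card D / 2 - 1) * exp (- t / 2))) \<partial>lborel)"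
proof -
  have g'[measurable]: "g \<in> borel_measurable (lebP D)"
    using g by (simp add: measurable_cong_sets[OF sets_gauss_lebP refl])
  have Q[measurable]: "sqn D \<in> borel_measurable (lebP D)"
    unfolding sqn_def[abs_def] by measurable
  obtain C where C: "\<And>F. F \<in> borel_measurable borel \<Longrightarrow> (\<integral>\<^sup>+x. g x * F (sqn D x) \<partial>lebP D)
    = C * (\<integral>\<^sup>+t. F t * ennreal (t powr (card D / 2 - 1)) * indicator {0<..} t \<partial>lborel)"
    using nn_integral_lebP_polar[OF D g' hom] by blast
  let ?k = "(1 / sqrt (2 * pi)) ^ card D"
  show ?thesis
  proof (intro exI[of _ "C * ennreal ?k"] ballI)
    fix F :: "real \<Rightarrow> ennreal" assume F[measurable]: "F \<in> borel_measurable borel"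
    have "(\<integral>\<^sup>+x. g x * F (sqn D x) \<partial>gauss D) = (\<integral>\<^sup>+x. (\<Prod>k\<in>D. ennreal (std_normal_density (x k))) * (g x * F (sqn D x)) \<partial>lebP D)"
      unfolding gauss_eq_density[OF D(1)] by (rule nn_integral_density) measurable
    also have "\<dots> = (\<integral>\<^sup>+x. g x * (\<lambda>t. F t * (ennreal ?k * ennreal (exp (- t / 2)))) (sqn D x) \<partial>lebP D)"
      by (intro nn_integral_cong) (simp add: gauss_density_eq[OF D(1)] sqn_def[symmetric] ennreal_mult mult_ac)
    also have "\<dots> = C * (\<integral>\<^sup>+t. F t * (ennreal ?k * ennreal (exp (- t / 2))) * ennreal (t powr (card D / 2 - 1)) * indicator {0<..} t \<partial>lborel)"
      by (rule C) measurable
    also have "(\<integral>\<^sup>+t. F t * (ennreal ?k * ennreal (exp (- t / 2))) * ennreal (t powr (card D / 2 - 1)) * indicator {0<..} t \<partial>lborel)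
      = (\<integral>\<^sup>+t. ennreal ?k * (F t * ennreal (indicator {0<..} t * (t powr (card D / 2 - 1) * exp (- t / 2)))) \<partial>lborel)"
      by (intro nn_integral_cong) (auto simp: indicator_def ennreal_mult mult_ac)
    also have "\<dots> = ennreal ?k * (\<integral>\<^sup>+t. F t * ennreal (indicator {0<..} t * (t powr (card D / 2 - 1) * exp (- t / 2))) \<partial>lborel)"
      by (rule nn_integral_cmult) measurable
    finally show "(\<integral>\<^sup>+x. g x * F (sqn D x) \<partial>gauss D) = C * ennreal ?k * (\<integral>\<^sup>+t. F t * ennreal (indicator {0<..} t * (t powr (card D / 2 - 1) * exp (- t / 2))) \<partial>lborel)"
      by (simp add: mult.assoc)
  qed
qed

text \<open>The polar formula for \<open>g = 1\<close>. Total mass \<open>1\<close> shows that the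
  constant is neither \<open>0\<close> nor infinite; its value is left open.\<close>

lemma distr_sqn:
  assumes D: "finite D" "D \<noteq> {}"
  shows "\<exists>c>0. distr (gauss D) borel (sqn D)
    = density lborel (\<lambda>t. ennreal (c * (indicator {0<..} t * (t powr (card D / 2 - 1) * exp (- t / 2)))))"
proof -
  let ?W = "\<lambda>t. indicator {0<..} t * (t powr (card D / 2 - 1) * exp (- t / 2)) :: real"
  have mQ: "sqn D \<in> borel_measurable (gauss D)" by (rule measurable_sqn) simp
  obtain C where C: "\<And>F. F \<in> borel_measurable borel \<Longrightarrow> (\<integral>\<^sup>+x. F (sqn D x) \<partial>gauss D)
    = C * (\<integral>\<^sup>+t. F t * ennreal (?W t) \<partial>lborel)"
    using nn_integral_gauss_polar[OF D, of "\<lambda>_. 1"] by auto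
  interpret G: prob_space "gauss D" by (rule prob_space_gauss)
  have 1: "1 = C * (\<integral>\<^sup>+t. ennreal (?W t) \<partial>lborel)"
    using C[of "\<lambda>_. 1"] by (simp add: G.emeasure_space_1)
  then have c0: "C \<noteq> 0" by auto
  have "C \<noteq> \<infinity>"
    using 1 by (auto simp: ennreal_top_mult split: if_splits)
  then obtain c where c: "C = ennreal c" "0 \<le> c" by (cases C) auto
  with c0 have cpos: "0 < c" by auto
  have "distr (gauss D) borel (sqn D) = density lborel (\<lambda>t. ennreal (c * ?W t))"
  proof (rule measure_eqI)
    fix A assume "A \<in> sets (distr (gauss D) borel (sqn D))"
    then have A[measurable]: "A \<in> sets borel" by simp
    have "emeasure (distr (gauss D) borel (sqn D)) A = (\<integral>\<^sup>+x. indicator A (sqn D x) \<partial>gauss D)"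
      using nn_integral_distr[OF mQ, of "indicator A"] A by simp
    also have "\<dots> = C * (\<integral>\<^sup>+t. indicator A t * ennreal (?W t) \<partial>lborel)" by (rule C) simp
    also have "\<dots> = (\<integral>\<^sup>+t. C * (indicator A t * ennreal (?W t)) \<partial>lborel)"
      by (rule nn_integral_cmult[symmetric]) measurable
    also have "\<dots> = (\<integral>\<^sup>+t. ennreal (c * ?W t) * indicator A t \<partial>lborel)"
      using c by (intro nn_integral_cong) (simp add: ennreal_mult mult_ac)
    also have "\<dots> = emeasure (density lborel (\<lambda>t. ennreal (c * ?W t))) A"
      by (rule emeasure_density[symmetric]) measurable
    finally show "emeasure (distr (gauss D) borel (sqn D)) A = emeasure (density lborel (\<lambda>t. ennreal (c * ?W t))) A" .
  qed simp
  with cpos show ?thesis by blast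
qed

text \<open>At \<open>w = 0\<close> the integrand is \<open>1\<close> almost everywhere, so the
  formula itself determines the constant left open by \<open>distr_sqn\<close>, as a reciprocal of a
  Gamma value.\<close>

lemma integral_xi_sqn:
  assumes D: "finite D" "D \<noteq> {}"
  shows "(\<integral>x. xi w (sqn D x) \<partial>gauss D) = chi_char (card D) w"
proof -
  let ?W = "\<lambda>t. indicator {0<..} t * (t powr (card D / 2 - 1) * exp (- t / 2)) :: real"
  let ?d = "card D"
  have d: "0 < ?d" using D by (simp add: card_gt_0_iff)
  have mQ: "sqn D \<in> borel_measurable (gauss D)" by (rule measurable_sqn) simp
  obtain c where c: "0 < c" "distr (gauss D) borel (sqn D) = density lborel (\<lambda>t. ennreal (c * ?W t))"
    using distr_sqn[OF D] by blast
  have I: "(\<integral>x. xi v (sqn D x) \<partial>gauss D) = of_real (c * 2 powr (?d / 2)) * (exp (\<i> * of_real (v * ln 2)) * Gamma (Complex (?d / 2) v))" for v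
  proof -
    have "(\<integral>x. xi v (sqn D x) \<partial>gauss D) = (\<integral>t. xi v t \<partial>distr (gauss D) borel (sqn D))"
      by (rule integral_distr[symmetric, OF mQ]) simp
    also have "\<dots> = (\<integral>t. (c * ?W t) *\<^sub>R xi v t \<partial>lborel)"
      unfolding c(2) using c(1) by (intro integral_density) auto
    also have "\<dots> = c *\<^sub>R (\<integral>t. ?W t *\<^sub>R xi v t \<partial>lborel)"
      by (simp only: scaleR_scaleR[symmetric] integral_scaleR_right)
    finally show ?thesis by (simp only: LINT_chi[OF d]) (simp add: scaleR_conv_of_real)
  qed
  interpret G: prob_space "gauss D" by (rule prob_space_gauss)
  have "AE t in density lborel (\<lambda>t. ennreal (c * ?W t)). t > 0"
    by (subst AE_density) (auto simp: indicator_def)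
  then have "AE t in distr (gauss D) borel (sqn D). t > 0" by (simp only: c(2))
  then have "AE x in gauss D. sqn D x > 0"
    by (subst (asm) AE_distr_iff[OF mQ]) auto
  then have "(\<integral>x. xi 0 (sqn D x) \<partial>gauss D) = (\<integral>x. 1 \<partial>gauss D)"
    using measurable_compose[OF mQ measurable_xi] by (intro integral_cong_AE) (auto simp: xi_def elim!: eventually_mono)
  also have "\<dots> = 1" by (simp add: G.prob_space)
  finally have 1: "of_real (c * 2 powr (?d / 2)) * Gamma (of_real (?d / 2)) = (1 :: complex)"
    using I[of 0] by (simp add: complex_of_real_def[symmetric])
  then have "Gamma (of_real (?d / 2)) \<noteq> (0::complex)" by auto
  with 1 have "of_real (c * 2 powr (?d / 2)) = 1 / (Gamma (of_real (?d / 2)) :: complex)"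
    by (simp add: field_simps)
  then show ?thesis unfolding I chi_char_def by simp
qed

text \<open>The indicator of \<open>f x \<in> A\<close> is homogeneous of degree \<open>0\<close>,
  so in \<open>nn_integral_gauss_polar\<close> it influences only the constant in front of a radial
  integral common to all \<open>A\<close>. The joint law therefore factorises.\<close>

lemma indep_var_homogeneous_sqn:
  fixes D :: "'i set" and f :: "('i \<Rightarrow> real) \<Rightarrow> complex" and h :: "real \<Rightarrow> complex"
  assumes D: "finite D" "D \<noteq> {}"
    and f: "f \<in> borel_measurable (gauss D)"
    and hom: "\<And>r x. 0 < r \<Longrightarrow> x \<in> extensional D \<Longrightarrow> f (\<lambda>k\<in>D. r * x k) = f x"
    and h: "h \<in> borel_measurable borel"
  shows "prob_space.indep_var (gauss D) borel f borel (\<lambda>x. h (sqn D x))"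
proof -
  let ?W = "\<lambda>t. indicator {0<..} t * (t powr (card D / 2 - 1) * exp (- t / 2)) :: real"
  interpret G: prob_space "gauss D" by (rule prob_space_gauss)
  note h[measurable]
  have mQ: "(\<lambda>x. h (sqn D x)) \<in> borel_measurable (gauss D)"
    by (rule measurable_compose[OF measurable_sqn h]) simp
  have mfQ: "(\<lambda>x. (f x, h (sqn D x))) \<in> measurable (gauss D) (borel \<Otimes>\<^sub>M borel)"
    using f mQ by measurable
  interpret F: prob_space "distr (gauss D) borel f" using f by (rule G.prob_space_distr)
  interpret Q: prob_space "distr (gauss D) borel (\<lambda>x. h (sqn D x))" using mQ by (rule G.prob_space_distr)
  obtain K where K: "\<And>F. F \<in> borel_measurable borel \<Longrightarrow> (\<integral>\<^sup>+x. F (sqn D x) \<partial>gauss D)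
    = K * (\<integral>\<^sup>+t. F t * ennreal (?W t) \<partial>lborel)"
    using nn_integral_gauss_polar[OF D, of "\<lambda>_. 1"] by auto
  have K1: "1 = K * (\<integral>\<^sup>+t. ennreal (?W t) \<partial>lborel)"
    using K[of "\<lambda>_. 1"] by (simp add: G.emeasure_space_1)
  have "distr (gauss D) borel f \<Otimes>\<^sub>M distr (gauss D) borel (\<lambda>x. h (sqn D x)) = distr (gauss D) (borel \<Otimes>\<^sub>M borel) (\<lambda>x. (f x, h (sqn D x)))"
  proof (rule pair_measure_eqI)
    fix A B assume "A \<in> sets (distr (gauss D) borel f)" "B \<in> sets (distr (gauss D) borel (\<lambda>x. h (sqn D x)))"
    then have A[measurable]: "A \<in> sets borel" and B[measurable]: "B \<in> sets borel" by auto
    let ?g = "\<lambda>x. indicator A (f x) :: ennreal"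
    have mg: "?g \<in> borel_measurable (gauss D)" using f A by measurable
    obtain C where C: "\<And>F. F \<in> borel_measurable borel \<Longrightarrow> (\<integral>\<^sup>+x. ?g x * F (sqn D x) \<partial>gauss D)
      = C * (\<integral>\<^sup>+t. F t * ennreal (?W t) \<partial>lborel)"
      using nn_integral_gauss_polar[OF D mg] hom by auto
    have eA: "emeasure (distr (gauss D) borel f) A = C * (\<integral>\<^sup>+t. ennreal (?W t) \<partial>lborel)"
      using C[of "\<lambda>_. 1"] nn_integral_distr[OF f, of "indicator A"] A by simp
    have eB: "emeasure (distr (gauss D) borel (\<lambda>x. h (sqn D x))) B = K * (\<integral>\<^sup>+t. indicator B (h t) * ennreal (?W t) \<partial>lborel)"
      using K[of "\<lambda>t. indicator B (h t)"] nn_integral_distr[OF mQ, of "indicator B"] B by simp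
    have "emeasure (distr (gauss D) (borel \<Otimes>\<^sub>M borel) (\<lambda>x. (f x, h (sqn D x)))) (A \<times> B)
      = (\<integral>\<^sup>+x. indicator (A \<times> B) (f x, h (sqn D x)) \<partial>gauss D)"
      using nn_integral_distr[OF mfQ, of "indicator (A \<times> B)"] A B by simp
    also have "\<dots> = (\<integral>\<^sup>+x. ?g x * indicator B (h (sqn D x)) \<partial>gauss D)"
      by (intro nn_integral_cong) (auto simp: indicator_def)
    also have "\<dots> = C * (\<integral>\<^sup>+t. indicator B (h t) * ennreal (?W t) \<partial>lborel)" by (rule C) simp
    \<comment> \<open>Inserting total mass \<open>1\<close> in the form \<open>K1\<close> separates
      the two marginal probabilities.\<close>
    also have "\<dots> = C * (K * (\<integral>\<^sup>+t. ennreal (?W t) \<partial>lborel)) * (\<integral>\<^sup>+t. indicator B (h t) * ennreal (?W t) \<partial>lborel)"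
      by (simp only: K1[symmetric] mult_1_right)
    finally show "emeasure (distr (gauss D) borel f) A * emeasure (distr (gauss D) borel (\<lambda>x. h (sqn D x))) B
      = emeasure (distr (gauss D) (borel \<Otimes>\<^sub>M borel) (\<lambda>x. (f x, h (sqn D x)))) (A \<times> B)"
      by (simp add: eA eB mult_ac)
  qed (simp_all add: F.sigma_finite_measure_axioms Q.sigma_finite_measure_axioms cong: sets_pair_measure_cong)
  then show ?thesis using f mQ by (simp add: G.indep_var_distribution_eq)
qed

section \<open>Independence of disjoint sets of coordinates\<close>

lemma distr_gauss_restrict:
  assumes "D \<subseteq> I"
  shows "distr (gauss I) (gauss D) (\<lambda>x. restrict x D) = gauss D"
  using distr_PiM_reindex[of I "\<lambda>_. density lborel std_normal_density" "\<lambda>k. k" D] assms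
  by (auto simp: gauss_def prob_space_std_normal restrict_def[abs_def])

lemma integral_gauss_restrict:
  fixes f :: "('i \<Rightarrow> real) \<Rightarrow> complex"
  assumes "D \<subseteq> I" "f \<in> borel_measurable (gauss D)"
  shows "(\<integral>x. f (restrict x D) \<partial>gauss I) = (\<integral>x. f x \<partial>gauss D)"
proof -
  have m: "(\<lambda>x. restrict x D) \<in> measurable (gauss I) (gauss D)"
    using assms(1) by (intro measurable_gauss_restrict measurable_gauss_component) auto
  have "(\<integral>x. f x \<partial>gauss D) = (\<integral>x. f x \<partial>distr (gauss I) (gauss D) (\<lambda>x. restrict x D))"
    by (simp add: distr_gauss_restrict[OF assms(1)])
  also have "\<dots> = (\<integral>x. f (restrict x D) \<partial>gauss I)" by (rule integral_distr[OF m assms(2)])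
  finally show ?thesis by simp
qed

lemma sqn_restrict: "E \<subseteq> D \<Longrightarrow> sqn E (restrict x D) = sqn E x"
  unfolding sqn_def by (intro sum.cong) auto

lemma indep_vars_gauss:
  assumes "I \<noteq> {}"
  shows "prob_space.indep_vars (gauss I) (\<lambda>_. borel) (\<lambda>k x. x k) I"
proof -
  interpret G: prob_space "gauss I" by (rule prob_space_gauss)
  have 1: "distr (gauss I) borel (\<lambda>x. x i) = density lborel std_normal_density" if "i \<in> I" for i
  proof -
    have "distr (gauss I) borel (\<lambda>x. x i) = distr (gauss I) (density lborel std_normal_density) (\<lambda>x. x i)"
      by (intro distr_cong) auto
    then show ?thesis
      using distr_PiM_component[of I "\<lambda>_. density lborel std_normal_density" i] that
      by (simp add: gauss_def prob_space_std_normal)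
  qed
  have "distr (gauss I) (\<Pi>\<^sub>M i\<in>I. borel) (\<lambda>x. \<lambda>i\<in>I. x i) = distr (gauss I) (gauss I) (\<lambda>x. x)"
    by (intro distr_cong) (auto simp: sets_gauss space_gauss extensional_restrict)
  also have "\<dots> = gauss I" by (simp add: distr_id)
  also have "\<dots> = (\<Pi>\<^sub>M i\<in>I. distr (gauss I) borel (\<lambda>x. x i))"
    by (subst (1) gauss_def, rule PiM_cong) (simp_all add: 1)
  finally show ?thesis
    using assms by (subst G.indep_vars_iff_distr_eq_PiM') (auto intro: measurable_gauss_component)
qed

text \<open>Squared norms over disjoint coordinate sets are independent and the factors are bounded,
  so the expectation factorises.\<close>

lemma integral_prod_xi:
  fixes D :: "'j \<Rightarrow> 'i set"
  assumes I: "finite I" and J: "finite J" and D: "\<And>j. j \<in> J \<Longrightarrow> D j \<noteq> {} \<and> D j \<subseteq> I"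
    and dis: "disjoint_family_on D J"
  shows "(\<integral>x. (\<Prod>j\<in>J. xi (w j) (sqn (D j) x)) \<partial>gauss I) = (\<Prod>j\<in>J. chi_char (card (D j)) (w j))"
proof (cases "J = {}")
  case True
  interpret G: prob_space "gauss I" by (rule prob_space_gauss)
  show ?thesis using True by (simp add: G.prob_space)
next
  case False
  interpret G: prob_space "gauss I" by (rule prob_space_gauss)
  have ne: "I \<noteq> {}" using False D by auto
  have fD: "finite (D j)" if "j \<in> J" for j using D[OF that] I finite_subset by blast
  have "G.indep_vars (\<lambda>j. \<Pi>\<^sub>M i\<in>D j. borel) (\<lambda>j x. restrict (\<lambda>i. x i) (D j)) J"
    using G.indep_vars_restrict[OF indep_vars_gauss[OF ne], of J D] D dis by auto
  then have "G.indep_vars (\<lambda>_. borel) (\<lambda>j x. (\<lambda>y. xi (w j) (sqn (D j) y)) (restrict (\<lambda>i. x i) (D j))) J"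
  proof (rule G.indep_vars_compose2)
    fix j assume "j \<in> J"
    have "(\<lambda>y. xi (w j) (sqn (D j) y)) \<in> borel_measurable (gauss (D j))"
      by (intro measurable_compose[OF measurable_sqn measurable_xi]) auto
    then show "(\<lambda>y. xi (w j) (sqn (D j) y)) \<in> borel_measurable (\<Pi>\<^sub>M i\<in>D j. borel)"
      by (simp add: measurable_cong_sets[OF sets_gauss refl])
  qed
  then have ind: "G.indep_vars (\<lambda>_. borel) (\<lambda>j x. xi (w j) (sqn (D j) x)) J"
    by (simp add: sqn_restrict)
  have m: "(\<lambda>x. xi (w j) (sqn (D j) x)) \<in> borel_measurable (gauss I)" if "j \<in> J" for j
    using D[OF that] by (intro measurable_compose[OF measurable_sqn measurable_xi]) auto
  have "(\<integral>x. (\<Prod>j\<in>J. xi (w j) (sqn (D j) x)) \<partial>gauss I) = (\<Prod>j\<in>J. \<integral>x. xi (w j) (sqn (D j) x) \<partial>gauss I)"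
    using m by (intro G.indep_vars_lebesgue_integral J ind)
      (auto intro!: G.integrable_const_bound[where B = 1] simp: norm_xi_le)
  also have "\<dots> = (\<Prod>j\<in>J. chi_char (card (D j)) (w j))"
  proof (rule prod.cong)
    fix j assume j: "j \<in> J"
    have "(\<integral>x. xi (w j) (sqn (D j) x) \<partial>gauss I) = (\<integral>x. xi (w j) (sqn (D j) (restrict x (D j))) \<partial>gauss I)"
      by (simp add: sqn_restrict)
    also have "\<dots> = (\<integral>x. xi (w j) (sqn (D j) x) \<partial>gauss (D j))"
      using D[OF j] by (intro integral_gauss_restrict measurable_compose[OF measurable_sqn measurable_xi]) auto
    also have "\<dots> = chi_char (card (D j)) (w j)" using D[OF j] fD[OF j] by (intro integral_xi_sqn) auto
    finally show "(\<integral>x. xi (w j) (sqn (D j) x) \<partial>gauss I) = chi_char (card (D j)) (w j)" .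
  qed simp
  finally show ?thesis .
qed

text \<open>
  The product of powers below is homogeneous of degree \<open>0\<close>, hence independent of \<open>sqn Dt\<close>.
\<close>

lemma integral_xi_ratio:
  fixes D :: "'j \<Rightarrow> 'i set"
  assumes I: "finite I" "Dt \<subseteq> I" and J: "finite J" "J \<noteq> {}" and D: "\<And>j. j \<in> J \<Longrightarrow> D j \<noteq> {} \<and> D j \<subseteq> Dt"
    and dis: "disjoint_family_on D J"
  shows "(\<integral>x. (\<Prod>j\<in>J. xi (w j) (sqn (D j) x)) * xi (- (\<Sum>j\<in>J. w j)) (sqn Dt x) \<partial>gauss I)
      * chi_char (card Dt) (\<Sum>j\<in>J. w j) = (\<Prod>j\<in>J. chi_char (card (D j)) (w j))"
proof -
  let ?s = "\<Sum>j\<in>J. w j"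
  let ?f = "\<lambda>x. (\<Prod>j\<in>J. xi (w j) (sqn (D j) x)) * xi (- ?s) (sqn Dt x)"
  interpret G: prob_space "gauss Dt" by (rule prob_space_gauss)
  have Dt: "finite Dt" using I by (rule finite_subset[rotated])
  obtain j where "j \<in> J" using J by blast
  then have "Dt \<noteq> {}" using D by blast
  note Dt = Dt this
  have fD: "finite (D j)" if "j \<in> J" for j using D[OF that] Dt finite_subset by blast
  have m1: "(\<lambda>x. xi v (sqn E x)) \<in> borel_measurable (gauss Dt)" if "E \<subseteq> Dt" for v E
    using that by (intro measurable_compose[OF measurable_sqn measurable_xi]) auto
  have m: "?f \<in> borel_measurable (gauss Dt)"
    using D by (intro borel_measurable_times borel_measurable_prod m1) auto
  have hom: "?f (\<lambda>k\<in>Dt. r * x k) = ?f x" if r: "0 < r" for r x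
  proof -
    have e: "sqn E (\<lambda>k\<in>Dt. r * x k) = r\<^sup>2 * sqn E x" if "E \<subseteq> Dt" for E
    proof -
      have "sqn E (\<lambda>k\<in>Dt. r * x k) = sqn E (\<lambda>k\<in>E. r * x k)" 
        unfolding sqn_def using that by (intro sum.cong) auto
      also have "finite E" using that Dt finite_subset by blast
      then have "sqn E (\<lambda>k\<in>E. r * x k) = r\<^sup>2 * sqn E x" by (rule sqn_scale)
      finally show ?thesis .
    qed
    have "?f (\<lambda>k\<in>Dt. r * x k) = (\<Prod>j\<in>J. xi (w j) (r\<^sup>2)) * xi (- ?s) (r\<^sup>2) * ?f x"
      using D by (simp add: e xi_mult prod.distrib)
    \<comment> \<open>The exponents sum to \<open>0\<close>; this is the homogeneity of degree
      \<open>0\<close>.\<close>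
    also have "(\<Prod>j\<in>J. xi (w j) (r\<^sup>2)) * xi (- ?s) (r\<^sup>2) = 1"
      using r by (simp add: xi_sum[OF J, symmetric] xi_add[symmetric]) (simp add: xi_def)
    finally show ?thesis by (simp only: mult_1_left)
  qed
  have nb: "norm (?f x) \<le> 1" for x
    unfolding norm_mult prod_norm[symmetric] by (intro mult_le_one prod_le_1 prod_nonneg norm_xi_le) (auto simp: norm_xi_le)
  have "(\<integral>x. ?f x \<partial>gauss I) = (\<integral>x. ?f (restrict x Dt) \<partial>gauss I)"
    using D by (simp add: sqn_restrict)
  also have "\<dots> = (\<integral>x. ?f x \<partial>gauss Dt)" by (rule integral_gauss_restrict[OF I(2) m])
  finally have 1: "(\<integral>x. ?f x \<partial>gauss I) = (\<integral>x. ?f x \<partial>gauss Dt)" .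
  have iv: "G.indep_var borel ?f borel (\<lambda>x. xi ?s (sqn Dt x))"
    by (rule indep_var_homogeneous_sqn[OF Dt m hom measurable_xi])
  \<comment> \<open>Multiplying by the independent factor \<open>xi ?s (sqn Dt x)\<close> removes
    the power of \<open>sqn Dt x\<close> and leaves the product that \<open>integral_prod_xi\<close>
    evaluates.\<close>
  have "(\<integral>x. ?f x \<partial>gauss Dt) * chi_char (card Dt) ?s = (\<integral>x. ?f x \<partial>gauss Dt) * (\<integral>x. xi ?s (sqn Dt x) \<partial>gauss Dt)"
    by (simp add: integral_xi_sqn[OF Dt])
  also have "\<dots> = (\<integral>x. ?f x * xi ?s (sqn Dt x) \<partial>gauss Dt)"
    using m m1[of Dt] nb norm_xi_le
    by (intro G.indep_var_lebesgue_integral[symmetric] iv) (auto intro!: G.integrable_const_bound[where B = 1])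
  also have "\<dots> = (\<integral>x. (\<Prod>j\<in>J. xi (w j) (sqn (D j) x)) \<partial>gauss Dt)"
  proof (rule Bochner_Integration.integral_cong[OF refl])
    fix x
    show "?f x * xi ?s (sqn Dt x) = (\<Prod>j\<in>J. xi (w j) (sqn (D j) x))"
    \<comment> \<open>Opposite powers do not cancel at \<open>0\<close>, where \<open>xi\<close> is
      \<open>0\<close>. There the product on the right vanishes too, as each \<open>D j\<close> lies
      in \<open>Dt\<close>.\<close>
    proof (cases "sqn Dt x = 0")
      case True
      obtain j where j: "j \<in> J" using J by auto
      have "sqn (D j) x \<le> sqn Dt x" unfolding sqn_def using D[OF j] Dt by (intro sum_mono2) auto
      then have "sqn (D j) x = 0" using True sqn_nonneg[of "D j" x] by simp
      then have "(\<Prod>j\<in>J. xi (w j) (sqn (D j) x)) = 0" using j J by (intro prod_zero bexI[of _ j]) auto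
      then show ?thesis by simp
    next
      case False
      then have "xi (- ?s) (sqn Dt x) * xi ?s (sqn Dt x) = 1"
        by (simp add: xi_add[symmetric]) (simp add: xi_def)
      then show ?thesis by (simp add: mult.assoc)
    qed
  qed
  also have "\<dots> = (\<Prod>j\<in>J. chi_char (card (D j)) (w j))"
    using D by (intro integral_prod_xi Dt J dis) auto
  finally show ?thesis by (simp add: 1)
qed

section \<open>Gram determinants\<close>

text \<open>Rows are functions and \<open>D\<close> is the set of columns, so passing to a group,
  deleting a column and appending a row by \<open>z(i := y)\<close> involve no matrix
  operations.\<close>

definition gram :: "nat \<Rightarrow> 'c set \<Rightarrow> (nat \<Rightarrow> 'c \<Rightarrow> real) \<Rightarrow> real" where
  "gram p D z = det (mat p p (\<lambda>(a, b). \<Sum>k\<in>D. z a k * z b k))"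

lemma gram_cong:
  assumes "\<And>a b. a < p \<Longrightarrow> b < p \<Longrightarrow> (\<Sum>k\<in>D. z a k * z b k) = (\<Sum>k\<in>E. y a k * y b k)"
  shows "gram p D z = gram p E y"
  unfolding gram_def by (intro arg_cong[where f = det] eq_matI) (auto simp: assms)

lemma gram_0 [simp]: "gram 0 D z = 1"
  by (simp add: gram_def det_dim_zero)

lemma gram_1: "gram (Suc 0) D z = sqn D (z 0)"
proof -
  have "gram (Suc 0) D z = (mat (Suc 0) (Suc 0) (\<lambda>(a, b). \<Sum>k\<in>D. z a k * z b k)) $$ (0, 0)"
    unfolding gram_def by (rule det_single) simp
  then show ?thesis by (simp add: sqn_def power2_eq_square)
qed

text \<open>Row \<open>0\<close> is supported at column \<open>k\<close>, so one elimination step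
  clears this column from the other rows. If \<open>z 0 k = 0\<close>, the first row of the Gram
  matrix is zero and both sides vanish.\<close>

lemma gram_Suc:
  assumes D: "finite D" "k \<in> D" and z: "\<And>l. l \<in> D - {k} \<Longrightarrow> z 0 l = 0"
  shows "gram (Suc p) D z = (z 0 k)\<^sup>2 * gram p (D - {k}) (\<lambda>a. z (Suc a))"
proof -
  let ?A = "mat (Suc p) (Suc p) (\<lambda>(a, b). \<Sum>l\<in>D. z a l * z b l)"
  have split: "(\<Sum>l\<in>D. z a l * z b l) = z a k * z b k + (\<Sum>l\<in>D - {k}. z a l * z b l)" for a b
    using D by (simp add: sum.remove)
  have row0: "(\<Sum>l\<in>D. z 0 l * z b l) = z 0 k * z b k" for b
    unfolding split using z by simp
  have col0: "(\<Sum>l\<in>D. z a l * z 0 l) = z a k * z 0 k" for a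
    unfolding split using z by simp
  show ?thesis
  proof (cases "z 0 k = 0")
    case True
    have "?A \<in> carrier_mat (Suc p) (Suc p)" by simp
    then have "det ?A = (\<Sum>j<Suc p. ?A $$ (0, j) * cofactor ?A 0 j)"
      by (rule laplace_expansion_row) simp
    also have "\<dots> = 0" using True by (intro sum.neutral) (auto simp: row0)
    finally show ?thesis using True by (simp add: gram_def)
  next
    case False
    define G where "G = mat p p (\<lambda>(a, b). \<Sum>l\<in>D - {k}. z (Suc a) l * z (Suc b) l)"
    \<comment> \<open>The unit lower triangular matrix of the elimination multipliers.
      \<open>R\<close> is block upper triangular, with the Gram matrix over \<open>D - {k}\<close>
      as its lower block.\<close>
    define L where "L = four_block_mat (1\<^sub>m 1) (0\<^sub>m 1 p) (mat p 1 (\<lambda>(a, b). z (Suc a) k / z 0 k)) (1\<^sub>m p)"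
    define R where "R = four_block_mat (mat 1 1 (\<lambda>_. (z 0 k)\<^sup>2)) (mat 1 p (\<lambda>(a, b). z 0 k * z (Suc b) k)) (0\<^sub>m p 1) G"
    have G: "G \<in> carrier_mat p p" by (simp add: G_def)
    have L: "L \<in> carrier_mat (Suc p) (Suc p)" unfolding L_def by (rule carrier_matI) auto
    have R: "R \<in> carrier_mat (Suc p) (Suc p)" unfolding R_def using G by (intro carrier_matI) auto
    have "?A = L * R"
    proof (rule eq_matI)
      fix a b assume "a < dim_row (L * R)" "b < dim_col (L * R)"
      then have ab: "a < Suc p" "b < Suc p" using L R by auto
      have Lrow: "L $$ (a, c) = (if a = 0 then (if c = 0 then 1 else 0) else (if c = 0 then z a k / z 0 k else if a = c then 1 else 0))"
        if "c < Suc p" for c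
        using ab that by (cases a; cases c) (auto simp: L_def)
      have Rcol: "R $$ (c, b) = (if c = 0 then z 0 k * z b k else (if b = 0 then 0 else \<Sum>l\<in>D - {k}. z c l * z b l))"
        if "c < Suc p" for c
        using ab that G by (cases b; cases c) (auto simp: R_def G_def power2_eq_square)
      have "(L * R) $$ (a, b) = (\<Sum>c<Suc p. L $$ (a, c) * R $$ (c, b))"
        using ab L R by (simp add: scalar_prod_def row_def col_def atLeast0LessThan)
      also have "\<dots> = L $$ (a, 0) * R $$ (0, b) + (\<Sum>c\<in>{..<Suc p} - {0}. L $$ (a, c) * R $$ (c, b))"
        by (intro sum.remove) auto
      also have "(\<Sum>c\<in>{..<Suc p} - {0}. L $$ (a, c) * R $$ (c, b)) = (\<Sum>c\<in>{..<Suc p} - {0}. if c = a then R $$ (a, b) else 0)"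
        by (intro sum.cong) (auto simp: Lrow)
      also have "\<dots> = (if a = 0 then 0 else R $$ (a, b))" using ab by simp
      finally have "(L * R) $$ (a, b) = (\<Sum>l\<in>D. z a l * z b l)"
        using ab False by (auto simp: Lrow Rcol row0 col0 split[of a b] intro!: sum.neutral z)
      then show "?A $$ (a, b) = (L * R) $$ (a, b)" using ab by simp
    qed (use L R in auto)
    then have "det ?A = det L * det R" using det_mult[OF L R] by simp
    also have "det L = det (1\<^sub>m 1) * det (1\<^sub>m p)"
      unfolding L_def by (rule det_four_block_mat_upper_right_zero) auto
    also have "det R = det (mat 1 1 (\<lambda>_. (z 0 k)\<^sup>2)) * det G"
      unfolding R_def by (rule det_four_block_mat_lower_left_zero) (auto simp: G)
    also have "det (mat 1 1 (\<lambda>_. (z 0 k)\<^sup>2)) = (z 0 k)\<^sup>2"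
      by (subst det_single) auto
    finally show ?thesis by (simp add: gram_def G_def det_one)
  qed
qed

lemma gram_zero_row:
  assumes "a < p" "\<And>l. l \<in> D \<Longrightarrow> z a l = 0"
  shows "gram p D z = 0"
proof -
  let ?A = "mat p p (\<lambda>(a, b). \<Sum>l\<in>D. z a l * z b l)"
  have "det ?A = (\<Sum>j<p. ?A $$ (a, j) * cofactor ?A a j)"
    using assms(1) by (intro laplace_expansion_row) auto
  also have "\<dots> = 0" using assms by (intro sum.neutral) auto
  finally show ?thesis by (simp add: gram_def)
qed

text \<open>For a kernel vector \<open>v\<close> the quadratic form is a sum of squares, so
  \<open>v\<close> is a linear relation between the rows. Padded with \<open>0\<close> it remains
  one after a row is added. Degenerate earlier rows thus make both sides of the row step
  vanish.\<close>

lemma gram_eq_0_extend: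
  assumes D: "finite D" and 0: "gram p D z = 0"
  shows "gram (Suc p) D z = 0"
proof -
  let ?A = "\<lambda>p. mat p p (\<lambda>(a, b). \<Sum>l\<in>D. z a l * z b l)"
  obtain v where v: "v \<in> carrier_vec p" "v \<noteq> 0\<^sub>v p" "?A p *\<^sub>v v = 0\<^sub>v p"
    using 0 det_0_iff_vec_prod_zero[of "?A p" p] by (auto simp: gram_def)
  have Av: "(\<Sum>b<p. (\<Sum>l\<in>D. z a l * z b l) * v $ b) = 0" if "a < p" for a
  proof -
    have "(?A p *\<^sub>v v) $ a = (\<Sum>b<p. (\<Sum>l\<in>D. z a l * z b l) * v $ b)"
      using that v(1) by (simp add: scalar_prod_def atLeast0LessThan)
    then show ?thesis using v(3) that by simp
  qed
  let ?c = "\<lambda>l. \<Sum>b<p. z b l * v $ b"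
  have zc: "(\<Sum>b<p. (\<Sum>l\<in>D. z a l * z b l) * v $ b) = (\<Sum>l\<in>D. z a l * ?c l)" for a
    by (simp add: sum_distrib_left sum_distrib_right mult.assoc sum.swap[of _ "{..<p}"])
  have "(\<Sum>l\<in>D. ?c l * ?c l) = (\<Sum>l\<in>D. \<Sum>a<p. v $ a * (z a l * ?c l))"
    by (simp add: sum_distrib_right mult_ac)
  also have "\<dots> = (\<Sum>a<p. v $ a * (\<Sum>l\<in>D. z a l * ?c l))"
    by (simp add: sum_distrib_left sum.swap[of _ D])
  also have "\<dots> = 0" using Av zc by simp
  finally have "\<forall>l\<in>D. ?c l * ?c l = 0" using D by (subst (asm) sum_nonneg_eq_0_iff) auto
  then have c: "?c l = 0" if "l \<in> D" for l using that by auto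
  let ?v = "vec (Suc p) (\<lambda>a. if a < p then v $ a else 0)"
  have "?A (Suc p) *\<^sub>v ?v = 0\<^sub>v (Suc p)"
  proof (rule eq_vecI)
    fix a assume "a < dim_vec (0\<^sub>v (Suc p) :: real vec)"
    then have a: "a < Suc p" by simp
    have "(?A (Suc p) *\<^sub>v ?v) $ a = (\<Sum>b<Suc p. (\<Sum>l\<in>D. z a l * z b l) * ?v $ b)"
      using a by (simp add: scalar_prod_def atLeast0LessThan del: sum.lessThan_Suc)
    also have "\<dots> = (\<Sum>l\<in>D. z a l * ?c l)" by (simp add: zc[symmetric])
    finally show "(?A (Suc p) *\<^sub>v ?v) $ a = (0\<^sub>v (Suc p)) $ a" using a c by simp
  qed simp
  moreover have "?v \<noteq> 0\<^sub>v (Suc p)"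
  proof
    assume e: "?v = 0\<^sub>v (Suc p)"
    have "v $ a = 0" if "a < p" for a
    proof -
      have "?v $ a = 0\<^sub>v (Suc p) $ a" by (simp only: e)
      then show ?thesis using that by simp
    qed
    then have "v = 0\<^sub>v p" using v(1) by (intro eq_vecI) auto
    then show False using v(2) by simp
  qed
  ultimately show ?thesis
    using det_0_iff_vec_prod_zero[of "?A (Suc p)" "Suc p"] by (auto simp: gram_def intro!: exI[of _ ?v])
qed

text \<open>The Householder maps of the blocks move disjoint sets of coordinates, so their
  composition serves all blocks at once.\<close>

lemma ex_gauss_preserving_blocks:
  fixes I :: "'c set" and D :: "'j \<Rightarrow> 'c set"
  assumes I: "finite I" and J: "finite J"
    and D: "\<And>j. j \<in> J \<Longrightarrow> D j \<subseteq> I \<and> k j \<in> D j" and dis: "disjoint_family_on D J"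
  shows "\<exists>T. gauss_preserving I T \<and> (\<forall>y. \<forall>l\<in>I - (\<Union>j\<in>J. D j). T y l = y l)
    \<and> (\<forall>j\<in>J. (\<forall>y y'. (\<Sum>l\<in>D j. T y l * T y' l) = (\<Sum>l\<in>D j. y l * y' l)) \<and> (\<forall>l\<in>D j - {k j}. T x l = 0))"
  using J D dis
proof (induction J rule: finite_induct)
  case empty
  show ?case using gauss_preserving_id by (intro exI[of _ "\<lambda>x. x"]) auto
next
  case (insert i J)
  have dis': "disjoint_family_on D J" using insert.prems(2) by (auto simp: disjoint_family_on_def)
  have "\<exists>T. gauss_preserving I T \<and> (\<forall>y. \<forall>l\<in>I - (\<Union>j\<in>J. D j). T y l = y l)
    \<and> (\<forall>j\<in>J. (\<forall>y y'. (\<Sum>l\<in>D j. T y l * T y' l) = (\<Sum>l\<in>D j. y l * y' l)) \<and> (\<forall>l\<in>D j - {k j}. T x l = 0))"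
    by (rule insert.IH[OF _ dis']) (use insert.prems(1) in auto)
  then obtain T where T': "gauss_preserving I T" "\<forall>y. \<forall>l\<in>I - (\<Union>j\<in>J. D j). T y l = y l"
    "\<forall>j\<in>J. (\<forall>y y'. (\<Sum>l\<in>D j. T y l * T y' l) = (\<Sum>l\<in>D j. y l * y' l)) \<and> (\<forall>l\<in>D j - {k j}. T x l = 0)"
    by (elim exE conjE)
  have T: "gauss_preserving I T" "\<And>y l. l \<in> I - (\<Union>j\<in>J. D j) \<Longrightarrow> T y l = y l"
    "\<And>j y y'. j \<in> J \<Longrightarrow> (\<Sum>l\<in>D j. T y l * T y' l) = (\<Sum>l\<in>D j. y l * y' l)"
    "\<And>j l. j \<in> J \<Longrightarrow> l \<in> D j - {k j} \<Longrightarrow> T x l = 0"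
    using T' by simp_all
  obtain H where H: "gauss_preserving I H" "\<And>y l. l \<in> I - D i \<Longrightarrow> H y l = y l"
    "\<And>y y'. (\<Sum>l\<in>D i. H y l * H y' l) = (\<Sum>l\<in>D i. y l * y' l)" "\<And>l. l \<in> D i - {k i} \<Longrightarrow> H (T x) l = 0"
    using ex_gauss_preserving_householder[OF I, of "D i" "k i" "T x"] insert.prems by auto
  have Di: "D i \<subseteq> I" using insert.prems by auto
  have disj: "D j \<inter> D i = {}" if "j \<in> J" for j
    using insert.prems(2) insert.hyps that by (auto simp: disjoint_family_on_def)
  have HD: "H y l = y l" if "j \<in> J" "l \<in> D j" for j y l
    using that disj insert.prems(1)[of j] by (intro H(2)) auto
  have TD: "T y l = y l" if "l \<in> D i" for y l
    using that disj Di by (intro T(2)) auto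
  show ?case
  proof (intro exI[of _ "\<lambda>y. H (T y)"] conjI ballI allI)
    show "gauss_preserving I (\<lambda>y. H (T y))" by (rule gauss_preserving_comp[OF H(1) T(1)])
    fix y l assume "l \<in> I - (\<Union>j\<in>insert i J. D j)"
    then show "H (T y) l = y l" using H(2)[of l "T y"] T(2)[of l y] by auto
  next
    fix j y y' assume j: "j \<in> insert i J"
    show "(\<Sum>l\<in>D j. H (T y) l * H (T y') l) = (\<Sum>l\<in>D j. y l * y' l)"
    proof (cases "j = i")
      case True then show ?thesis by (simp add: H(3) TD)
    next
      case False
      then have "j \<in> J" using j by auto
      then show ?thesis using T(3)[of j] HD by simp
    qed
  next
    fix j l assume j: "j \<in> insert i J" and l: "l \<in> D j - {k j}"
    show "H (T x) l = 0"
    proof (cases "j = i")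
      case True then show ?thesis using H(4) l by simp
    next
      case False
      then have "j \<in> J" using j by auto
      then show ?thesis using T(4)[of j l] HD l by auto
    qed
  qed
qed

text \<open>
  Adapted orthonormal coordinates for the residual of a new row \<open>y\<close>: one common isometry \<open>T\<close> turns
  the Gram determinant ratios of all blocks, and of the total, into sums of squares over
  nested coordinate sets.
\<close>

lemma ex_gram_frame:
  fixes I :: "'c set" and D :: "'j \<Rightarrow> 'c set"
  assumes I: "finite I" and J: "finite J" "J \<noteq> {}"
    and D: "\<And>j. j \<in> J \<Longrightarrow> D j \<subseteq> Dt" and Dt: "Dt \<subseteq> I" and dis: "disjoint_family_on D J"
    and nz: "\<And>j. j \<in> J \<Longrightarrow> gram i (D j) z \<noteq> 0"
  shows "\<exists>T E Et. gauss_preserving I T \<and> (\<forall>j\<in>J. E j \<subseteq> Et \<and> card (E j) + i = card (D j))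
    \<and> Et \<subseteq> I \<and> card Et + i = card Dt \<and> disjoint_family_on E J
    \<and> (\<forall>y. (\<forall>j\<in>J. gram (Suc i) (D j) (z(i := y)) = gram i (D j) z * sqn (E j) (T y))
        \<and> gram (Suc i) Dt (z(i := y)) = gram i Dt z * sqn Et (T y))"
  using D Dt dis nz
proof (induction i arbitrary: z D Dt)
  case 0
  then show ?case
    by (intro exI[of _ "\<lambda>x. x"] exI[of _ D] exI[of _ Dt]) (auto simp: gram_1 gauss_preserving_id)
next
  case (Suc i)
  have fDt: "finite Dt" using Suc.prems(2) I by (rule finite_subset)
  have fD: "finite (D j)" if "j \<in> J" for j using Suc.prems(1)[OF that] fDt by (rule finite_subset)
  have "\<exists>k. k \<in> D j" if "j \<in> J" for j
    using Suc.prems(4)[OF that] gram_zero_row[of 0 "Suc i" "D j" z] by auto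
  then obtain k where k: "\<And>j. j \<in> J \<Longrightarrow> k j \<in> D j" by metis
  have DI: "D j \<subseteq> I \<and> k j \<in> D j" if "j \<in> J" for j using that Suc.prems k by blast
  \<comment> \<open>After \<open>S\<close>, row \<open>0\<close> vanishes on every
    \<open>D j\<close> except at the pivot \<open>k j\<close>.\<close>
  obtain S where S: "gauss_preserving I S" "\<And>y l. l \<in> I - (\<Union>j\<in>J. D j) \<Longrightarrow> S y l = y l"
    "\<And>j y y'. j \<in> J \<Longrightarrow> (\<Sum>l\<in>D j. S y l * S y' l) = (\<Sum>l\<in>D j. y l * y' l)"
    "\<And>j l. j \<in> J \<Longrightarrow> l \<in> D j - {k j} \<Longrightarrow> S (z 0) l = 0"
  proof -
    have "\<exists>S. gauss_preserving I S \<and> (\<forall>y. \<forall>l\<in>I - (\<Union>j\<in>J. D j). S y l = y l)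
      \<and> (\<forall>j\<in>J. (\<forall>y y'. (\<Sum>l\<in>D j. S y l * S y' l) = (\<Sum>l\<in>D j. y l * y' l)) \<and> (\<forall>l\<in>D j - {k j}. S (z 0) l = 0))"
      by (rule ex_gauss_preserving_blocks[OF I J(1) DI Suc.prems(3)])
    then obtain S where S': "gauss_preserving I S" "\<forall>y. \<forall>l\<in>I - (\<Union>j\<in>J. D j). S y l = y l"
      "\<forall>j\<in>J. (\<forall>y y'. (\<Sum>l\<in>D j. S y l * S y' l) = (\<Sum>l\<in>D j. y l * y' l)) \<and> (\<forall>l\<in>D j - {k j}. S (z 0) l = 0)"
      by (elim exE conjE)
    show thesis by (rule that[of S]) (use S' in simp_all)
  qed
  obtain j0 where j0: "j0 \<in> J" using J by blast
  define U where "U = (\<Union>j\<in>J. D j)"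
  \<comment> \<open>What row \<open>0\<close> may still occupy within \<open>Dt\<close>: one pivot
    per block and the columns outside all blocks. \<open>H\<close> acts on \<open>K\<close> alone
    and concentrates row \<open>0\<close> at the single column \<open>k j0\<close>, leaving the
    non-pivot columns of the blocks as \<open>S\<close> made them.\<close>
  define K where "K = k ` J \<union> (Dt - U)"
  have KDt: "K \<subseteq> Dt" using DI Suc.prems(1) by (auto simp: K_def)
  have UDt: "U \<subseteq> Dt" using Suc.prems(1) by (auto simp: U_def)
  have KI: "K \<subseteq> I" using KDt Suc.prems(2) by (rule subset_trans)
  have k0: "k j0 \<in> K" using j0 by (auto simp: K_def)
  obtain H where H: "gauss_preserving I H" "\<And>y l. l \<in> I - K \<Longrightarrow> H y l = y l"
    "\<And>y y'. (\<Sum>l\<in>K. H y l * H y' l) = (\<Sum>l\<in>K. y l * y' l)" "\<And>l. l \<in> K - {k j0} \<Longrightarrow> H (S (z 0)) l = 0"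
    using ex_gauss_preserving_householder[OF I KI k0, of "S (z 0)"] by auto
  let ?T = "\<lambda>y. H (S y)"
  have disj: "D j \<inter> D j' = {}" if "j \<in> J" "j' \<in> J" "j \<noteq> j'" for j j'
    using Suc.prems(3) that by (auto simp: disjoint_family_on_def)
  have notK: "l \<notin> K" if jl: "j \<in> J" "l \<in> D j - {k j}" for j l
  proof
    assume "l \<in> K"
    then obtain j' where "j' \<in> J" "l = k j'" using jl by (auto simp: K_def U_def)
    then show False using disj[of j j'] k[of j'] jl by auto
  qed
  have TS: "?T y l = S y l" if "j \<in> J" "l \<in> D j - {k j}" for j l y
    using that notK[OF that] DI by (intro H(2)) auto
  have Ssum: "(\<Sum>l\<in>Dt. S y l * S y' l) = (\<Sum>l\<in>Dt. y l * y' l)" for y y'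
  proof -
    have sp: "(\<Sum>l\<in>Dt. f l) = (\<Sum>j\<in>J. \<Sum>l\<in>D j. f l) + (\<Sum>l\<in>Dt - U. f l)" for f :: "'c \<Rightarrow> real"
    proof -
      have "(\<Sum>l\<in>Dt. f l) = (\<Sum>l\<in>Dt - U. f l) + (\<Sum>l\<in>U. f l)" by (rule sum.subset_diff[OF UDt fDt])
      also have "(\<Sum>l\<in>U. f l) = (\<Sum>j\<in>J. \<Sum>l\<in>D j. f l)"
        unfolding U_def using J fD disj by (intro sum.UNION_disjoint) auto
      finally show ?thesis by simp
    qed
    have "(\<Sum>l\<in>Dt - U. S y l * S y' l) = (\<Sum>l\<in>Dt - U. y l * y' l)"
      using Suc.prems(2) by (intro sum.cong) (auto simp: S(2) U_def)
    then show ?thesis unfolding sp by (simp add: S(3))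
  qed
  have Tsum: "(\<Sum>l\<in>Dt. ?T y l * ?T y' l) = (\<Sum>l\<in>Dt. y l * y' l)" for y y'
  proof -
    have "(\<Sum>l\<in>Dt. ?T y l * ?T y' l) = (\<Sum>l\<in>Dt - K. ?T y l * ?T y' l) + (\<Sum>l\<in>K. ?T y l * ?T y' l)"
      by (rule sum.subset_diff[OF KDt fDt])
    also have "(\<Sum>l\<in>Dt - K. ?T y l * ?T y' l) = (\<Sum>l\<in>Dt - K. S y l * S y' l)"
      using Suc.prems(2) by (intro sum.cong) (auto simp: H(2))
    also have "\<dots> + (\<Sum>l\<in>K. ?T y l * ?T y' l) = (\<Sum>l\<in>Dt. S y l * S y' l)"
      unfolding H(3) by (rule sum.subset_diff[OF KDt fDt, symmetric])
    finally show ?thesis by (simp add: Ssum)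
  qed
  have T0: "?T (z 0) l = 0" if l: "l \<in> Dt - {k j0}" for l
  proof (cases "l \<in> K")
    case True then show ?thesis using H(4) l by auto
  next
    case False
    then obtain j where "j \<in> J" "l \<in> D j - {k j}" using l by (auto simp: K_def U_def)
    then show ?thesis using TS S(4) by auto
  qed
  \<comment> \<open>The blocks are reduced after \<open>S\<close> alone. The result can be written
    with \<open>?T\<close>, because \<open>?T\<close> and \<open>S\<close> agree away from the
    pivots.\<close>
  have gD: "gram (Suc n) (D j) y = (S (y 0) (k j))\<^sup>2 * gram n (D j - {k j}) (\<lambda>a. ?T (y (Suc a)))"
    if j: "j \<in> J" and y: "y 0 = z 0" for j n y
  proof -
    have "gram (Suc n) (D j) y = gram (Suc n) (D j) (\<lambda>a. S (y a))"
      by (rule gram_cong) (simp add: S(3)[OF j])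
    also have "\<dots> = (S (y 0) (k j))\<^sup>2 * gram n (D j - {k j}) (\<lambda>a. S (y (Suc a)))"
      using fD[OF j] k[OF j] S(4)[OF j] y by (intro gram_Suc) auto
    also have "gram n (D j - {k j}) (\<lambda>a. S (y (Suc a))) = gram n (D j - {k j}) (\<lambda>a. ?T (y (Suc a)))"
      using TS[OF j] by (intro gram_cong sum.cong) auto
    finally show ?thesis .
  qed
  \<comment> \<open>Each block gives up its own pivot, whereas the total gives up only
    \<open>k j0\<close>. The sets \<open>D j - {k j}\<close> remain disjoint and inside
    \<open>Dt - {k j0}\<close>, as the induction requires.\<close>
  have gDt: "gram (Suc n) Dt y = (?T (y 0) (k j0))\<^sup>2 * gram n (Dt - {k j0}) (\<lambda>a. ?T (y (Suc a)))"
    if y: "y 0 = z 0" for n y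
  proof -
    have "gram (Suc n) Dt y = gram (Suc n) Dt (\<lambda>a. ?T (y a))" by (rule gram_cong) (simp add: Tsum)
    also have "\<dots> = (?T (y 0) (k j0))\<^sup>2 * gram n (Dt - {k j0}) (\<lambda>a. ?T (y (Suc a)))"
      using fDt T0 y k0 KDt by (intro gram_Suc) auto
    finally show ?thesis .
  qed
  \<comment> \<open>Row \<open>0\<close> is used up; the rotated remaining rows are renumbered, and
    an update at \<open>Suc i\<close> becomes an update at \<open>i\<close>.\<close>
  define z' where "z' a = ?T (z (Suc a))" for a
  have upd: "(\<lambda>a. ?T ((z(Suc i := y)) (Suc a))) = z'(i := ?T y)" for y
    by (auto simp: z'_def)
  have "\<exists>T E Et. gauss_preserving I T \<and> (\<forall>j\<in>J. E j \<subseteq> Et \<and> card (E j) + i = card (D j - {k j}))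
    \<and> Et \<subseteq> I \<and> card Et + i = card (Dt - {k j0}) \<and> disjoint_family_on E J
    \<and> (\<forall>y. (\<forall>j\<in>J. gram (Suc i) (D j - {k j}) (z'(i := y)) = gram i (D j - {k j}) z' * sqn (E j) (T y))
        \<and> gram (Suc i) (Dt - {k j0}) (z'(i := y)) = gram i (Dt - {k j0}) z' * sqn Et (T y))"
  proof (rule Suc.IH)
    fix j assume j: "j \<in> J"
    show "D j - {k j} \<subseteq> Dt - {k j0}"
      using Suc.prems(1)[OF j] disj[OF j j0] k[OF j0] by (cases "j = j0") auto
    show "gram i (D j - {k j}) z' \<noteq> 0"
      using Suc.prems(4)[OF j] gD[OF j, of z i] by (auto simp: z'_def[abs_def])
  next
    show "Dt - {k j0} \<subseteq> I" using Suc.prems(2) by auto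
    show "disjoint_family_on (\<lambda>j. D j - {k j}) J" using Suc.prems(3) by (auto simp: disjoint_family_on_def)
  qed
  then obtain T E Et where T': "gauss_preserving I T" "\<forall>j\<in>J. E j \<subseteq> Et \<and> card (E j) + i = card (D j - {k j})"
    "Et \<subseteq> I" "card Et + i = card (Dt - {k j0})" "disjoint_family_on E J"
    "\<forall>y. (\<forall>j\<in>J. gram (Suc i) (D j - {k j}) (z'(i := y)) = gram i (D j - {k j}) z' * sqn (E j) (T y))
        \<and> gram (Suc i) (Dt - {k j0}) (z'(i := y)) = gram i (Dt - {k j0}) z' * sqn Et (T y)"
    by (elim exE conjE)
  have T: "gauss_preserving I T" "\<And>j. j \<in> J \<Longrightarrow> E j \<subseteq> Et \<and> card (E j) + i = card (D j - {k j})"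
    "Et \<subseteq> I" "card Et + i = card (Dt - {k j0})" "disjoint_family_on E J"
    "\<And>y j. j \<in> J \<Longrightarrow> gram (Suc i) (D j - {k j}) (z'(i := y)) = gram i (D j - {k j}) z' * sqn (E j) (T y)"
    "\<And>y. gram (Suc i) (Dt - {k j0}) (z'(i := y)) = gram i (Dt - {k j0}) z' * sqn Et (T y)"
    using T' by blast+
  have c: "card (D j - {k j}) + 1 = card (D j)" if "j \<in> J" for j
    using card_Suc_Diff1[OF fD[OF that] k[OF that]] by simp
  have ct: "card (Dt - {k j0}) + 1 = card Dt"
    using card_Suc_Diff1[OF fDt subsetD[OF KDt k0]] by simp
  show ?case
  proof (rule exI[of _ "\<lambda>y. T (?T y)"], rule exI[of _ E], rule exI[of _ Et], intro conjI ballI allI)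
    show "gauss_preserving I (\<lambda>y. T (?T y))"
      by (rule gauss_preserving_comp[OF T(1) gauss_preserving_comp[OF H(1) S(1)]])
    show "card Et + Suc i = card Dt" using T(4) ct by simp
    show "Et \<subseteq> I" "disjoint_family_on E J" using T by simp_all
    fix y
    show "gram (Suc (Suc i)) Dt (z(Suc i := y)) = gram (Suc i) Dt z * sqn Et (T (?T y))"
      using gDt[of "z(Suc i := y)" "Suc i", unfolded upd] gDt[of z i, folded z'_def] T(7)[of "?T y"] by simp
    fix j assume j: "j \<in> J"
    show "gram (Suc (Suc i)) (D j) (z(Suc i := y)) = gram (Suc i) (D j) z * sqn (E j) (T (?T y))"
      using gD[OF j, of "z(Suc i := y)" "Suc i", unfolded upd] gD[OF j, of z i, folded z'_def] T(6)[OF j, of "?T y"] by simp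
  next
    fix j assume j: "j \<in> J"
    show "card (E j) + Suc i = card (D j)" using T(2)[OF j] c[OF j] by simp
    show "E j \<subseteq> Et" using T(2)[OF j] by simp
  qed
qed

section \<open>Integrating out one row\<close>

lemma chi_char_nonzero:
  assumes "0 < d" shows "chi_char d w \<noteq> 0"
proof -
  have "z \<notin> \<int>\<^sub>\<le>\<^sub>0" if "0 < Re z" for z :: complex
    using that by (auto elim!: nonpos_Ints_cases)
  then show ?thesis using assms by (simp add: chi_char_def Gamma_eq_zero_iff)
qed

lemma measurable_det_mat:
  assumes "\<And>a b. a < p \<Longrightarrow> b < p \<Longrightarrow> (\<lambda>x. f x a b) \<in> borel_measurable M"
  shows "(\<lambda>x. det (mat p p (\<lambda>(a, b). f x a b)) :: real) \<in> borel_measurable M"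
proof -
  have lt: "\<pi> i < p" if "\<pi> permutes {0..<p}" "i < p" for \<pi> i
    using permutes_in_image[OF that(1), of i] that(2) by simp
  have "det (mat p p (\<lambda>(a, b). f x a b)) =
    (\<Sum>\<pi>\<in>{\<pi>. \<pi> permutes {0..<p}}. signof \<pi> * (\<Prod>i = 0..<p. f x i (\<pi> i)))" for x
    using lt by (simp add: det_def)
  then show ?thesis
    using assms lt by (auto intro!: borel_measurable_sum borel_measurable_times borel_measurable_prod)
qed

lemma measurable_gram:
  assumes "\<And>a c. a < p \<Longrightarrow> c \<in> D \<Longrightarrow> (\<lambda>x. z x a c) \<in> borel_measurable M"
  shows "(\<lambda>x. gram p D (z x)) \<in> borel_measurable M"
  unfolding gram_def using assms
  by (intro measurable_det_mat borel_measurable_sum borel_measurable_times) auto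

lemma norm_prod_xi_le: "norm ((\<Prod>j\<in>J. xi (w j) (f j)) * xi v y) \<le> 1"
  unfolding norm_mult prod_norm[symmetric] by (intro mult_le_one prod_le_1 prod_nonneg norm_xi_le) (auto simp: norm_xi_le)

text \<open>For \<open>w j = s * N j / 2\<close> and the bordered rows this is almost surely, up to
  a constant of modulus \<open>1\<close>, the integrand of the characteristic function of the log
  likelihood ratio.\<close>

definition gram_char :: "'j set \<Rightarrow> ('j \<Rightarrow> 'c set) \<Rightarrow> 'c set \<Rightarrow> ('j \<Rightarrow> real) \<Rightarrow> nat \<Rightarrow> (nat \<Rightarrow> 'c \<Rightarrow> real) \<Rightarrow> complex" where
  "gram_char J D C w i z = (\<Prod>j\<in>J. xi (w j) (gram i (D j) z)) * xi (- (\<Sum>j\<in>J. w j)) (gram i C z)"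

lemma norm_gram_char_le: "norm (gram_char J D C w i z) \<le> 1"
  unfolding gram_char_def by (rule norm_prod_xi_le)

lemma measurable_gram_char:
  assumes "\<And>a c. a < i \<Longrightarrow> c \<in> C \<Longrightarrow> (\<lambda>x. z x a c) \<in> borel_measurable M" and "\<And>j. j \<in> J \<Longrightarrow> D j \<subseteq> C"
  shows "(\<lambda>x. gram_char J D C w i (z x)) \<in> borel_measurable M"
  unfolding gram_char_def using assms
  by (intro borel_measurable_times borel_measurable_prod measurable_compose[OF measurable_gram measurable_xi]) blast+

lemma gram_char_cong:
  assumes "\<And>a c. a < i \<Longrightarrow> c \<in> C \<Longrightarrow> y a c = z a c" and "\<And>j. j \<in> J \<Longrightarrow> D j \<subseteq> C"
  shows "gram_char J D C w i y = gram_char J D C w i z"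
proof -
  have "gram i E y = gram i E z" if "E \<subseteq> C" for E
    using assms(1) that by (intro gram_cong sum.cong) auto
  then show ?thesis unfolding gram_char_def using assms(2) by simp
qed

text \<open>The expected contribution of row \<open>i\<close> given the earlier ones: projecting off
  \<open>i\<close> rows, the row of ones included, leaves \<open>N j - i\<close> and
  \<open>n - i\<close> degrees of freedom.\<close>

definition row_factor :: "'j set \<Rightarrow> ('j \<Rightarrow> nat) \<Rightarrow> nat \<Rightarrow> ('j \<Rightarrow> real) \<Rightarrow> nat \<Rightarrow> complex" where
  "row_factor J N n w i = (\<Prod>j\<in>J. chi_char (N j - i) (w j)) / chi_char (n - i) (\<Sum>j\<in>J. w j)"

text \<open>The earlier rows are frozen in \<open>z\<close> and only the law of the new row matters.
  The frame \<open>T\<close> may therefore depend on \<open>z\<close> in any way; no measurable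
  choice of it is made.\<close>

lemma integral_gram_char_row:
  fixes D :: "'j \<Rightarrow> 'c set"
  assumes C: "finite C" and J: "finite J" "J \<noteq> {}" and D: "\<And>j. j \<in> J \<Longrightarrow> D j \<subseteq> C \<and> i < card (D j)"
    and dis: "disjoint_family_on D J"
  shows "(\<integral>y. gram_char J D C w (Suc i) (z(i := y)) \<partial>gauss C)
    = gram_char J D C w i z * row_factor J (\<lambda>j. card (D j)) (card C) w i"
proof (cases "\<exists>j\<in>J. gram i (D j) z = 0")
  case True
  \<comment> \<open>Dependent earlier rows stay dependent after \<open>y\<close> is added, so both
    sides are \<open>0\<close>.\<close>
  then obtain j where j: "j \<in> J" "gram i (D j) z = 0" by blast
  have fD: "finite (D j)" using D[OF j(1)] C finite_subset by blast
  have "gram i (D j) (z(i := y)) = 0" for y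
    using j(2) gram_cong[of i "z(i := y)" "D j" z "D j"] by simp
  then have "gram (Suc i) (D j) (z(i := y)) = 0" for y
    by (intro gram_eq_0_extend fD)
  then have "(\<Prod>j\<in>J. xi (w j) (gram (Suc i) (D j) (z(i := y)))) = 0" for y
    by (intro prod_zero[OF J(1)] bexI[OF _ j(1)]) simp
  then have "gram_char J D C w (Suc i) (z(i := y)) = 0" for y
    by (simp only: gram_char_def mult_zero_left)
  moreover have "(\<Prod>j\<in>J. xi (w j) (gram i (D j) z)) = 0"
    by (intro prod_zero[OF J(1)] bexI[OF _ j(1)]) (simp add: j(2))
  then have "gram_char J D C w i z = 0"
    by (simp only: gram_char_def mult_zero_left)
  ultimately show ?thesis by simp
next
  case False
  then have nz: "\<And>j. j \<in> J \<Longrightarrow> gram i (D j) z \<noteq> 0" by blast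
  have DC: "\<And>j. j \<in> J \<Longrightarrow> D j \<subseteq> C" using D by blast
  have "\<exists>T E Et. gauss_preserving C T \<and> (\<forall>j\<in>J. E j \<subseteq> Et \<and> card (E j) + i = card (D j))
    \<and> Et \<subseteq> C \<and> card Et + i = card C \<and> disjoint_family_on E J
    \<and> (\<forall>y. (\<forall>j\<in>J. gram (Suc i) (D j) (z(i := y)) = gram i (D j) z * sqn (E j) (T y))
        \<and> gram (Suc i) C (z(i := y)) = gram i C z * sqn Et (T y))"
    by (rule ex_gram_frame[OF C J DC subset_refl dis nz])
  then obtain T E Et where T: "gauss_preserving C T" "\<forall>j\<in>J. E j \<subseteq> Et \<and> card (E j) + i = card (D j)"
    "Et \<subseteq> C" "card Et + i = card C" "disjoint_family_on E J"
    "\<forall>y. (\<forall>j\<in>J. gram (Suc i) (D j) (z(i := y)) = gram i (D j) z * sqn (E j) (T y))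
        \<and> gram (Suc i) C (z(i := y)) = gram i C z * sqn Et (T y)"
    by (elim exE conjE)
  let ?s = "\<Sum>j\<in>J. w j"
  let ?f = "\<lambda>y. (\<Prod>j\<in>J. xi (w j) (sqn (E j) y)) * xi (- ?s) (sqn Et y)"
  have mf: "?f \<in> borel_measurable (gauss C)"
    using T(2,3) by (intro borel_measurable_times borel_measurable_prod measurable_compose[OF measurable_sqn measurable_xi]) auto
  have "(\<integral>y. gram_char J D C w (Suc i) (z(i := y)) \<partial>gauss C) = (\<integral>y. gram_char J D C w i z * ?f (T y) \<partial>gauss C)"
    using T(6) by (intro Bochner_Integration.integral_cong refl) (simp add: gram_char_def xi_mult prod.distrib)
  also have "\<dots> = gram_char J D C w i z * (\<integral>y. ?f (T y) \<partial>gauss C)" by simp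
  also have "(\<integral>y. ?f (T y) \<partial>gauss C) = (\<integral>y. ?f y \<partial>distr (gauss C) (gauss C) T)"
    using T(1) mf by (intro integral_distr[symmetric]) (auto simp: gauss_preserving_def)
  also have "\<dots> = (\<integral>y. ?f y \<partial>gauss C)" using T(1) by (simp only: gauss_preserving_def)
  finally have 1: "(\<integral>y. gram_char J D C w (Suc i) (z(i := y)) \<partial>gauss C) = gram_char J D C w i z * (\<integral>y. ?f y \<partial>gauss C)" .
  have cE: "card (E j) = card (D j) - i" "E j \<noteq> {}" if "j \<in> J" for j
    using T(2) D[OF that] that by auto
  have ct: "card Et = card C - i" using T(4) by simp
  obtain j where j: "j \<in> J" using J by blast
  have "0 < card (E j)" using cE[OF j] D[OF j] by simp
  moreover have "finite Et" using T(3) C by (rule finite_subset)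
  ultimately have "0 < card Et" using card_mono[of Et "E j"] T(2) j by auto
  then have nzc: "chi_char (card C - i) ?s \<noteq> 0" using ct by (simp add: chi_char_nonzero)
  have "(\<integral>y. ?f y \<partial>gauss C) * chi_char (card Et) ?s = (\<Prod>j\<in>J. chi_char (card (E j)) (w j))"
    using T cE by (intro integral_xi_ratio[OF C _ J]) auto
  then have "(\<integral>y. ?f y \<partial>gauss C) = row_factor J (\<lambda>j. card (D j)) (card C) w i"
    unfolding row_factor_def using nzc by (simp add: ct cE field_simps)
  then show ?thesis using 1 by simp
qed

text \<open>The border is deterministic, so the probability space carries only the coordinates
  \<open>{1..p} \<times> C\<close>.\<close>

definition ones_rows :: "(nat \<times> 'c \<Rightarrow> real) \<Rightarrow> nat \<Rightarrow> 'c \<Rightarrow> real" where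
  "ones_rows \<omega> a c = (if a = 0 then 1 else \<omega> (a, c))"

lemma gram_ones: "gram (Suc 0) D (ones_rows \<omega>) = real (card D)"
  by (simp add: gram_1 sqn_def ones_rows_def)

lemma measurable_ones_rows:
  assumes "a \<le> p" "c \<in> C"
  shows "(\<lambda>\<omega>. ones_rows \<omega> a c) \<in> borel_measurable (gauss ({1..p} \<times> C))"
  using assms by (cases "a = 0") (auto simp: ones_rows_def intro!: measurable_gauss_component)

lemma integral_gauss_row:
  fixes f :: "('c \<Rightarrow> real) \<Rightarrow> complex"
  assumes f: "f \<in> borel_measurable (gauss C)"
  shows "(\<integral>y. f (\<lambda>c\<in>C. y (s, c)) \<partial>gauss ({s} \<times> C)) = (\<integral>y. f y \<partial>gauss C)"
proof -
  have d: "distr (gauss ({s} \<times> C)) (gauss C) (\<lambda>y. \<lambda>c\<in>C. y (s, c)) = gauss C"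
    unfolding gauss_def by (rule distr_PiM_reindex) (auto simp: prob_space_std_normal inj_on_def)
  have m: "(\<lambda>y. \<lambda>c\<in>C. y (s, c)) \<in> measurable (gauss ({s} \<times> C)) (gauss C)"
    by (intro measurable_gauss_restrict measurable_gauss_component) auto
  show ?thesis using integral_distr[OF m f] d by simp
qed

text \<open>Peeling off the rows one by one, the last one first.\<close>

lemma integral_gram_char:
  fixes D :: "'j \<Rightarrow> 'c set"
  assumes C: "finite C" and J: "finite J" "J \<noteq> {}" and D: "\<And>j. j \<in> J \<Longrightarrow> D j \<subseteq> C \<and> p < card (D j)"
    and dis: "disjoint_family_on D J"
  shows "(\<integral>\<omega>. gram_char J D C w (Suc p) (ones_rows \<omega>) \<partial>gauss ({1..p} \<times> C))
    = (\<Prod>j\<in>J. xi (w j) (card (D j))) * xi (- (\<Sum>j\<in>J. w j)) (card C)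
      * (\<Prod>i=1..p. row_factor J (\<lambda>j. card (D j)) (card C) w i)"
  using D
proof (induction p)
  case 0
  interpret G: prob_space "gauss ({} :: (nat \<times> 'c) set)" by (rule prob_space_gauss)
  show ?case by (simp add: gram_char_def gram_ones G.prob_space)
next
  case (Suc p)
  let ?I = "{1..p} \<times> C" and ?K = "{Suc p} \<times> C"
  let ?F = "\<lambda>i \<omega>. gram_char J D C w i (ones_rows \<omega>)"
  let ?r = "row_factor J (\<lambda>j. card (D j)) (card C) w"
  have DC: "\<And>j. j \<in> J \<Longrightarrow> D j \<subseteq> C" using Suc.prems by blast
  interpret G: prob_space "gauss ({1..Suc p} \<times> C)" by (rule prob_space_gauss)
  have m: "?F (Suc (Suc p)) \<in> borel_measurable (gauss ({1..Suc p} \<times> C))"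
    using DC by (intro measurable_gram_char measurable_ones_rows) auto
  have int: "integrable (gauss ({1..Suc p} \<times> C)) (?F (Suc (Suc p)))"
    using m by (intro G.integrable_const_bound[where B = 1]) (auto simp: norm_gram_char_le)
  have IK: "{1..Suc p} \<times> C = ?I \<union> ?K" by auto
  \<comment> \<open>Merging the coordinates of row \<open>Suc p\<close> into the others amounts to
    updating \<open>ones_rows x\<close> at \<open>Suc p\<close>, the situation of the one-row
    formula.\<close>
  have inner: "(\<integral>y. ?F (Suc (Suc p)) (merge ?I ?K (x, y)) \<partial>gauss ?K) = ?F (Suc p) x * ?r (Suc p)" for x
  proof -
    let ?z = "ones_rows x"
    let ?h = "\<lambda>y. gram_char J D C w (Suc (Suc p)) (?z(Suc p := y))"
    have "(\<lambda>y. (?z(Suc p := y)) a c) \<in> borel_measurable (gauss C)" if "c \<in> C" for a c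
      using that by (cases "a = Suc p") (auto intro: measurable_gauss_component)
    then have mh: "?h \<in> borel_measurable (gauss C)"
      using DC by (intro measurable_gram_char) auto
    have "(\<integral>y. ?F (Suc (Suc p)) (merge ?I ?K (x, y)) \<partial>gauss ?K) = (\<integral>y. ?h (\<lambda>c\<in>C. y (Suc p, c)) \<partial>gauss ?K)"
      using DC by (intro Bochner_Integration.integral_cong refl gram_char_cong) (auto simp: ones_rows_def merge_def)
    also have "\<dots> = (\<integral>y. ?h y \<partial>gauss C)" by (rule integral_gauss_row[OF mh])
    also have "\<dots> = ?F (Suc p) x * ?r (Suc p)"
      using Suc.prems by (intro integral_gram_char_row[OF C J _ dis]) auto
    finally show ?thesis .
  qed
  have "(\<integral>\<omega>. ?F (Suc (Suc p)) \<omega> \<partial>gauss ({1..Suc p} \<times> C))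
     = (\<integral>x. (\<integral>y. ?F (Suc (Suc p)) (merge ?I ?K (x, y)) \<partial>gauss ?K) \<partial>gauss ?I)"
    using int C unfolding IK gauss_def by (intro gauss.product_integral_fold) auto
  also have "\<dots> = (\<integral>x. ?F (Suc p) x \<partial>gauss ?I) * ?r (Suc p)"
    by (simp only: inner integral_mult_left_zero)
  also have "(\<integral>x. ?F (Suc p) x \<partial>gauss ?I) = (\<Prod>j\<in>J. xi (w j) (card (D j))) * xi (- (\<Sum>j\<in>J. w j)) (card C)
      * (\<Prod>i=1..p. ?r i)"
    using Suc.prems by (intro Suc.IH) fastforce
  finally show ?case by (simp add: mult_ac)
qed

text \<open>A Householder map moves row \<open>0\<close> into one column, and
  \<open>gram_Suc\<close> then splits off a square.\<close>

lemma gram_nonneg: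
  assumes "finite D" shows "0 \<le> gram p D z"
  using assms
proof (induction p arbitrary: D z)
  case (Suc p)
  show ?case
  proof (cases "D = {}")
    case True
    then show ?thesis using gram_zero_row[of 0 "Suc p" D z] by simp
  next
    case False
    then obtain k where k: "k \<in> D" by blast
    obtain H where H: "\<forall>y y'. (\<Sum>l\<in>D. H y l * H y' l) = (\<Sum>l\<in>D. y l * y' l)" "\<forall>l\<in>D - {k}. H (z 0) l = 0"
      using ex_gauss_preserving_householder[OF Suc.prems subset_refl k, of "z 0"] by auto
    have "gram (Suc p) D z = gram (Suc p) D (\<lambda>a. H (z a))" using H(1) by (intro gram_cong) simp
    also have "\<dots> = (H (z 0) k)\<^sup>2 * gram p (D - {k}) (\<lambda>a. H (z (Suc a)))"
      using H(2) k Suc.prems by (intro gram_Suc) auto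
    also have "0 \<le> \<dots>" using Suc by (intro mult_nonneg_nonneg) auto
    finally show ?thesis .
  qed
qed simp

text \<open>An entry of a scatter matrix with the means multiplied out; see
  \<open>centred_sum_eq\<close>.\<close>

definition centred_sum :: "'c set \<Rightarrow> ('c \<Rightarrow> real) \<Rightarrow> ('c \<Rightarrow> real) \<Rightarrow> real" where
  "centred_sum D f g = (\<Sum>c\<in>D. f c * g c) - (\<Sum>c\<in>D. f c) * (\<Sum>c\<in>D. g c) / card D"

text \<open>Once the row of ones sits in column \<open>k\<close>, with a coordinate
  \<open>?c\<close> of square \<open>card D\<close>, the \<open>k\<close>-th coordinate of any other
  row \<open>y\<close> is its sum divided by \<open>?c\<close>. Deleting column \<open>k\<close>
  thus subtracts exactly the product of sums in \<open>centred_sum\<close>.\<close>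

lemma gram_ones_row:
  assumes D: "finite D" "D \<noteq> {}" and z0: "\<And>c. c \<in> D \<Longrightarrow> z 0 c = 1"
  shows "gram (Suc p) D z = card D * det (mat p p (\<lambda>(a, b). centred_sum D (z (Suc a)) (z (Suc b))))"
proof -
  obtain k where k: "k \<in> D" using D by blast
  obtain H where H: "\<And>y y'. (\<Sum>l\<in>D. H y l * H y' l) = (\<Sum>l\<in>D. y l * y' l)" "\<And>l. l \<in> D - {k} \<Longrightarrow> H (z 0) l = 0"
    using ex_gauss_preserving_householder[OF D(1) subset_refl k, of "z 0"] by auto
  let ?c = "H (z 0) k"
  have c1: "(\<Sum>l\<in>D. H (z 0) l * H y l) = ?c * H y k" for y
    using D k by (subst sum.remove[of D k]) (auto simp: H(2))
  have c: "?c * H y k = (\<Sum>l\<in>D. y l)" for y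
    using c1[of y] H(1)[of "z 0" y] z0 by simp
  have cc: "?c\<^sup>2 = card D" using c1[of "z 0"] H(1)[of "z 0" "z 0"] z0 by (simp add: power2_eq_square)
  have cn: "?c \<noteq> 0" using cc D by (auto simp: card_gt_0_iff)
  have "gram (Suc p) D z = gram (Suc p) D (\<lambda>a. H (z a))" using H(1) by (intro gram_cong) simp
  also have "\<dots> = ?c\<^sup>2 * gram p (D - {k}) (\<lambda>a. H (z (Suc a)))"
    using H(2) k D by (intro gram_Suc) auto
  also have "gram p (D - {k}) (\<lambda>a. H (z (Suc a))) = det (mat p p (\<lambda>(a, b). centred_sum D (z (Suc a)) (z (Suc b))))"
  proof -
    have "(\<Sum>l\<in>D - {k}. H y l * H y' l) = centred_sum D y y'" for y y'
    proof -
      have "(\<Sum>l\<in>D - {k}. H y l * H y' l) = (\<Sum>l\<in>D. y l * y' l) - H y k * H y' k"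
        using H(1)[of y y'] D k by (simp add: sum.remove)
      also have "H y k * H y' k = (?c * H y k) * (?c * H y' k) / ?c\<^sup>2"
        using cn by (simp add: power2_eq_square)
      finally show ?thesis unfolding c cc centred_sum_def by simp
    qed
    then show ?thesis unfolding gram_def by simp
  qed
  finally show ?thesis using cc by simp
qed

section \<open>Multivariate normal vectors\<close>

text \<open>Completing the square in the last variable leaves a form \<open>K'\<close> in the
  others, which is again positive definite.\<close>

lemma cholesky:
  fixes K :: "nat \<Rightarrow> nat \<Rightarrow> real"
  assumes "\<And>a b. a < p \<Longrightarrow> b < p \<Longrightarrow> K a b = K b a"
    and "\<And>x. (\<exists>a<p. x a \<noteq> 0) \<Longrightarrow> 0 < (\<Sum>a<p. \<Sum>b<p. K a b * x a * x b)"
  shows "\<exists>M. \<forall>x. (\<Sum>a<p. \<Sum>b<p. K a b * x a * x b) = (\<Sum>a<p. (\<Sum>b<p. M a b * x b)\<^sup>2)"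
  using assms
proof (induction p arbitrary: K)
  case 0
  then show ?case by simp
next
  case (Suc p)
  let ?q = "\<lambda>K n x. \<Sum>a<n. \<Sum>b<n. K a b * x a * x b :: real"
  have e: "?q K (Suc p) x = ?q K p x + 2 * x p * (\<Sum>a<p. K p a * x a) + K p p * (x p)\<^sup>2" for x
  proof -
    have "(\<Sum>a<p. K a p * x a * x p) = x p * (\<Sum>a<p. K p a * x a)"
      unfolding sum_distrib_left using Suc.prems(1)[of p] by (intro sum.cong) (auto simp: mult_ac)
    moreover have "(\<Sum>a<p. K p a * x p * x a) = x p * (\<Sum>a<p. K p a * x a)"
      unfolding sum_distrib_left by (simp add: mult_ac)
    ultimately show ?thesis by (simp add: sum.distrib power2_eq_square algebra_simps)
  qed
  have Kpp: "0 < K p p"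
    using Suc.prems(2)[of "\<lambda>a. if a = p then 1 else 0"] e[of "\<lambda>a. if a = p then 1 else 0"] by auto
  define K' where "K' a b = K a b - K p a * K p b / K p p" for a b
  have K': "?q K' p x = ?q K p x - (\<Sum>a<p. K p a * x a)\<^sup>2 / K p p" for x
  proof -
    have "(\<Sum>a<p. K p a * x a)\<^sup>2 / K p p = (\<Sum>a<p. \<Sum>b<p. K p a * K p b / K p p * x a * x b)"
      by (simp add: power2_eq_square sum_product sum_divide_distrib mult_ac)
    then show ?thesis by (simp add: K'_def left_diff_distrib sum_subtractf)
  qed
  have sq: "?q K (Suc p) x = ?q K' p x + K p p * (x p + (\<Sum>a<p. K p a * x a) / K p p)\<^sup>2" for x
    unfolding e K' using Kpp by (simp add: power2_eq_square field_simps)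
  have pos': "0 < ?q K' p x" if x: "\<exists>a<p. x a \<noteq> 0" for x
  proof -
    \<comment> \<open>The last coordinate at which the completed square vanishes.\<close>
    let ?x = "x(p := - (\<Sum>a<p. K p a * x a) / K p p)"
    have "0 < ?q K (Suc p) ?x" by (rule Suc.prems(2)) (use x in \<open>auto intro: less_SucI\<close>)
    also have "?q K (Suc p) ?x = ?q K' p ?x"
      unfolding sq by simp
    also have "\<dots> = ?q K' p x" by simp
    finally show ?thesis .
  qed
  have "K' a b = K' b a" if "a < p" "b < p" for a b
    using Suc.prems(1)[of a b] that by (simp add: K'_def)
  then obtain M where M: "\<And>x. ?q K' p x = (\<Sum>a<p. (\<Sum>b<p. M a b * x b)\<^sup>2)"
    using Suc.IH[of K'] pos' by blast
  \<comment> \<open>The rows of \<open>M\<close> padded by \<open>0\<close>, followed by the row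
    whose square is the one completed.\<close>
  define M' where "M' a b = (if a < p then (if b < p then M a b else 0)
    else sqrt (K p p) * (if b < p then K p b / K p p else 1))" for a b
  have "?q K (Suc p) x = (\<Sum>a<Suc p. (\<Sum>b<Suc p. M' a b * x b)\<^sup>2)" for x
  proof -
    have "(\<Sum>b<Suc p. M' p b * x b) = sqrt (K p p) * (x p + (\<Sum>a<p. K p a * x a) / K p p)"
      by (simp add: M'_def sum_distrib_left sum_divide_distrib algebra_simps)
    then have "(\<Sum>b<Suc p. M' p b * x b)\<^sup>2 = K p p * (x p + (\<Sum>a<p. K p a * x a) / K p p)\<^sup>2"
      using Kpp by (simp add: power_mult_distrib del: sum.lessThan_Suc)
    moreover have "(\<Sum>b<Suc p. M' a b * x b) = (\<Sum>b<p. M a b * x b)" if "a < p" for a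
      using that by (simp add: M'_def)
    ultimately show ?thesis
      unfolding sq M by (simp del: sum.lessThan_Suc add: sum.lessThan_Suc[of _ p])
  qed
  then show ?case by blast
qed

lemma ex_mat_inverse:
  fixes A :: "real mat"
  assumes A: "A \<in> carrier_mat p p" and inj: "\<And>v. v \<in> carrier_vec p \<Longrightarrow> A *\<^sub>v v = 0\<^sub>v p \<Longrightarrow> v = 0\<^sub>v p"
  shows "\<exists>B. mat_inverse A = Some B \<and> B \<in> carrier_mat p p \<and> A * B = 1\<^sub>m p \<and> B * A = 1\<^sub>m p"
proof -
  have d: "det A \<noteq> 0" using det_0_iff_vec_prod_zero[OF A] inj by auto
  then have "A \<in> Units (ring_mat TYPE(real) p ())" by (rule det_non_zero_imp_unit[OF A])
  then have "mat_inverse A \<noteq> None" using mat_inverse(1)[OF A, of "()"] by auto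
  then show ?thesis using mat_inverse(2)[OF A] by auto
qed

lemma quadratic_form_eq:
  fixes A :: "real mat"
  assumes "A \<in> carrier_mat p p" "v \<in> carrier_vec p"
  shows "v \<bullet> (A *\<^sub>v v) = (\<Sum>a<p. \<Sum>b<p. A $$ (a, b) * v $ a * v $ b)"
  using assms
proof -
  have "v \<bullet> (A *\<^sub>v v) = (\<Sum>a<p. v $ a * (\<Sum>b<p. A $$ (a, b) * v $ b))"
    using assms by (auto simp: scalar_prod_def atLeast0LessThan intro!: sum.cong)
  also have "\<dots> = (\<Sum>a<p. \<Sum>b<p. A $$ (a, b) * v $ a * v $ b)"
    unfolding sum_distrib_left by (intro sum.cong refl) simp
  finally show ?thesis .
qed

text \<open>The inverse \<open>K\<close> of \<open>S\<close> is symmetric, and positive definite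
  because \<open>v . K v = u . S u\<close> for \<open>u = K v\<close>. Its Cholesky factor
  \<open>M\<close> standardises the observations; \<open>L\<close> is the inverse map, from standard
  normal vectors to observations.\<close>

lemma positive_definite_factor:
  assumes S: "positive_definite_mat p S"
  shows "\<exists>M L. M \<in> carrier_mat p p \<and> L \<in> carrier_mat p p \<and> M * L = 1\<^sub>m p \<and> L * M = 1\<^sub>m p \<and>
    (\<forall>v\<in>carrier_vec p. v \<bullet> (the (mat_inverse S) *\<^sub>v v) = (M *\<^sub>v v) \<bullet> (M *\<^sub>v v))"
proof -
  have Sc: "S \<in> carrier_mat p p" and St: "transpose_mat S = S"
    and Sp: "\<And>v. v \<in> carrier_vec p \<Longrightarrow> v \<noteq> 0\<^sub>v p \<Longrightarrow> v \<bullet> (S *\<^sub>v v) > 0"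
    using S by (auto simp: positive_definite_mat_def)
  have "v = 0\<^sub>v p" if "v \<in> carrier_vec p" "S *\<^sub>v v = 0\<^sub>v p" for v
    using Sp[OF that(1)] that by (cases "v = 0\<^sub>v p") auto
  then obtain K where K: "mat_inverse S = Some K" "K \<in> carrier_mat p p" "S * K = 1\<^sub>m p" "K * S = 1\<^sub>m p"
    using ex_mat_inverse[OF Sc] by blast
  have Kt: "transpose_mat K = K"
  proof -
    have "transpose_mat K * S = 1\<^sub>m p"
      using transpose_mult[OF Sc K(2)] K(3) St by simp
    then have "transpose_mat K = transpose_mat K * (S * K)" using K by simp
    also have "\<dots> = transpose_mat K * S * K" using K Sc by (intro assoc_mult_mat[symmetric]) auto
    also have "\<dots> = K" using \<open>transpose_mat K * S = 1\<^sub>m p\<close> K by simp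
    finally show ?thesis .
  qed
  have SK: "S *\<^sub>v (K *\<^sub>v v) = v" if "v \<in> carrier_vec p" for v
    using assoc_mult_mat_vec[OF Sc K(2) that] K(3) that by simp
  have Kp: "0 < v \<bullet> (K *\<^sub>v v)" if v: "v \<in> carrier_vec p" "v \<noteq> 0\<^sub>v p" for v
  proof -
    let ?u = "K *\<^sub>v v"
    have u: "?u \<in> carrier_vec p" using K(2) v(1) by simp
    have "?u \<noteq> 0\<^sub>v p"
    proof
      assume "?u = 0\<^sub>v p"
      then have "v = S *\<^sub>v 0\<^sub>v p" using SK[OF v(1)] by simp
      also have "\<dots> = 0\<^sub>v p" using Sc by (intro eq_vecI) auto
      finally show False using v by simp
    qed
    then have "0 < ?u \<bullet> (S *\<^sub>v ?u)" using Sp u by blast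
    also have "\<dots> = v \<bullet> ?u" unfolding SK[OF v(1)] by (rule comm_scalar_prod[OF u v(1)])
    finally show ?thesis .
  qed
  have sym: "K $$ (a, b) = K $$ (b, a)" if "a < p" "b < p" for a b
  proof -
    have "transpose_mat K $$ (a, b) = K $$ (b, a)" using that K(2) by (intro index_transpose_mat(1)) auto
    then show ?thesis using Kt by simp
  qed
  have pos: "0 < (\<Sum>a<p. \<Sum>b<p. K $$ (a, b) * x a * x b)" if x: "\<exists>a<p. x a \<noteq> 0" for x
  proof -
    let ?v = "vec p x"
    have "?v \<noteq> 0\<^sub>v p"
    proof
      assume e: "?v = 0\<^sub>v p"
      obtain a where a: "a < p" "x a \<noteq> 0" using x by blast
      have "?v $ a = 0\<^sub>v p $ a" by (simp only: e)
      then show False using a by simp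
    qed
    then have "0 < ?v \<bullet> (K *\<^sub>v ?v)" by (intro Kp) auto
    then show ?thesis using quadratic_form_eq[OF K(2), of ?v] by simp
  qed
  obtain m where m: "\<And>x. (\<Sum>a<p. \<Sum>b<p. K $$ (a, b) * x a * x b) = (\<Sum>a<p. (\<Sum>b<p. m a b * x b)\<^sup>2)"
    using cholesky[of p "\<lambda>a b. K $$ (a, b)"] sym pos by blast
  define M where "M = mat p p (\<lambda>(a, b). m a b)"
  have M: "M \<in> carrier_mat p p" by (simp add: M_def)
  have q: "v \<bullet> (K *\<^sub>v v) = (M *\<^sub>v v) \<bullet> (M *\<^sub>v v)" if v: "v \<in> carrier_vec p" for v
  proof -
    have "v \<bullet> (K *\<^sub>v v) = (\<Sum>a<p. (\<Sum>b<p. m a b * v $ b)\<^sup>2)"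
      unfolding quadratic_form_eq[OF K(2) v] by (rule m)
    also have "\<dots> = (M *\<^sub>v v) \<bullet> (M *\<^sub>v v)"
      using v by (auto simp: M_def scalar_prod_def atLeast0LessThan power2_eq_square intro!: sum.cong)
    finally show ?thesis .
  qed
  have "v = 0\<^sub>v p" if v: "v \<in> carrier_vec p" "M *\<^sub>v v = 0\<^sub>v p" for v
    using Kp[OF v(1)] q[OF v(1)] v by (cases "v = 0\<^sub>v p") auto
  then obtain L where "L \<in> carrier_mat p p" "M * L = 1\<^sub>m p" "L * M = 1\<^sub>m p"
    using ex_mat_inverse[OF M] by blast
  then show ?thesis using M q K(1) by (intro exI[of _ M] exI[of _ L]) simp
qed

section \<open>Measurability and law of a single observation\<close>

lemma space_borel_vec [simp]: "space (borel_vec p) = carrier_vec p"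
  by (simp add: borel_vec_def)

lemma measurable_borel_vec_index:
  assumes "a < p" shows "(\<lambda>v. v $ a) \<in> borel_measurable (borel_vec p)"
proof -
  have "(\<lambda>v. \<lambda>i\<in>{..<p}. v $ i) \<in> measurable (borel_vec p) (\<Pi>\<^sub>M i\<in>{..<p}. borel)"
    unfolding borel_vec_def by (rule measurable_vimage_algebra1) (auto simp: space_PiM)
  from measurable_compose[OF this measurable_component_singleton[of a]] assms show ?thesis by simp
qed

lemma measurable_to_borel_vec:
  assumes "\<And>a. a < p \<Longrightarrow> (\<lambda>x. f x $ a) \<in> borel_measurable M" "\<And>x. x \<in> space M \<Longrightarrow> f x \<in> carrier_vec p"
  shows "f \<in> measurable M (borel_vec p)"
  unfolding borel_vec_def
proof (rule measurable_vimage_algebra2)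
  show "f \<in> space M \<rightarrow> carrier_vec p" using assms(2) by auto
  show "(\<lambda>x. \<lambda>i\<in>{..<p}. f x $ i) \<in> measurable M (\<Pi>\<^sub>M i\<in>{..<p}. borel)"
    using assms(1) by (intro measurable_restrict) auto
qed

definition affine_vec :: "nat \<Rightarrow> real vec \<Rightarrow> real mat \<Rightarrow> (nat \<Rightarrow> real) \<Rightarrow> real vec" where
  "affine_vec p m L z = vec p (\<lambda>a. m $ a + (\<Sum>b<p. L $$ (a, b) * z b))"

lemma measurable_affine_vec:
  "(\<And>b. b < p \<Longrightarrow> (\<lambda>x. f x b) \<in> borel_measurable M) \<Longrightarrow> (\<lambda>x. affine_vec p m L (f x)) \<in> measurable M (borel_vec p)"
  by (intro measurable_to_borel_vec) (auto simp: affine_vec_def)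

lemma mat_mult_inverse_sum:
  assumes "A \<in> carrier_mat p p" "B \<in> carrier_mat p p" "A * B = 1\<^sub>m p" "a < p"
  shows "(\<Sum>b<p. A $$ (a, b) * (\<Sum>c<p. B $$ (b, c) * x c)) = (x a :: real)"
proof -
  have "(\<Sum>b<p. A $$ (a, b) * (\<Sum>c<p. B $$ (b, c) * x c)) = (\<Sum>c<p. (\<Sum>b<p. A $$ (a, b) * B $$ (b, c)) * x c)"
    by (simp add: sum_distrib_left sum_distrib_right mult.assoc) (rule sum.swap)
  also have "\<dots> = (\<Sum>c<p. (if c = a then x c else 0))"
  proof (rule sum.cong[OF refl])
    fix c assume "c \<in> {..<p}"
    then have "(\<Sum>b<p. A $$ (a, b) * B $$ (b, c)) = (A * B) $$ (a, c)"
      using assms(1,2,4) by (simp add: scalar_prod_def atLeast0LessThan)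
    then show "(\<Sum>b<p. A $$ (a, b) * B $$ (b, c)) * x c = (if c = a then x c else 0)"
      using assms \<open>c \<in> {..<p}\<close> by simp
  qed
  finally show ?thesis using assms by simp
qed

text \<open>
  The normalising constants need not be computed: both sides are probability measures.
\<close>

lemma mvnormal_law:
  assumes S: "positive_definite_mat p S" and m: "m \<in> carrier_vec p"
  shows "\<exists>L. L \<in> carrier_mat p p \<and> det L \<noteq> 0 \<and> (\<forall>(\<Omega> :: 'a measure) X. prob_space \<Omega> \<longrightarrow>
    distributed \<Omega> (lborel_vec p) X (mvnormal_density p m S) \<longrightarrow>
    distr \<Omega> (borel_vec p) X = distr (gauss {..<p}) (borel_vec p) (affine_vec p m L))"
proof -
  obtain M L where M: "M \<in> carrier_mat p p" and L: "L \<in> carrier_mat p p" and MxL: "M * L = 1\<^sub>m p" and LxM: "L * M = 1\<^sub>m p"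
    and q: "\<And>v. v \<in> carrier_vec p \<Longrightarrow> v \<bullet> (the (mat_inverse S) *\<^sub>v v) = (M *\<^sub>v v) \<bullet> (M *\<^sub>v v)"
    using positive_definite_factor[OF S] by blast
  have "det M * det L = 1" using det_mult[OF M L] MxL by (simp add: det_one)
  then have dL: "det L \<noteq> 0" by auto
  let ?I = "{..<p}"
  let ?T = "\<lambda>z. \<lambda>a\<in>?I. \<Sum>b\<in>?I. L $$ (a, b) * z b"
  let ?R = "\<lambda>z. \<lambda>a\<in>?I. \<Sum>b\<in>?I. M $$ (a, b) * z b"
  have sp: "space (lebP ?I) = extensional ?I" by (auto simp: space_PiM PiE_def)
  have mT: "?T \<in> measurable (lebP ?I) (lebP ?I)" and mR: "?R \<in> measurable (lebP ?I) (lebP ?I)"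
    by measurable
  have RT: "?R (?T x) = x" and TR: "?T (?R x) = x" if "x \<in> space (lebP ?I)" for x
    using that mat_mult_inverse_sum[OF M L MxL, of _ x] mat_mult_inverse_sum[OF L M LxM, of _ x] sp
    by (auto simp: fun_eq_iff extensional_def)
  have "\<exists>c. c \<noteq> 0 \<and> c \<noteq> \<infinity> \<and> distr (lebP ?I) (lebP ?I) ?T = density (lebP ?I) (\<lambda>_. c)"
    by (rule distr_lebP_linear[OF _ mT mR RT TR]) (auto simp: sum.distrib algebra_simps fun_eq_iff)
  then obtain c where c: "c \<noteq> 0" "c \<noteq> \<infinity>" "distr (lebP ?I) (lebP ?I) ?T = density (lebP ?I) (\<lambda>_. c)" by blast
  let ?C = "1 / sqrt ((2 * pi) ^ p * det S)"
  let ?k = "(1 / sqrt (2 * pi)) ^ p"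
  \<comment> \<open>The quotient of all constants: normalisation of the given density, Jacobian
    factor of \<open>L\<close> and Gaussian normalisation. The test function \<open>h = 1\<close>
    later gives \<open>r = 1\<close>.\<close>
  define r where "r = ennreal ?C / (c * ennreal ?k)"
  obtain c' where c': "c = ennreal c'" "0 < c'" using c(1,2) by (cases c) (auto simp: less_le)
  let ?e = "\<lambda>z. ennreal (exp (- (\<Sum>a\<in>?I. (z a)\<^sup>2) / 2))"
  have k: "0 < ?k" by simp
  have dens: "mvnormal_density p m S (vec p (\<lambda>a. m $ a + x a)) = ?C * exp (- (\<Sum>a\<in>?I. (?R x a)\<^sup>2) / 2)" for x
  proof -
    have "vec p (\<lambda>a. m $ a + x a) - m = vec p x" using m by (intro eq_vecI) auto
    moreover have "(M *\<^sub>v vec p x) \<bullet> (M *\<^sub>v vec p x) = (\<Sum>a\<in>?I. (?R x a)\<^sup>2)"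
      using M by (auto simp: scalar_prod_def atLeast0LessThan power2_eq_square intro!: sum.cong)
    ultimately show ?thesis using q[of "vec p x"] by (simp add: mvnormal_density_def)
  qed
  show ?thesis
  \<comment> \<open>\<open>L\<close> is fixed before the probability space and the vector, so one
    affine map serves all observations of the sample.\<close>
  proof (intro exI[of _ L] conjI allI impI L dL)
    fix \<Omega> :: "'a measure" and X
    assume "prob_space \<Omega>" and X: "distributed \<Omega> (lborel_vec p) X (mvnormal_density p m S)"
    interpret prob_space \<Omega> by fact
    have sl: "sets (lborel_vec p) = sets (borel_vec p)" by (simp add: lborel_vec_def)
    have mvec: "vec p \<in> measurable (lebP ?I) (borel_vec p)"
      by (intro measurable_to_borel_vec) auto
    have mX: "X \<in> measurable \<Omega> (borel_vec p)"
      using distributed_measurable[OF X] by (simp add: measurable_cong_sets[OF refl sl])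
    have mf: "(\<lambda>v. ennreal (mvnormal_density p m S v)) \<in> borel_measurable (borel_vec p)"
      using distributed_borel_measurable[OF X] by (simp add: measurable_cong_sets[OF sl refl])
    have maff: "affine_vec p m L \<in> measurable (gauss ?I) (borel_vec p)"
      by (intro measurable_affine_vec) (auto intro: measurable_gauss_component)
    have int: "(\<integral>\<^sup>+\<omega>. h (X \<omega>) \<partial>\<Omega>) = r * (\<integral>\<^sup>+z. h (affine_vec p m L z) \<partial>gauss ?I)"
      if h: "h \<in> borel_measurable (borel_vec p)" for h :: "real vec \<Rightarrow> ennreal"
    proof -
      let ?g = "\<lambda>v. ennreal (mvnormal_density p m S v) * h v"
      have g: "?g \<in> borel_measurable (borel_vec p)" using mf h by (rule borel_measurable_times_ennreal)
      let ?g' = "\<lambda>x. ?g (vec p x)"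
      have g': "?g' \<in> borel_measurable (lebP ?I)" using measurable_compose[OF mvec g] .
      let ?s = "\<lambda>x. \<lambda>a\<in>?I. m $ a + 1 * x a"
      have ms: "?s \<in> measurable (lebP ?I) (lebP ?I)" by measurable
      define G where "G x = ?g' (?s x)" for x
      have g'': "G \<in> borel_measurable (lebP ?I)" unfolding G_def[abs_def] using measurable_compose[OF ms g'] .
      have "(\<integral>\<^sup>+\<omega>. h (X \<omega>) \<partial>\<Omega>) = (\<integral>\<^sup>+v. ?g v \<partial>lborel_vec p)"
        using distributed_nn_integral[OF X, of h] h by (simp add: measurable_cong_sets[OF sl refl])
      also have "\<dots> = (\<integral>\<^sup>+x. ?g' x \<partial>lebP ?I)"
        unfolding lborel_vec_def using mvec g by (intro nn_integral_distr) auto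
      also have "\<dots> = (\<integral>\<^sup>+x. ?g' (?s x) \<partial>lebP ?I)"
        using nn_integral_lebP_affine[OF _ _ g', of 1] by simp
      finally have 1: "(\<integral>\<^sup>+\<omega>. h (X \<omega>) \<partial>\<Omega>) = (\<integral>\<^sup>+x. G x \<partial>lebP ?I)" by (simp only: G_def)
      \<comment> \<open>Substituting \<open>x = ?T z\<close> costs the factor \<open>c\<close> and
        turns the quadratic form into the sum of squares of \<open>z\<close>, because
        \<open>?R (?T z) = z\<close>.\<close>
      have "c * (\<integral>\<^sup>+x. G x \<partial>lebP ?I) = (\<integral>\<^sup>+x. G x \<partial>distr (lebP ?I) (lebP ?I) ?T)"
        unfolding c(3) using g'' by (simp add: nn_integral_density nn_integral_cmult)
      also have "\<dots> = (\<integral>\<^sup>+z. G (?T z) \<partial>lebP ?I)"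
        using g'' by (subst nn_integral_distr[OF mT]) simp_all
      also have "\<dots> = (\<integral>\<^sup>+z. ennreal ?C * (?e z * h (affine_vec p m L z)) \<partial>lebP ?I)"
      proof (rule nn_integral_cong)
        fix z assume z: "z \<in> space (lebP ?I)"
        have v: "vec p (?s (?T z)) = vec p (\<lambda>a. m $ a + ?T z a)" by (intro eq_vecI) auto
        have "ennreal (mvnormal_density p m S (vec p (?s (?T z)))) = ennreal ?C * ?e z"
          unfolding v dens RT[OF z] by (rule ennreal_mult'') simp
        moreover have "vec p (?s (?T z)) = affine_vec p m L z"
          unfolding affine_vec_def by (intro eq_vecI) auto
        ultimately show "G (?T z) = ennreal ?C * (?e z * h (affine_vec p m L z))"
          unfolding G_def by (simp only: mult.assoc)
      qed
      also have "\<dots> = ennreal ?C * (\<integral>\<^sup>+z. ?e z * h (affine_vec p m L z) \<partial>lebP ?I)"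
      proof (rule nn_integral_cmult)
        have "(\<lambda>z. h (affine_vec p m L z)) \<in> borel_measurable (lebP ?I)"
          using measurable_compose[OF maff h] by (simp add: measurable_cong_sets[OF sets_gauss_lebP refl])
        then show "(\<lambda>z. ?e z * h (affine_vec p m L z)) \<in> borel_measurable (lebP ?I)" by measurable
      qed
      finally have 2: "c * (\<integral>\<^sup>+x. G x \<partial>lebP ?I) = ennreal ?C * (\<integral>\<^sup>+z. ?e z * h (affine_vec p m L z) \<partial>lebP ?I)" .
      have 3: "(\<integral>\<^sup>+z. h (affine_vec p m L z) \<partial>gauss ?I) = ennreal ?k * (\<integral>\<^sup>+z. ?e z * h (affine_vec p m L z) \<partial>lebP ?I)"
      proof -
        have mh: "(\<lambda>z. h (affine_vec p m L z)) \<in> borel_measurable (lebP ?I)"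
          using measurable_compose[OF maff h] by (simp add: measurable_cong_sets[OF sets_gauss_lebP refl])
        have "(\<integral>\<^sup>+z. h (affine_vec p m L z) \<partial>gauss ?I) = (\<integral>\<^sup>+z. (\<Prod>k\<in>?I. ennreal (std_normal_density (z k))) * h (affine_vec p m L z) \<partial>lebP ?I)"
          unfolding gauss_eq_density[OF finite_lessThan] by (rule nn_integral_density[OF _ mh]) measurable
        also have "\<dots> = (\<integral>\<^sup>+z. ennreal ?k * (?e z * h (affine_vec p m L z)) \<partial>lebP ?I)"
          unfolding gauss_density_eq[OF finite_lessThan] by (intro nn_integral_cong) (simp add: ennreal_mult mult_ac)
        also have "\<dots> = ennreal ?k * (\<integral>\<^sup>+z. ?e z * h (affine_vec p m L z) \<partial>lebP ?I)"
          by (intro nn_integral_cmult borel_measurable_times_ennreal mh) measurable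
        finally show ?thesis .
      qed
      let ?A = "(\<integral>\<^sup>+x. G x \<partial>lebP ?I)" and ?B = "(\<integral>\<^sup>+z. ?e z * h (affine_vec p m L z) \<partial>lebP ?I)"
      have "?A = ?A * c / c" by (rule ennreal_mult_divide_eq[symmetric]) (use c in auto)
      also have "\<dots> = ennreal ?C * ?B * ennreal (inverse c')"
        unfolding mult.commute[of ?A] 2 divide_ennreal_def using c'(2) by (simp only: c'(1) inverse_ennreal)
      also have "ennreal (inverse c') = ennreal (inverse (c' * ?k)) * ennreal ?k"
        using c'(2) k by (subst ennreal_mult[symmetric]) (auto simp: field_simps)
      also have "ennreal ?C * ?B * \<dots> = r * (ennreal ?k * ?B)"
      proof -
        have "c * ennreal ?k = ennreal (c' * ?k)" using c' k by (simp add: ennreal_mult)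
        then have "r = ennreal ?C * ennreal (inverse (c' * ?k))"
          using c'(2) k by (simp only: r_def divide_ennreal_def inverse_ennreal mult_pos_pos)
        then show ?thesis by (simp only: mult_ac)
      qed
      finally show ?thesis unfolding 1 3 .
    qed
    interpret G: prob_space "gauss ?I" by (rule prob_space_gauss)
    have 1: "r = 1"
      using int[of "\<lambda>_. 1"] by (simp add: emeasure_space_1 G.emeasure_space_1)
    show "distr \<Omega> (borel_vec p) X = distr (gauss ?I) (borel_vec p) (affine_vec p m L)"
    proof (rule measure_eqI)
      fix A assume "A \<in> sets (distr \<Omega> (borel_vec p) X)"
      then have A: "A \<in> sets (borel_vec p)" by simp
      have "emeasure (distr \<Omega> (borel_vec p) X) A = (\<integral>\<^sup>+\<omega>. indicator A (X \<omega>) \<partial>\<Omega>)"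
        using nn_integral_distr[OF mX, of "indicator A"] A by simp
      also have "\<dots> = (\<integral>\<^sup>+z. indicator A (affine_vec p m L z) \<partial>gauss ?I)"
        using int[of "indicator A"] A by (simp add: 1)
      also have "\<dots> = emeasure (distr (gauss ?I) (borel_vec p) (affine_vec p m L)) A"
        using nn_integral_distr[OF maff, of "indicator A"] A by simp
      finally show "emeasure (distr \<Omega> (borel_vec p) X) A = emeasure (distr (gauss ?I) (borel_vec p) (affine_vec p m L)) A" .
    qed simp
  qed
qed

section \<open>The characteristic function of the likelihood ratio\<close>

lemma centred_sum_affine:
  assumes D: "finite D" "D \<noteq> {}"
  shows "centred_sum D (\<lambda>c. m + (\<Sum>b<p. l b * z b c)) g = (\<Sum>b<p. l b * centred_sum D (z b) g)"
proof -
  have cD: "real (card D) \<noteq> 0" using D by auto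
  have 1: "(\<Sum>c\<in>D. (m + (\<Sum>b<p. l b * z b c)) * g c) = m * (\<Sum>c\<in>D. g c) + (\<Sum>b<p. l b * (\<Sum>c\<in>D. z b c * g c))"
    by (simp add: sum.distrib distrib_right sum_distrib_left sum_distrib_right mult.assoc) (rule sum.swap)
  have 2: "(\<Sum>c\<in>D. m + (\<Sum>b<p. l b * z b c)) = card D * m + (\<Sum>b<p. l b * (\<Sum>c\<in>D. z b c))"
    by (simp add: sum.distrib sum_distrib_left) (rule sum.swap)
  have "centred_sum D (\<lambda>c. m + (\<Sum>b<p. l b * z b c)) g
    = m * (\<Sum>c\<in>D. g c) + (\<Sum>b<p. l b * (\<Sum>c\<in>D. z b c * g c))
      - (card D * m + (\<Sum>b<p. l b * (\<Sum>c\<in>D. z b c))) * (\<Sum>c\<in>D. g c) / card D"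
    unfolding centred_sum_def 1 2 ..
  also have "\<dots> = (\<Sum>b<p. l b * (\<Sum>c\<in>D. z b c * g c)) - (\<Sum>b<p. l b * (\<Sum>c\<in>D. z b c)) * (\<Sum>c\<in>D. g c) / card D"
    using cD by (simp add: field_simps)
  also have "\<dots> = (\<Sum>b<p. l b * centred_sum D (z b) g)"
  proof -
    define S where "S b = (\<Sum>c\<in>D. z b c)" for b
    have "(\<Sum>b<p. l b * S b) * (\<Sum>c\<in>D. g c) / card D = (\<Sum>b<p. l b * (S b * (\<Sum>c\<in>D. g c) / card D))"
      by (simp only: sum_distrib_right sum_divide_distrib mult.assoc times_divide_eq_right)
    then show ?thesis
      unfolding centred_sum_def S_def by (simp add: right_diff_distrib sum_subtractf)
  qed
  finally show ?thesis .
qed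

lemma centred_sum_commute: "centred_sum D f g = centred_sum D g f"
  by (simp add: centred_sum_def mult.commute)

text \<open>Centring removes the shift \<open>m\<close>, and bilinearity gives the matrix
  \<open>L ?C L^T\<close>.\<close>

lemma det_centred_sum_affine:
  assumes D: "finite D" "D \<noteq> {}" and L: "L \<in> carrier_mat p p"
  shows "det (mat p p (\<lambda>(a, a'). centred_sum D (\<lambda>c. m a + (\<Sum>b<p. L $$ (a, b) * z b c)) (\<lambda>c. m a' + (\<Sum>b<p. L $$ (a', b) * z b c))))
    = (det L)\<^sup>2 * det (mat p p (\<lambda>(a, b). centred_sum D (z a) (z b)))"
proof -
  let ?C = "mat p p (\<lambda>(a, b). centred_sum D (z a) (z b))"
  let ?A = "mat p p (\<lambda>(a, a'). centred_sum D (\<lambda>c. m a + (\<Sum>b<p. L $$ (a, b) * z b c)) (\<lambda>c. m a' + (\<Sum>b<p. L $$ (a', b) * z b c)))"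
  have "?A = L * ?C * transpose_mat L"
  proof (rule eq_matI)
    fix a a' assume "a < dim_row (L * ?C * transpose_mat L)" "a' < dim_col (L * ?C * transpose_mat L)"
    then have a: "a < p" "a' < p" using L by auto
    have "?A $$ (a, a') = (\<Sum>b<p. L $$ (a, b) * centred_sum D (z b) (\<lambda>c. m a' + (\<Sum>b<p. L $$ (a', b) * z b c)))"
      using a by (simp add: centred_sum_affine[OF D])
    also have "\<dots> = (\<Sum>b<p. L $$ (a, b) * (\<Sum>b'<p. L $$ (a', b') * centred_sum D (z b) (z b')))"
      by (simp add: centred_sum_commute[of D "z _" "\<lambda>c. m a' + _ c"] centred_sum_affine[OF D] centred_sum_commute[of D "z _" "z _"])
    also have "\<dots> = (\<Sum>b'<p. (\<Sum>b<p. L $$ (a, b) * centred_sum D (z b) (z b')) * L $$ (a', b'))"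
      by (simp add: sum_distrib_left sum_distrib_right mult_ac) (rule sum.swap)
    also have "\<dots> = (L * ?C * transpose_mat L) $$ (a, a')"
      using a L by (simp add: scalar_prod_def atLeast0LessThan)
    finally show "?A $$ (a, a') = (L * ?C * transpose_mat L) $$ (a, a')" .
  qed (use L in auto)
  also have "det \<dots> = det L * det ?C * det (transpose_mat L)"
    using L by (simp add: det_mult[where n = p])
  finally show ?thesis using L by (simp add: det_transpose[OF L] power2_eq_square)
qed

section \<open>The statistic as a function of the data array\<close>

definition block :: "(nat \<Rightarrow> nat) \<Rightarrow> nat \<Rightarrow> (nat \<times> nat) set" where
  "block N j = {j} \<times> {1..N j}"

definition blocks :: "nat \<Rightarrow> (nat \<Rightarrow> nat) \<Rightarrow> (nat \<times> nat) set" where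
  "blocks q N = (SIGMA j:{1..q}. {1..N j})"

lemma card_block: "card (block N j) = N j"
  by (simp add: block_def card_cartesian_product)

lemma finite_block [simp]: "finite (block N j)" and finite_blocks [simp]: "finite (blocks q N)"
  by (auto simp: block_def blocks_def)

lemma card_blocks: "card (blocks q N) = (\<Sum>j=1..q. N j)"
  by (simp add: blocks_def)

lemma sum_block: "(\<Sum>c\<in>block N j. f c) = (\<Sum>k=1..N j. f (j, k))"
proof -
  have "block N j = Pair j ` {1..N j}" by (auto simp: block_def)
  then show ?thesis by (simp add: sum.reindex inj_on_def)
qed

lemma sum_blocks: "(\<Sum>c\<in>blocks q N. f c) = (\<Sum>j=1..q. \<Sum>k=1..N j. f (j, k))"
  unfolding blocks_def by (subst sum.Sigma) (auto simp: split_beta')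

definition scatter_det :: "nat \<Rightarrow> 'c set \<Rightarrow> (nat \<Rightarrow> 'c \<Rightarrow> real) \<Rightarrow> real" where
  "scatter_det p D z = det (mat p p (\<lambda>(a, b). centred_sum D (z a) (z b)))"

lemma scatter_det_cong:
  assumes "\<And>a c. a < p \<Longrightarrow> c \<in> D \<Longrightarrow> y a c = z a c"
  shows "scatter_det p D y = scatter_det p D z"
proof -
  have "centred_sum D (y a) (y b) = centred_sum D (z a) (z b)" if "a < p" "b < p" for a b
    using assms that by (simp add: centred_sum_def)
  then show ?thesis unfolding scatter_det_def by (intro arg_cong[where f = det] eq_matI) auto
qed

lemma measurable_scatter_det:
  assumes "\<And>a c. a < p \<Longrightarrow> c \<in> D \<Longrightarrow> (\<lambda>x. z x a c) \<in> borel_measurable M"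
  shows "(\<lambda>x. scatter_det p D (z x)) \<in> borel_measurable M"
  unfolding scatter_det_def centred_sum_def using assms
  by (intro measurable_det_mat borel_measurable_diff borel_measurable_divide borel_measurable_times borel_measurable_sum) auto

text \<open>\<open>likelihood_ratio\<close> for an array \<open>z a c\<close> (coordinate
  \<open>a\<close> of observation \<open>c\<close>), with the scalars \<open>1 / N j\<close> and
  \<open>1 / n\<close> already taken out of the determinants as \<open>p\<close>-th powers.\<close>

definition lr_stat :: "nat \<Rightarrow> nat \<Rightarrow> (nat \<Rightarrow> nat) \<Rightarrow> (nat \<Rightarrow> nat \<times> nat \<Rightarrow> real) \<Rightarrow> real" where
  "lr_stat p q N z =
     (\<Prod>j=1..q. ((1 / real (N j)) ^ p * scatter_det p (block N j) z) powr (real (N j) / 2))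
     / ((1 / real (\<Sum>j=1..q. N j)) ^ p * scatter_det p (blocks q N) z) powr (real (\<Sum>j=1..q. N j) / 2)"

lemma centred_sum_eq:
  assumes D: "finite D" "D \<noteq> {}"
  shows "(\<Sum>c\<in>D. (f c - (\<Sum>c\<in>D. f c) / card D) * (g c - (\<Sum>c\<in>D. g c) / card D)) = centred_sum D f g"
proof -
  let ?F = "\<Sum>c\<in>D. f c" and ?G = "\<Sum>c\<in>D. g c" and ?n = "real (card D)"
  have n: "?n \<noteq> 0" using D by auto
  have "(\<Sum>c\<in>D. (f c - ?F / ?n) * (g c - ?G / ?n)) = (\<Sum>c\<in>D. f c * g c - f c * (?G / ?n) - ?F / ?n * g c + ?F / ?n * (?G / ?n))"
    by (intro sum.cong) (auto simp: algebra_simps)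
  also have "\<dots> = (\<Sum>c\<in>D. f c * g c) - ?F * (?G / ?n) - ?F / ?n * ?G + ?n * (?F / ?n * (?G / ?n))"
    by (simp only: sum.distrib sum_subtractf sum_distrib_left[symmetric] sum_distrib_right[symmetric] sum_constant mult.left_commute)
  also have "\<dots> = centred_sum D f g" using n by (simp add: centred_sum_def field_simps)
  finally show ?thesis .
qed

lemma likelihood_ratio_eq_lr_stat:
  assumes q: "0 < q" and N: "\<And>j. j \<in> {1..q} \<Longrightarrow> 0 < N j"
  shows "likelihood_ratio p q N x = lr_stat p q N (\<lambda>a c. x (fst c) (snd c) $ a)"
proof -
  let ?z = "\<lambda>a c. x (fst c) (snd c) $ a"
  have 1: "det ((1 / real (N j)) \<cdot>\<^sub>m within_scatter p N x j) = (1 / real (N j)) ^ p * scatter_det p (block N j) ?z"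
    if "j \<in> {1..q}" for j
  proof -
    have ne: "block N j \<noteq> {}" using N[OF that] by (auto simp: block_def)
    have "within_scatter p N x j = mat p p (\<lambda>(a, b). centred_sum (block N j) (?z a) (?z b))"
      unfolding within_scatter_def
      by (intro eq_matI) (auto simp: group_mean_def centred_sum_eq[OF finite_block ne, symmetric] card_block sum_block)
    moreover have "within_scatter p N x j \<in> carrier_mat p p" by (simp add: within_scatter_def)
    ultimately show ?thesis by (simp add: det_smult scatter_det_def)
  qed
  have "block N q \<subseteq> blocks q N" "block N q \<noteq> {}" using q N[of q] by (auto simp: block_def blocks_def)
  then have ne: "blocks q N \<noteq> {}" by auto
  have "total_scatter p q N x = mat p p (\<lambda>(a, b). centred_sum (blocks q N) (?z a) (?z b))"
    unfolding total_scatter_def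
    by (intro eq_matI) (auto simp: overall_mean_def total_size_def centred_sum_eq[OF finite_blocks ne, symmetric] card_blocks sum_blocks)
  moreover have "total_scatter p q N x \<in> carrier_mat p p" by (simp add: total_scatter_def)
  ultimately have 2: "det ((1 / real (total_size q N)) \<cdot>\<^sub>m total_scatter p q N x)
    = (1 / real (\<Sum>j=1..q. N j)) ^ p * scatter_det p (blocks q N) ?z"
    by (simp add: det_smult scatter_det_def total_size_def)
  show ?thesis unfolding likelihood_ratio_def lr_stat_def 2 using 1 by (simp add: total_size_def)
qed

lemma lr_stat_cong:
  assumes "\<And>a c. a < p \<Longrightarrow> c \<in> blocks q N \<Longrightarrow> y a c = z a c"
  shows "lr_stat p q N y = lr_stat p q N z"
proof -
  have "scatter_det p (block N j) y = scatter_det p (block N j) z" if "j \<in> {1..q}" for j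
    using assms that by (intro scatter_det_cong) (auto simp: block_def blocks_def)
  moreover have "scatter_det p (blocks q N) y = scatter_det p (blocks q N) z"
    using assms by (intro scatter_det_cong)
  ultimately show ?thesis by (simp add: lr_stat_def)
qed

lemma measurable_lr_stat:
  assumes "\<And>a c. a < p \<Longrightarrow> c \<in> blocks q N \<Longrightarrow> (\<lambda>x. z x a c) \<in> borel_measurable M"
  shows "(\<lambda>x. lr_stat p q N (z x)) \<in> borel_measurable M"
proof -
  have "block N j \<subseteq> blocks q N" if "j \<in> {1..q}" for j using that by (auto simp: block_def blocks_def)
  then have "(\<lambda>x. scatter_det p (block N j) (z x)) \<in> borel_measurable M" if "j \<in> {1..q}" for j
    using assms that by (intro measurable_scatter_det) blast
  moreover have "(\<lambda>x. scatter_det p (blocks q N) (z x)) \<in> borel_measurable M"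
    using assms by (rule measurable_scatter_det)
  ultimately show ?thesis unfolding lr_stat_def
    by (intro borel_measurable_divide borel_measurable_prod powr_real_measurable borel_measurable_times borel_measurable_const)
qed

lemma chi_char_0: "0 < d \<Longrightarrow> chi_char d 0 = 1"
proof -
  assume d: "0 < d"
  have "Gamma (of_real (real d / 2)) \<noteq> (0::complex)"
  proof
    assume "Gamma (of_real (real d / 2)) = (0::complex)"
    then have "chi_char d 0 = 0" by (simp only: chi_char_def div_by_0)
    then show False using chi_char_nonzero[OF d] by simp
  qed
  then show ?thesis by (simp add: chi_char_def Complex_eq)
qed

lemma xi_zero_exponent: "xi 0 x = (if x = 0 then 0 else 1)"
  by (simp add: xi_def)

text \<open>With all exponents \<open>0\<close> each \<open>xi\<close> indicates that its
  determinant is nonzero, so the integral in \<open>integral_gram_char\<close> is the probability of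
  nondegeneracy. The right-hand side of the formula is then \<open>1\<close>.\<close>

lemma AE_gram_nonzero:
  fixes D :: "'j \<Rightarrow> 'c set"
  assumes C: "finite C" and J: "finite J" "J \<noteq> {}" and D: "\<And>j. j \<in> J \<Longrightarrow> D j \<subseteq> C \<and> p < card (D j)"
    and dis: "disjoint_family_on D J"
  shows "AE \<omega> in gauss ({1..p} \<times> C). (\<forall>j\<in>J. gram (Suc p) (D j) (ones_rows \<omega>) \<noteq> 0) \<and> gram (Suc p) C (ones_rows \<omega>) \<noteq> 0"
proof -
  let ?G = "gauss ({1..p} \<times> C)"
  let ?F = "\<lambda>\<omega>. gram_char J D C (\<lambda>_. 0) (Suc p) (ones_rows \<omega>)"
  interpret G: prob_space ?G by (rule prob_space_gauss)
  have Feq: "?F \<omega> = (if (\<forall>j\<in>J. gram (Suc p) (D j) (ones_rows \<omega>) \<noteq> 0) \<and> gram (Suc p) C (ones_rows \<omega>) \<noteq> 0 then 1 else 0)" for \<omega>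
    using J by (auto simp: gram_char_def xi_zero_exponent prod_zero_iff intro!: prod.neutral)
  obtain j where j: "j \<in> J" using J by blast
  have cC: "p < card C" using D[OF j] card_mono[OF C, of "D j"] by auto
  have rf: "row_factor J (\<lambda>j. card (D j)) (card C) (\<lambda>_. 0) i = 1" if "i \<in> {1..p}" for i
  proof -
    have "chi_char (card (D j) - i) 0 = 1" if "j \<in> J" for j using D[OF that] \<open>i \<in> {1..p}\<close> by (intro chi_char_0) auto
    moreover have "chi_char (card C - i) 0 = 1" using cC that by (intro chi_char_0) auto
    ultimately show ?thesis by (simp add: row_factor_def)
  qed
  have cD: "card (D j) \<noteq> 0" if "j \<in> J" for j using D[OF that] by auto
  have m: "?F \<in> borel_measurable ?G"
    using D by (intro measurable_gram_char measurable_ones_rows) auto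
  have int: "integrable ?G ?F"
    using m by (intro G.integrable_const_bound[where B = 1]) (auto simp: norm_gram_char_le)
  have "(\<integral>\<omega>. ?F \<omega> \<partial>?G) = 1"
    using integral_gram_char[OF C J D dis, of "\<lambda>_. 0"] cD cC by (simp add: rf xi_zero_exponent)
  then have "(\<integral>\<omega>. 1 - Re (?F \<omega>) \<partial>?G) = 0"
    using integrable_Re[OF int] integral_Re[OF int] G.prob_space by (simp del: One_nat_def)
  moreover have "integrable ?G (\<lambda>\<omega>. 1 - Re (?F \<omega>))"
    by (intro Bochner_Integration.integrable_diff G.integrable_const integrable_Re[OF int])
  moreover have "0 \<le> 1 - Re (?F \<omega>)" for \<omega> by (simp add: Feq)
  ultimately have "AE \<omega> in ?G. 1 - Re (?F \<omega>) = 0"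
    by (subst (asm) integral_nonneg_eq_0_iff_AE) auto
  then show ?thesis by (rule AE_mp) (auto simp: Feq split: if_splits)
qed

text \<open>The bordered Gram determinant is \<open>card D\<close> times the scatter determinant,
  hence the coefficient \<open>p + 1\<close> of the logarithms of the sample sizes where the
  statistic itself has \<open>p\<close>.\<close>

lemma lr_stat_affine:
  assumes q: "0 < q" and N: "\<And>j. j \<in> {1..q} \<Longrightarrow> p < N j" and L: "L \<in> carrier_mat p p" "det L \<noteq> 0"
    and nz: "\<And>j. j \<in> {1..q} \<Longrightarrow> gram (Suc p) (block N j) (ones_rows \<omega>) \<noteq> 0" "gram (Suc p) (blocks q N) (ones_rows \<omega>) \<noteq> 0"
  defines "n \<equiv> real (\<Sum>j=1..q. N j)"
  shows "ln (lr_stat p q N (\<lambda>a c. m a + (\<Sum>b<p. L $$ (a, b) * \<omega> (Suc b, c))))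
    = (\<Sum>j=1..q. N j / 2 * (ln (gram (Suc p) (block N j) (ones_rows \<omega>)) - (real p + 1) * ln (N j)))
      - n / 2 * (ln (gram (Suc p) (blocks q N) (ones_rows \<omega>)) - (real p + 1) * ln n)"
proof -
  let ?y = "\<lambda>a c. m a + (\<Sum>b<p. L $$ (a, b) * \<omega> (Suc b, c))"
  let ?d = "(det L)\<^sup>2"
  have d: "0 < ?d" using L(2) by simp
  have g: "0 < (1 / card D) ^ p * scatter_det p D ?y" 
      "ln ((1 / card D) ^ p * scatter_det p D ?y) = ln ?d + (ln (gram (Suc p) D (ones_rows \<omega>)) - (real p + 1) * ln (card D))"
    if D: "finite D" "D \<noteq> {}" "gram (Suc p) D (ones_rows \<omega>) \<noteq> 0" for D
  proof -
    have G: "0 < gram (Suc p) D (ones_rows \<omega>)" using gram_nonneg[OF D(1)] D(3) by (simp add: less_le)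
    have c: "0 < real (card D)" using D by (simp add: card_gt_0_iff)
    have "scatter_det p D ?y = ?d * scatter_det p D (\<lambda>b. ones_rows \<omega> (Suc b))"
      unfolding scatter_det_def using det_centred_sum_affine[OF D(1,2) L(1), of m "\<lambda>b c. \<omega> (Suc b, c)"]
      by (simp add: ones_rows_def[abs_def])
    moreover have "gram (Suc p) D (ones_rows \<omega>) = card D * scatter_det p D (\<lambda>b. ones_rows \<omega> (Suc b))"
      unfolding scatter_det_def by (rule gram_ones_row[OF D(1,2)]) (simp add: ones_rows_def)
    ultimately have e: "(1 / card D) ^ p * scatter_det p D ?y = ?d * (gram (Suc p) D (ones_rows \<omega>) / card D ^ Suc p)"
      using c by (simp add: power_divide)
    show "0 < (1 / card D) ^ p * scatter_det p D ?y" unfolding e using d G c by simp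
    have "ln (real (card D) ^ Suc p) = (real p + 1) * ln (card D)"
      using c by (subst ln_realpow) auto
    then show "ln ((1 / card D) ^ p * scatter_det p D ?y) = ln ?d + (ln (gram (Suc p) D (ones_rows \<omega>)) - (real p + 1) * ln (card D))"
      unfolding e using d G c by (simp only: ln_mult_pos ln_divide_pos divide_pos_pos zero_less_power of_nat_power)
  qed
  have ne: "block N j \<noteq> {}" if "j \<in> {1..q}" for j using N[OF that] by (auto simp: block_def)
  have "block N q \<subseteq> blocks q N" using q by (auto simp: block_def blocks_def)
  then have net: "blocks q N \<noteq> {}" using ne[of q] q by auto
  have gj: "0 < (1 / real (N j)) ^ p * scatter_det p (block N j) ?y"
    "ln ((1 / real (N j)) ^ p * scatter_det p (block N j) ?y) = ln ?d + (ln (gram (Suc p) (block N j) (ones_rows \<omega>)) - (real p + 1) * ln (N j))"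
    if "j \<in> {1..q}" for j
    using g[OF finite_block ne[OF that] nz(1)[OF that], unfolded card_block] by auto
  have gt: "0 < (1 / n) ^ p * scatter_det p (blocks q N) ?y"
    "ln ((1 / n) ^ p * scatter_det p (blocks q N) ?y) = ln ?d + (ln (gram (Suc p) (blocks q N) (ones_rows \<omega>)) - (real p + 1) * ln n)"
    using g[OF finite_blocks net nz(2), unfolded card_blocks, folded n_def] by auto
  have pj: "0 < ((1 / real (N j)) ^ p * scatter_det p (block N j) ?y) powr (real (N j) / 2)" if "j \<in> {1..q}" for j
    unfolding powr_gt_zero using gj(1)[OF that] by (rule less_imp_neq[symmetric])
  have pt: "0 < ((1 / n) ^ p * scatter_det p (blocks q N) ?y) powr (n / 2)"
    unfolding powr_gt_zero using gt(1) by (rule less_imp_neq[symmetric])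
  have "ln (lr_stat p q N ?y) = ln (\<Prod>j=1..q. ((1 / real (N j)) ^ p * scatter_det p (block N j) ?y) powr (real (N j) / 2))
     - ln (((1 / n) ^ p * scatter_det p (blocks q N) ?y) powr (n / 2))"
    unfolding lr_stat_def n_def[symmetric] 
    by (rule ln_divide_pos[OF prod_pos[OF pj] pt])
  also have "ln (\<Prod>j=1..q. ((1 / real (N j)) ^ p * scatter_det p (block N j) ?y) powr (real (N j) / 2))
     = (\<Sum>j=1..q. real (N j) / 2 * ln ((1 / real (N j)) ^ p * scatter_det p (block N j) ?y))"
    by (subst ln_prod[OF finite_atLeastAtMost less_imp_neq[OF pj, symmetric]]) (simp_all only: ln_powr)
  also have "ln (((1 / n) ^ p * scatter_det p (blocks q N) ?y) powr (n / 2)) = n / 2 * ln ((1 / n) ^ p * scatter_det p (blocks q N) ?y)"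
    by (simp only: ln_powr)
  also have "(\<Sum>j=1..q. real (N j) / 2 * ln ((1 / real (N j)) ^ p * scatter_det p (block N j) ?y)) - n / 2 * ln ((1 / n) ^ p * scatter_det p (blocks q N) ?y)
    = (\<Sum>j=1..q. N j / 2 * ln ?d) - n / 2 * ln ?d
    + ((\<Sum>j=1..q. N j / 2 * (ln (gram (Suc p) (block N j) (ones_rows \<omega>)) - (real p + 1) * ln (N j)))
      - n / 2 * (ln (gram (Suc p) (blocks q N) (ones_rows \<omega>)) - (real p + 1) * ln n))"
    unfolding gt(2) using gj(2) by (simp add: sum.distrib[symmetric] distrib_left)
  \<comment> \<open>The common normal law drops out here: all groups and the total carry the same
    factor \<open>?d\<close>, and the exponents \<open>N j / 2\<close> add up to
    \<open>n / 2\<close>.\<close>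
  also have "(\<Sum>j=1..q. N j / 2 * ln ?d) = n / 2 * ln ?d"
    by (simp add: n_def sum_distrib_right sum_divide_distrib)
  finally show ?thesis by simp
qed

text \<open>The phase comes from the normalisations by \<open>N j\<close> and \<open>n\<close>. Its
  coefficient is \<open>p\<close> because the row of ones contributes \<open>card D\<close> to each
  Gram determinant, which lowers the \<open>p + 1\<close> of \<open>lr_stat_affine\<close> by
  one.\<close>

definition lr_char :: "nat \<Rightarrow> nat \<Rightarrow> (nat \<Rightarrow> nat) \<Rightarrow> real \<Rightarrow> complex" where
  "lr_char p q N s =
     exp (\<i> * of_real (s * (p * (real (\<Sum>j=1..q. N j) / 2 * ln (real (\<Sum>j=1..q. N j)) - (\<Sum>j=1..q. N j / 2 * ln (N j))))))
     * (\<Prod>i=1..p. row_factor {1..q} N (\<Sum>j=1..q. N j) (\<lambda>j. s * (N j / 2)) i)"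

text \<open>Off a null set all determinants are positive; there \<open>xi\<close> is a genuine
  imaginary power and the logarithm of the statistic splits.\<close>

lemma integral_exp_lr_stat:
  assumes q: "0 < q" and N: "\<And>j. j \<in> {1..q} \<Longrightarrow> p < N j" and L: "L \<in> carrier_mat p p" "det L \<noteq> 0"
  shows "(\<integral>\<omega>. exp (\<i> * of_real (s * ln (lr_stat p q N (\<lambda>a c. m a + (\<Sum>b<p. L $$ (a, b) * \<omega> (Suc b, c))))))
      \<partial>gauss ({1..p} \<times> blocks q N)) = lr_char p q N s"
proof -
  let ?G = "gauss ({1..p} \<times> blocks q N)"
  let ?y = "\<lambda>\<omega> a c. m a + (\<Sum>b<p. L $$ (a, b) * \<omega> (Suc b, c))"
  let ?w = "\<lambda>j. s * (N j / 2)"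
  let ?J = "{1..q}"
  let ?F = "\<lambda>\<omega>. gram_char ?J (block N) (blocks q N) ?w (Suc p) (ones_rows \<omega>)"
  define n where "n = real (\<Sum>j=1..q. N j)"
  define c where "c = (real p + 1) * (n / 2 * ln n - (\<Sum>j=1..q. N j / 2 * ln (N j)))"
  have J: "finite ?J" "?J \<noteq> {}" using q by auto
  have D: "block N j \<subseteq> blocks q N \<and> p < card (block N j)" if "j \<in> ?J" for j
    using that N[OF that] by (auto simp: card_block) (auto simp: block_def blocks_def)
  have dis: "disjoint_family_on (block N) ?J" by (auto simp: disjoint_family_on_def block_def)
  have sw: "(\<Sum>j\<in>?J. ?w j) = s * (n / 2)"
    by (simp add: n_def sum_distrib_left sum_divide_distrib)
  have "N q \<le> (\<Sum>j=1..q. N j)" using q by (intro member_le_sum) auto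
  then have npos: "0 < n" using N[of q] q unfolding n_def of_nat_0_less_iff by auto
  have Npos: "0 < real (N j)" if "j \<in> ?J" for j using N[OF that] by simp
  have mF: "?F \<in> borel_measurable ?G"
    using D by (intro measurable_gram_char measurable_ones_rows) auto
  have my: "(\<lambda>\<omega>. lr_stat p q N (?y \<omega>)) \<in> borel_measurable ?G"
    by (intro measurable_lr_stat borel_measurable_add borel_measurable_const borel_measurable_sum borel_measurable_times
      measurable_gauss_component) auto
  have AE0: "AE \<omega> in ?G. (\<forall>j\<in>?J. gram (Suc p) (block N j) (ones_rows \<omega>) \<noteq> 0) \<and> gram (Suc p) (blocks q N) (ones_rows \<omega>) \<noteq> 0"
    by (rule AE_gram_nonzero[OF finite_blocks J D dis])
  have "(\<integral>\<omega>. exp (\<i> * of_real (s * ln (lr_stat p q N (?y \<omega>)))) \<partial>?G) = (\<integral>\<omega>. exp (\<i> * of_real (s * c)) * ?F \<omega> \<partial>?G)"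
  proof (rule integral_cong_AE)
    show "(\<lambda>\<omega>. exp (\<i> * of_real (s * ln (lr_stat p q N (?y \<omega>))))) \<in> borel_measurable ?G" using my by measurable
    show "(\<lambda>\<omega>. exp (\<i> * of_real (s * c)) * ?F \<omega>) \<in> borel_measurable ?G" using mF by measurable
    show "AE \<omega> in ?G. exp (\<i> * of_real (s * ln (lr_stat p q N (?y \<omega>)))) = exp (\<i> * of_real (s * c)) * ?F \<omega>"
    proof (rule AE_mp[OF AE0], intro AE_I2 impI)
      fix \<omega>
      assume nz: "(\<forall>j\<in>?J. gram (Suc p) (block N j) (ones_rows \<omega>) \<noteq> 0) \<and> gram (Suc p) (blocks q N) (ones_rows \<omega>) \<noteq> 0"
      let ?g = "\<lambda>D. gram (Suc p) D (ones_rows \<omega>)"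
      have gj: "0 < ?g (block N j)" if "j \<in> ?J" for j
        using gram_nonneg[of "block N j" "Suc p" "ones_rows \<omega>"] nz that by (simp add: less_le)
      have gt: "0 < ?g (blocks q N)"
        using gram_nonneg[of "blocks q N" "Suc p" "ones_rows \<omega>"] nz by (simp add: less_le)
      have F: "?F \<omega> = exp (\<i> * of_real ((\<Sum>j\<in>?J. ?w j * ln (?g (block N j))) - s * (n / 2) * ln (?g (blocks q N))))"
      proof -
        have "(\<Prod>j\<in>?J. xi (?w j) (?g (block N j))) = exp (\<i> * of_real (\<Sum>j\<in>?J. ?w j * ln (?g (block N j))))"
        proof -
          have "(\<Prod>j\<in>?J. xi (?w j) (?g (block N j))) = (\<Prod>j\<in>?J. exp (\<i> * of_real (?w j * ln (?g (block N j)))))"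
            using gj by (intro prod.cong refl) (auto simp: xi_def less_imp_neq[symmetric] abs_of_pos)
          then show ?thesis by (simp add: exp_sum[symmetric] sum_distrib_left)
        qed
        moreover have "xi (- (\<Sum>j\<in>?J. ?w j)) (?g (blocks q N)) = exp (\<i> * of_real (- (s * (n / 2) * ln (?g (blocks q N)))))"
          unfolding sw using gt by (simp add: xi_def)
        ultimately show ?thesis
          unfolding gram_char_def by (simp add: exp_add[symmetric] algebra_simps)
      qed
      have "s * ln (lr_stat p q N (?y \<omega>)) = s * c + ((\<Sum>j\<in>?J. ?w j * ln (?g (block N j))) - s * (n / 2) * ln (?g (blocks q N)))"
      proof -
        have "ln (lr_stat p q N (?y \<omega>)) = (\<Sum>j=1..q. N j / 2 * (ln (?g (block N j)) - (real p + 1) * ln (N j)))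
            - n / 2 * (ln (?g (blocks q N)) - (real p + 1) * ln n)"
          unfolding n_def using nz by (intro lr_stat_affine[OF q N L]) auto
        also have "\<dots> = c + ((\<Sum>j=1..q. N j / 2 * ln (?g (block N j))) - n / 2 * ln (?g (blocks q N)))"
        proof -
          have "(\<Sum>j=1..q. N j / 2 * (ln (?g (block N j)) - (real p + 1) * ln (N j)))
            = (\<Sum>j=1..q. N j / 2 * ln (?g (block N j))) - (real p + 1) * (\<Sum>j=1..q. N j / 2 * ln (N j))"
            unfolding sum_distrib_left sum_subtractf[symmetric] by (intro sum.cong refl) (simp add: algebra_simps)
          then show ?thesis by (simp add: c_def algebra_simps)
        qed
        finally show ?thesis by (simp add: distrib_left right_diff_distrib sum_distrib_left mult.assoc)
      qed
      then show "exp (\<i> * of_real (s * ln (lr_stat p q N (?y \<omega>)))) = exp (\<i> * of_real (s * c)) * ?F \<omega>"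
        unfolding F by (simp only: of_real_add distrib_left exp_add)
    qed
  qed
  also have "\<dots> = exp (\<i> * of_real (s * c)) * (\<integral>\<omega>. ?F \<omega> \<partial>?G)" by simp
  also have "(\<integral>\<omega>. ?F \<omega> \<partial>?G) = (\<Prod>j\<in>?J. xi (?w j) (card (block N j))) * xi (- (\<Sum>j\<in>?J. ?w j)) (card (blocks q N))
      * (\<Prod>i=1..p. row_factor ?J (\<lambda>j. card (block N j)) (card (blocks q N)) ?w i)"
    by (rule integral_gram_char[OF finite_blocks J D dis])
  also have "\<dots> = exp (\<i> * of_real ((\<Sum>j\<in>?J. ?w j * ln (N j)) - s * (n / 2) * ln n))
      * (\<Prod>i=1..p. row_factor ?J N (\<Sum>j=1..q. N j) ?w i)"
  proof -
    have "(\<Prod>j\<in>?J. xi (?w j) (N j)) = (\<Prod>j\<in>?J. exp (\<i> * of_real (?w j * ln (N j))))"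
      using Npos by (intro prod.cong refl) (auto simp: xi_def)
    also have "\<dots> = exp (\<i> * of_real (\<Sum>j\<in>?J. ?w j * ln (N j)))"
      by (simp add: exp_sum[symmetric] sum_distrib_left)
    finally have 1: "(\<Prod>j\<in>?J. xi (?w j) (N j)) = exp (\<i> * of_real (\<Sum>j\<in>?J. ?w j * ln (N j)))" .
    have 2: "xi (- (\<Sum>j\<in>?J. ?w j)) n = exp (\<i> * of_real (- (s * (n / 2) * ln n)))"
      unfolding sw using npos by (simp add: xi_def)
    show ?thesis
      unfolding card_block card_blocks 1 n_def[symmetric] 2
      by (simp only: exp_add[symmetric] distrib_left[symmetric] of_real_add[symmetric] diff_conv_add_uminus)
  qed
  also have "exp (\<i> * of_real (s * c)) * (exp (\<i> * of_real ((\<Sum>j\<in>?J. ?w j * ln (N j)) - s * (n / 2) * ln n))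
      * (\<Prod>i=1..p. row_factor ?J N (\<Sum>j=1..q. N j) ?w i))
    = exp (\<i> * of_real (s * c + ((\<Sum>j\<in>?J. ?w j * ln (N j)) - s * (n / 2) * ln n)))
      * (\<Prod>i=1..p. row_factor ?J N (\<Sum>j=1..q. N j) ?w i)"
    by (simp only: exp_add[symmetric] distrib_left[symmetric] of_real_add[symmetric] mult.assoc[symmetric])
  also have "s * c + ((\<Sum>j\<in>?J. ?w j * ln (N j)) - s * (n / 2) * ln n) = s * (p * (n / 2 * ln n - (\<Sum>j=1..q. N j / 2 * ln (N j))))"
  proof -
    have "(\<Sum>j\<in>?J. ?w j * ln (N j)) = s * (\<Sum>j=1..q. N j / 2 * ln (N j))"
      unfolding sum_distrib_left by (intro sum.cong refl) simp
    then show ?thesis unfolding c_def by (simp add: algebra_simps)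
  qed
  finally show ?thesis unfolding lr_char_def n_def .
qed

text \<open>
  The columns of the matrix with independent standard normal entries are independent, so the sample
  has the law of the images of these columns under \<open>affine_vec\<close>.
\<close>

lemma likelihood_ratio_law:
  assumes \<Omega>: "prob_space \<Omega>" and p: "0 < p" and q: "0 < q" and N: "\<And>j. j \<in> {1..q} \<Longrightarrow> p < N j"
    and S: "positive_definite_mat p S" and m: "m \<in> carrier_vec p"
    and X: "\<And>j i. j \<in> {1..q} \<Longrightarrow> i \<in> {1..N j} \<Longrightarrow> distributed \<Omega> (lborel_vec p) (X j i) (mvnormal_density p m S)"
    and ind: "prob_space.indep_vars \<Omega> (\<lambda>_. borel_vec p) (\<lambda>(j, i). X j i) (SIGMA j:{1..q}. {1..N j})"
  shows "(\<lambda>\<omega>. likelihood_ratio p q N (\<lambda>j i. X j i \<omega>)) \<in> borel_measurable \<Omega>"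
    and "(\<integral>\<omega>. exp (\<i> * of_real (s * ln (likelihood_ratio p q N (\<lambda>j i. X j i \<omega>)))) \<partial>\<Omega>) = lr_char p q N s"
proof -
  interpret prob_space \<Omega> by fact
  let ?C = "blocks q N"
  define Y where "Y c = (case c of (j, i) \<Rightarrow> X j i)" for c
  let ?I = "{1..p} \<times> ?C"
  interpret G: prob_space "gauss ?I" by (rule prob_space_gauss)
  have Cne: "?C \<noteq> {}"
  proof -
    have "(1, 1) \<in> ?C" using q N[of 1] by (auto simp: blocks_def)
    then show ?thesis by auto
  qed
  have ind': "indep_vars (\<lambda>_. borel_vec p) Y ?C" using ind by (simp add: blocks_def Y_def[abs_def])
  have rvY: "Y c \<in> measurable \<Omega> (borel_vec p)" if "c \<in> ?C" for c
    using ind' that by (auto simp: indep_vars_def)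
  obtain L where L: "L \<in> carrier_mat p p" "det L \<noteq> 0"
    and law: "\<And>(\<Omega> :: 'a measure) X. prob_space \<Omega> \<Longrightarrow> distributed \<Omega> (lborel_vec p) X (mvnormal_density p m S) \<Longrightarrow>
    distr \<Omega> (borel_vec p) X = distr (gauss {..<p}) (borel_vec p) (affine_vec p m L)"
    using mvnormal_law[OF S m, where 'a = 'a] by auto
  \<comment> \<open>Column \<open>c\<close> of the Gaussian array, mapped to an observation. The
    shift \<open>Suc b\<close> skips the place of the row of ones.\<close>
  define Z where "Z c \<omega> = affine_vec p m L (\<lambda>b. \<omega> (Suc b, c))" for c and \<omega> :: "nat \<times> nat \<times> nat \<Rightarrow> real"
  have lawY: "distr \<Omega> (borel_vec p) (Y c) = distr (gauss {..<p}) (borel_vec p) (affine_vec p m L)" if "c \<in> ?C" for c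
    using that by (intro law prob_space_axioms) (auto simp: Y_def blocks_def intro!: X)
  have rvZ: "Z c \<in> measurable (gauss ?I) (borel_vec p)" if "c \<in> ?C" for c
    unfolding Z_def[abs_def] using that by (intro measurable_affine_vec measurable_gauss_component) auto
  have lawZ: "distr (gauss ?I) (borel_vec p) (Z c) = distr (gauss {..<p}) (borel_vec p) (affine_vec p m L)" if c: "c \<in> ?C" for c
  proof -
    let ?t = "\<lambda>\<omega>. \<lambda>b\<in>{..<p}. \<omega> (Suc b, c)"
    have d: "distr (gauss ?I) (gauss {..<p}) ?t = gauss {..<p}"
      unfolding gauss_def using c by (intro distr_PiM_reindex) (auto simp: prob_space_std_normal inj_on_def)
    have mt: "?t \<in> measurable (gauss ?I) (gauss {..<p})"
      using c by (intro measurable_gauss_restrict measurable_gauss_component) auto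
    have ma: "affine_vec p m L \<in> measurable (gauss {..<p}) (borel_vec p)"
      by (intro measurable_affine_vec measurable_gauss_component) auto
    have "distr (gauss {..<p}) (borel_vec p) (affine_vec p m L) = distr (distr (gauss ?I) (gauss {..<p}) ?t) (borel_vec p) (affine_vec p m L)"
      by (simp only: d)
    also have "\<dots> = distr (gauss ?I) (borel_vec p) (affine_vec p m L \<circ> ?t)" by (rule distr_distr[OF ma mt])
    also have "affine_vec p m L \<circ> ?t = Z c"
      by (auto simp: Z_def affine_vec_def fun_eq_iff intro!: eq_vecI sum.cong)
    finally show ?thesis by simp
  qed
  have indZ: "G.indep_vars (\<lambda>_. borel_vec p) Z ?C"
  proof -
    have ne: "?I \<noteq> {}" using Cne p by auto
    let ?K = "\<lambda>c. {1..p} \<times> {c}"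
    have "G.indep_vars (\<lambda>c. \<Pi>\<^sub>M k\<in>?K c. borel) (\<lambda>c \<omega>. restrict (\<lambda>k. \<omega> k) (?K c)) ?C"
      by (rule G.indep_vars_restrict[OF indep_vars_gauss[OF ne]]) (auto simp: disjoint_family_on_def)
    then have "G.indep_vars (\<lambda>_. borel_vec p) (\<lambda>c \<omega>. Z c (restrict (\<lambda>k. \<omega> k) (?K c))) ?C"
      by (rule G.indep_vars_compose2)
        (auto simp: Z_def[abs_def] intro!: measurable_affine_vec measurable_component_singleton)
    moreover have "Z c (restrict (\<lambda>k. \<omega> k) (?K c)) = Z c \<omega>" for c \<omega>
      by (auto simp: Z_def affine_vec_def intro!: eq_vecI sum.cong)
    ultimately show ?thesis by simp
  qed
  \<comment> \<open>Independence and equal marginals determine the joint law, so the statistic has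
    the same law on both probability spaces.\<close>
  have joint: "distr \<Omega> (\<Pi>\<^sub>M c\<in>?C. borel_vec p) (\<lambda>\<omega>. \<lambda>c\<in>?C. Y c \<omega>) = distr (gauss ?I) (\<Pi>\<^sub>M c\<in>?C. borel_vec p) (\<lambda>\<omega>. \<lambda>c\<in>?C. Z c \<omega>)"
  proof -
    have "distr \<Omega> (\<Pi>\<^sub>M c\<in>?C. borel_vec p) (\<lambda>\<omega>. \<lambda>c\<in>?C. Y c \<omega>) = (\<Pi>\<^sub>M c\<in>?C. distr \<Omega> (borel_vec p) (Y c))"
      using indep_vars_iff_distr_eq_PiM'[OF Cne, where M' = "\<lambda>_. borel_vec p" and X = Y] rvY ind' by simp
    also have "\<dots> = (\<Pi>\<^sub>M c\<in>?C. distr (gauss ?I) (borel_vec p) (Z c))"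
      by (rule PiM_cong[OF refl]) (simp only: lawY lawZ)
    also have "\<dots> = distr (gauss ?I) (\<Pi>\<^sub>M c\<in>?C. borel_vec p) (\<lambda>\<omega>. \<lambda>c\<in>?C. Z c \<omega>)"
      using G.indep_vars_iff_distr_eq_PiM'[OF Cne, where M' = "\<lambda>_. borel_vec p" and X = Z] rvZ indZ by simp
    finally show ?thesis .
  qed
  have mY: "(\<lambda>\<omega>. \<lambda>c\<in>?C. Y c \<omega>) \<in> measurable \<Omega> (\<Pi>\<^sub>M c\<in>?C. borel_vec p)"
    by (rule measurable_restrict) (rule rvY)
  have mZ: "(\<lambda>\<omega>. \<lambda>c\<in>?C. Z c \<omega>) \<in> measurable (gauss ?I) (\<Pi>\<^sub>M c\<in>?C. borel_vec p)"
    by (rule measurable_restrict) (rule rvZ)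
  let ?R = "\<lambda>x. lr_stat p q N (\<lambda>a c. x c $ a)"
  have mR: "?R \<in> borel_measurable (\<Pi>\<^sub>M c\<in>?C. borel_vec p)"
  proof (rule measurable_lr_stat)
    fix a c assume "a < p" "c \<in> ?C"
    then show "(\<lambda>x. x c $ a) \<in> borel_measurable (\<Pi>\<^sub>M c\<in>?C. borel_vec p)"
      using measurable_compose[OF measurable_component_singleton[of c ?C "\<lambda>_. borel_vec p"] measurable_borel_vec_index[of a p]] by simp
  qed
  have RY: "likelihood_ratio p q N (\<lambda>j i. X j i \<omega>) = ?R (\<lambda>c\<in>?C. Y c \<omega>)" for \<omega>
  proof -
    have "likelihood_ratio p q N (\<lambda>j i. X j i \<omega>) = lr_stat p q N (\<lambda>a c. X (fst c) (snd c) \<omega> $ a)"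
      using N by (intro likelihood_ratio_eq_lr_stat q) fastforce
    also have "\<dots> = ?R (\<lambda>c\<in>?C. Y c \<omega>)" by (intro lr_stat_cong) (auto simp: Y_def)
    finally show ?thesis .
  qed
  show "(\<lambda>\<omega>. likelihood_ratio p q N (\<lambda>j i. X j i \<omega>)) \<in> borel_measurable \<Omega>"
    unfolding RY by (rule measurable_compose[OF mY mR])
  let ?e = "\<lambda>x. exp (\<i> * of_real (s * ln (?R x)))"
  have me: "?e \<in> borel_measurable (\<Pi>\<^sub>M c\<in>?C. borel_vec p)" using mR by measurable
  have "(\<integral>\<omega>. exp (\<i> * of_real (s * ln (likelihood_ratio p q N (\<lambda>j i. X j i \<omega>)))) \<partial>\<Omega>)
    = (\<integral>x. ?e x \<partial>distr \<Omega> (\<Pi>\<^sub>M c\<in>?C. borel_vec p) (\<lambda>\<omega>. \<lambda>c\<in>?C. Y c \<omega>))"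
    unfolding RY by (rule integral_distr[OF mY me, symmetric])
  also have "\<dots> = (\<integral>\<omega>. ?e (\<lambda>c\<in>?C. Z c \<omega>) \<partial>gauss ?I)"
    unfolding joint by (rule integral_distr[OF mZ me])
  also have "\<dots> = (\<integral>\<omega>. exp (\<i> * of_real (s * ln (lr_stat p q N (\<lambda>a c. m $ a + (\<Sum>b<p. L $$ (a, b) * \<omega> (Suc b, c)))))) \<partial>gauss ?I)"
  proof (rule Bochner_Integration.integral_cong[OF refl])
    fix \<omega>
    have "?R (\<lambda>c\<in>?C. Z c \<omega>) = lr_stat p q N (\<lambda>a c. m $ a + (\<Sum>b<p. L $$ (a, b) * \<omega> (Suc b, c)))"
      by (rule lr_stat_cong) (auto simp: Z_def affine_vec_def)
    then show "?e (\<lambda>c\<in>?C. Z c \<omega>) = exp (\<i> * of_real (s * ln (lr_stat p q N (\<lambda>a c. m $ a + (\<Sum>b<p. L $$ (a, b) * \<omega> (Suc b, c))))))"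
      by simp
  qed
  also have "\<dots> = lr_char p q N s" by (rule integral_exp_lr_stat[OF q N L])
  finally show "(\<integral>\<omega>. exp (\<i> * of_real (s * ln (likelihood_ratio p q N (\<lambda>j i. X j i \<omega>)))) \<partial>\<Omega>) = lr_char p q N s" .
qed

section \<open>Expansion of the Gamma function\<close>

text \<open>A telescoping majorant; it makes the sum of inverse cubes from \<open>a\<close> on at
  most \<open>2 / a^2\<close>.\<close>

lemma inverse_cube_telescope:
  fixes x :: real assumes "1 \<le> x"
  shows "1 / x ^ 3 \<le> 2 * (1 / x\<^sup>2 - 1 / (x + 1)\<^sup>2)"
proof -
  have e: "2 * (1 / x\<^sup>2 - 1 / (x + 1)\<^sup>2) = 2 * (2 * x + 1) / (x\<^sup>2 * (x + 1)\<^sup>2)"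
    using assms by (simp add: divide_simps) (simp add: power2_eq_square algebra_simps)
  have "(x + 1)\<^sup>2 \<le> (2 * x)\<^sup>2" using assms by (intro power_mono) auto
  also have "\<dots> \<le> 2 * x * (2 * x + 1)" using assms by (simp add: power2_eq_square algebra_simps)
  finally have "x\<^sup>2 * (x + 1)\<^sup>2 \<le> x\<^sup>2 * (2 * x * (2 * x + 1))" by (intro mult_left_mono) auto
  then show ?thesis unfolding e using assms
    by (simp add: divide_simps) (simp add: power2_eq_square power3_eq_cube algebra_simps)
qed

lemma
  fixes a :: real assumes a: "1 \<le> a"
  shows summable_inverse_cubes: "summable (\<lambda>k. 1 / (a + real k) ^ 3)"
    and suminf_inverse_cubes: "(\<Sum>k. 1 / (a + real k) ^ 3) \<le> 2 / a\<^sup>2"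
proof -
  let ?g = "\<lambda>k. - (2 / (a + real k)\<^sup>2)"
  have "?g \<longlonglongrightarrow> 0" by real_asymp
  then have s: "(\<lambda>k. ?g (Suc k) - ?g k) sums (0 - ?g 0)" by (rule telescope_sums)
  have le: "1 / (a + real k) ^ 3 \<le> ?g (Suc k) - ?g k" for k
    using inverse_cube_telescope[of "a + real k"] a by (simp add: algebra_simps)
  show 1: "summable (\<lambda>k. 1 / (a + real k) ^ 3)"
    using a le by (intro summable_comparison_test'[OF sums_summable[OF s], of 0]) (auto simp: abs_of_pos)
  have "(\<Sum>k. 1 / (a + real k) ^ 3) \<le> (\<Sum>k. ?g (Suc k) - ?g k)"
    by (intro suminf_le le 1 sums_summable[OF s])
  also have "\<dots> = 2 / a\<^sup>2" using sums_unique[OF s] by simp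
  finally show "(\<Sum>k. 1 / (a + real k) ^ 3) \<le> 2 / a\<^sup>2" .
qed

text \<open>The bound is uniform on the half-plane, so it controls the third derivative of
  \<open>ln_Gamma\<close> along the whole vertical segment used in the Taylor expansion.\<close>

lemma norm_Polygamma_2_le:
  fixes z :: complex assumes a: "1 \<le> a" and z: "a \<le> Re z"
  shows "norm (Polygamma 2 z) \<le> 4 / a\<^sup>2"
proof -
  have le: "norm (inverse ((z + of_nat k) ^ 3)) \<le> 1 / (a + real k) ^ 3" for k
  proof -
    have "a + real k \<le> Re (z + of_nat k)" using z by simp
    also have "\<dots> \<le> norm (z + of_nat k)" by (rule complex_Re_le_cmod)
    finally have "a + real k \<le> norm (z + of_nat k)" .
    then have "(a + real k) ^ 3 \<le> norm (z + of_nat k) ^ 3" using a by (intro power_mono) auto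
    then have "1 / norm (z + of_nat k) ^ 3 \<le> 1 / (a + real k) ^ 3"
      using a by (intro divide_left_mono mult_pos_pos zero_less_power) (auto intro: less_le_trans[OF _ \<open>a + real k \<le> norm (z + of_nat k)\<close>])
    then show ?thesis by (simp add: norm_inverse norm_power inverse_eq_divide norm_divide)
  qed
  have sn: "summable (\<lambda>k. norm (inverse ((z + of_nat k) ^ 3)))"
    by (intro summable_comparison_test'[OF summable_inverse_cubes[OF a], of 0]) (use le in auto)
  have "norm (\<Sum>k. inverse ((z + of_nat k) ^ 3)) \<le> (\<Sum>k. norm (inverse ((z + of_nat k) ^ 3)))"
    by (rule summable_norm[OF sn])
  also have "\<dots> \<le> (\<Sum>k. 1 / (a + real k) ^ 3)"
    by (rule suminf_le[OF le sn summable_inverse_cubes[OF a]])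
  also have "\<dots> \<le> 2 / a\<^sup>2" by (rule suminf_inverse_cubes[OF a])
  finally have "norm (\<Sum>k. inverse ((z + of_nat k) ^ 3)) \<le> 2 / a\<^sup>2" .
  moreover have "norm (Polygamma 2 z) = 2 * norm (\<Sum>k. inverse ((z + of_nat k) ^ 3))"
    by (simp add: Polygamma_def norm_mult fact_2 numeral_3_eq_3)
  ultimately show ?thesis by simp
qed

text \<open>\<open>1 / a\<close> is the telescoping sum of \<open>1 / x - 1 / (x + 1)\<close> over
  \<open>x = a + k\<close>. This differs from \<open>1 / x^2\<close> by
  \<open>1 / (x^2 * (x + 1))\<close>, at most an inverse cube.\<close>

lemma Polygamma_1_approx:
  fixes a :: real assumes a: "1 \<le> a"
  shows "\<bar>Polygamma 1 a - 1 / a\<bar> \<le> 2 / a\<^sup>2"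
proof -
  let ?g = "\<lambda>k. - (1 / (a + real k))"
  have "?g \<longlonglongrightarrow> 0" by real_asymp
  then have s: "(\<lambda>k. ?g (Suc k) - ?g k) sums (0 - ?g 0)" by (rule telescope_sums)
  have "summable (\<lambda>k. inverse ((a + of_nat k) ^ Suc 1))"
    using a by (intro Polygamma_converges') auto
  then have p: "(\<lambda>k. inverse ((a + real k)\<^sup>2)) sums Polygamma 1 a"
    by (simp add: Polygamma_def numeral_2_eq_2 summable_sums)
  have d: "(\<lambda>k. inverse ((a + real k)\<^sup>2) - (?g (Suc k) - ?g k)) sums (Polygamma 1 a - 1 / a)"
    using sums_diff[OF p s] by simp
  have le: "0 \<le> inverse ((a + real k)\<^sup>2) - (?g (Suc k) - ?g k) \<and> inverse ((a + real k)\<^sup>2) - (?g (Suc k) - ?g k) \<le> 1 / (a + real k) ^ 3" for k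
  proof -
    define x where "x = a + real k"
    have x: "1 \<le> x" using a by (simp add: x_def)
    have "inverse ((a + real k)\<^sup>2) - (?g (Suc k) - ?g k) = inverse (x\<^sup>2) - (1 / x - 1 / (x + 1))"
      by (simp add: x_def algebra_simps)
    also have "\<dots> = 1 / (x\<^sup>2 * (x + 1))"
      using x by (simp add: divide_simps) (simp add: power2_eq_square algebra_simps)
    finally have e: "inverse ((a + real k)\<^sup>2) - (?g (Suc k) - ?g k) = 1 / (x\<^sup>2 * (x + 1))" .
    have "1 / (x\<^sup>2 * (x + 1)) \<le> 1 / (x\<^sup>2 * x)" using x by (intro divide_left_mono mult_left_mono) auto
    also have "x\<^sup>2 * x = x ^ 3" by (simp add: power2_eq_square power3_eq_cube)
    finally show ?thesis unfolding e using x by (simp add: x_def)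
  qed
  have "0 \<le> Polygamma 1 a - 1 / a"
    using sums_le[OF _ sums_zero d] le by auto
  moreover have "Polygamma 1 a - 1 / a \<le> (\<Sum>k. 1 / (a + real k) ^ 3)"
    by (rule sums_le[OF _ d summable_sums[OF summable_inverse_cubes[OF a]]]) (use le in auto)
  ultimately show ?thesis using suminf_inverse_cubes[OF a] by simp
qed

text \<open>The derivative of the middle expression is \<open>x^2 / (1 + x)\<close>, which lies
  between \<open>0\<close> and \<open>x^2\<close>.\<close>

lemma ln_one_plus_cubic:
  fixes u :: real assumes "0 \<le> u"
  shows "0 \<le> ln (1 + u) - u + u\<^sup>2 / 2" "ln (1 + u) - u + u\<^sup>2 / 2 \<le> u ^ 3 / 3"
proof -
  let ?g = "\<lambda>u::real. ln (1 + u) - u + u\<^sup>2 / 2"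
  have d: "(?g has_real_derivative x\<^sup>2 / (1 + x)) (at x)" if "0 \<le> x" for x
    using that by (auto intro!: derivative_eq_intros simp: divide_simps) (simp add: power2_eq_square algebra_simps)
  have "?g 0 \<le> ?g u"
    by (rule DERIV_nonneg_imp_nondecreasing[OF assms]) (use d in \<open>fastforce intro!: exI[of _ "_ / _"]\<close>)
  then show "0 \<le> ln (1 + u) - u + u\<^sup>2 / 2" by simp
  let ?h = "\<lambda>u::real. u ^ 3 / 3 - ?g u"
  have "(?h has_real_derivative x\<^sup>2 - x\<^sup>2 / (1 + x)) (at x)" if "0 \<le> x" for x
  proof -
    have "((\<lambda>u. u ^ 3 / 3) has_real_derivative x\<^sup>2) (at x)"
      by (auto intro!: derivative_eq_intros)
    from DERIV_diff[OF this d[OF that]] show ?thesis .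
  qed
  moreover have "0 \<le> x\<^sup>2 - x\<^sup>2 / (1 + x)" if "0 \<le> x" for x :: real
    using that by (simp add: divide_simps) (simp add: algebra_simps)
  ultimately have "?h 0 \<le> ?h u"
    by (intro DERIV_nonneg_imp_nondecreasing[OF assms]) blast
  then show "ln (1 + u) - u + u\<^sup>2 / 2 \<le> u ^ 3 / 3" by simp
qed

text \<open>\<open>e x\<close> is the error of the trapezoidal rule for \<open>1 / t\<close> on the
  interval from \<open>x\<close> to \<open>x + 1\<close>, of order \<open>1 / x^3\<close>. Its
  partial sums telescope into those of the limit formula for \<open>Digamma\<close>.\<close>

lemma Digamma_approx:
  fixes a :: real assumes a: "1 \<le> a"
  shows "\<bar>Digamma a - (ln a - 1 / (2 * a))\<bar> \<le> 1 / a\<^sup>2"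
proof -
  define e where "e x = ln ((x + 1) / x) - 1 / (2 * x) - 1 / (2 * (x + 1))" for x :: real
  have e: "\<bar>e x\<bar> \<le> 1 / 2 * (1 / x ^ 3)" if x: "1 \<le> x" for x
  proof -
    define u where "u = 1 / x"
    have u: "0 < u" "u \<le> 1" using x by (auto simp: u_def)
    have x': "x = 1 / u" using x by (simp add: u_def)
    have "(x + 1) / x = 1 + u" using x by (simp add: u_def field_simps)
    moreover have "1 / (2 * x) + 1 / (2 * (x + 1)) = u - u\<^sup>2 / 2 + u ^ 3 / (2 * (1 + u))"
      unfolding x' using u by (simp add: divide_simps) (simp add: power2_eq_square power3_eq_cube algebra_simps)
    moreover have "e x = ln ((x + 1) / x) - (1 / (2 * x) + 1 / (2 * (x + 1)))" by (simp add: e_def)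
    ultimately have ex: "e x = (ln (1 + u) - u + u\<^sup>2 / 2) - u ^ 3 / (2 * (1 + u))"
      by (simp only:)
    have "0 \<le> u ^ 3 / (2 * (1 + u))" using u by simp
    moreover have "u ^ 3 / (2 * (1 + u)) \<le> u ^ 3 / 2"
      by (rule divide_left_mono) (use u in auto)
    moreover have "0 \<le> u ^ 3" using u by simp
    ultimately have "\<bar>e x\<bar> \<le> u ^ 3 / 2"
      unfolding ex abs_le_iff using ln_one_plus_cubic[OF less_imp_le[OF u(1)]] by linarith
    then show ?thesis by (simp add: u_def power_divide)
  qed
  have part: "(\<Sum>k<m. e (a + real k)) = ln (a + real m) - 1 / (2 * (a + real m)) - ln a + 1 / (2 * a) - (\<Sum>k<m. inverse (a + real k))" for m
  proof (induction m)
    case (Suc m)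
    have "e (a + real m) = ln (a + real (Suc m)) - ln (a + real m) - 1 / (2 * (a + real m)) - 1 / (2 * (a + real (Suc m)))"
      unfolding e_def using a by (simp add: ln_divide_pos add.assoc add.commute[of 1])
    moreover have "1 / (2 * (a + real m)) = inverse (a + real m) / 2" by (simp add: divide_simps)
    ultimately show ?case using Suc.IH by simp
  qed simp
  have "(\<lambda>m. \<Sum>k<m. e (a + real k)) \<longlonglongrightarrow> Digamma a - (ln a - 1 / (2 * a))"
  proof -
    have 1: "(\<lambda>m. ln (real m) - (\<Sum>k<m. inverse (a + real k))) \<longlonglongrightarrow> Digamma a"
      using Digamma_LIMSEQ[of a] a by simp
    have 2: "(\<lambda>m. ln (a + real m) - ln (real m) - 1 / (2 * (a + real m)) - ln a + 1 / (2 * a)) \<longlonglongrightarrow> - ln a + 1 / (2 * a)"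
    proof -
      have "(\<lambda>m. ln (a + real m) - ln (real m) - 1 / (2 * (a + real m))) \<longlonglongrightarrow> 0" by real_asymp
      from tendsto_add[OF this tendsto_const[of "- ln a + 1 / (2 * a)"]] show ?thesis by (simp add: algebra_simps)
    qed
    show ?thesis using tendsto_add[OF 1 2] by (simp add: part algebra_simps)
  qed
  then have s: "(\<lambda>k. e (a + real k)) sums (Digamma a - (ln a - 1 / (2 * a)))" by (simp add: sums_def)
  have t: "(\<lambda>k. 1 / 2 * (1 / (a + real k) ^ 3)) sums (1 / 2 * (\<Sum>k. 1 / (a + real k) ^ 3))"
    by (intro sums_mult summable_sums summable_inverse_cubes[OF a])
  have "\<bar>\<Sum>k. e (a + real k)\<bar> \<le> (\<Sum>k. 1 / 2 * (1 / (a + real k) ^ 3))"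
    using norm_suminf_le[of "\<lambda>k. e (a + real k)" "\<lambda>k. 1 / 2 * (1 / (a + real k) ^ 3)"] e a sums_summable[OF t] by auto
  then show ?thesis
    using sums_unique[OF s] sums_unique[OF t] suminf_inverse_cubes[OF a] by simp
qed

text \<open>Taylor expansion of degree \<open>2\<close> at \<open>a\<close> in the imaginary
  direction. The half-plane \<open>?S\<close> is convex and avoids the branch cut; the remainder is
  \<open>4 / a^2 * \<bar>w\<bar> ^ 3 / 2\<close>.\<close>

lemma ln_Gamma_approx:
  fixes a w :: real assumes a: "1 \<le> a"
  shows "norm (ln_Gamma (Complex a w) - (ln_Gamma (of_real a) + \<i> * of_real (w * Digamma a) - of_real (w\<^sup>2 / 2 * Polygamma 1 a))) \<le> 2 * \<bar>w\<bar> ^ 3 / a\<^sup>2"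
proof -
  let ?S = "{z. a \<le> Re z}"
  define f :: "nat \<Rightarrow> complex \<Rightarrow> complex" where "f i = (case i of 0 \<Rightarrow> ln_Gamma | Suc i \<Rightarrow> Polygamma i)" for i
  have zn: "z \<notin> \<real>\<^sub>\<le>\<^sub>0" "z \<notin> \<int>\<^sub>\<le>\<^sub>0" if "z \<in> ?S" for z :: complex
    using that a by (auto simp: complex_nonpos_Reals_iff elim!: nonpos_Ints_cases)
  have "cmod (f 0 (Complex a w) - (\<Sum>i\<le>2. f i (of_real a) * (Complex a w - of_real a) ^ i / fact i))
    \<le> 4 / a\<^sup>2 * cmod (Complex a w - of_real a) ^ Suc 2 / fact 2"
  proof (rule complex_Taylor[where S = ?S])
    show "convex ?S" by (rule convex_halfspace_Re_ge)
    fix i :: nat and z assume z: "z \<in> ?S" "i \<le> 2"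
    show "(f i has_field_derivative f (Suc i) z) (at z within ?S)"
      using zn[OF z(1)] by (cases i) (auto simp: f_def intro!: has_field_derivative_at_within[OF has_field_derivative_ln_Gamma_complex] has_field_derivative_at_within[OF has_field_derivative_Polygamma])
  next
    fix z assume "z \<in> ?S"
    then show "cmod (f (Suc 2) z) \<le> 4 / a\<^sup>2" using norm_Polygamma_2_le[OF a, of z] by (simp add: f_def)
  qed simp_all
  moreover have "Complex a w - of_real a = \<i> * of_real w" by (simp add: complex_eq_iff)
  moreover have "(\<Sum>i\<le>2. f i (of_real a) * (\<i> * of_real w) ^ i / fact i)
    = ln_Gamma (of_real a) + \<i> * of_real (w * Digamma a) - of_real (w\<^sup>2 / 2 * Polygamma 1 a)"
    using a by (simp add: f_def numeral_2_eq_2 Polygamma_of_real algebra_simps power2_eq_square)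
  ultimately show ?thesis by (simp add: f_def norm_mult fact_2)
qed

text \<open>At \<open>a = m / 2\<close> the \<open>ln 2\<close> from the scale of the chi-square law
  cancels the one in \<open>ln (m / 2)\<close>. \<open>Digamma\<close> yields the phase and
  \<open>Polygamma 1\<close> the damping. \<open>2 \<le> m\<close> makes
  \<open>1 \<le> a\<close>.\<close>

lemma chi_char_approx:
  assumes m: "2 \<le> m"
  shows "\<exists>R. chi_char m w = exp (Complex (- (w\<^sup>2 / m)) (w * (ln m - 1 / m)) + R)
    \<and> norm R \<le> (4 * \<bar>w\<bar> + 4 * w\<^sup>2 + 8 * \<bar>w\<bar> ^ 3) / (real m)\<^sup>2"
proof -
  define a where "a = real m / 2"
  have a: "1 \<le> a" using m by (simp add: a_def)
  define R1 where "R1 = ln_Gamma (Complex a w) - (ln_Gamma (of_real a) + \<i> * of_real (w * Digamma a) - of_real (w\<^sup>2 / 2 * Polygamma 1 a))"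
  define R2 where "R2 = Digamma a - (ln a - 1 / (2 * a))"
  define R3 where "R3 = Polygamma 1 a - 1 / a"
  let ?R = "R1 + \<i> * of_real (w * R2) - of_real (w\<^sup>2 / 2 * R3)"
  have nz: "z \<notin> \<int>\<^sub>\<le>\<^sub>0" if "0 < Re z" for z :: complex
    using that by (auto elim!: nonpos_Ints_cases)
  have "chi_char m w = exp (\<i> * of_real (w * ln 2)) * exp (ln_Gamma (Complex a w)) / exp (ln_Gamma (of_real a))"
    using a nz[of "Complex a w"] nz[of "of_real a"] by (simp add: chi_char_def a_def Gamma_complex_altdef)
  also have "\<dots> = exp (\<i> * of_real (w * ln 2) + (ln_Gamma (Complex a w) - ln_Gamma (of_real a)))"
    by (simp add: exp_add exp_diff)
  also have "\<i> * of_real (w * ln 2) + (ln_Gamma (Complex a w) - ln_Gamma (of_real a))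
    = \<i> * of_real (w * (ln 2 + Digamma a)) - of_real (w\<^sup>2 / 2 * Polygamma 1 a) + R1"
    by (simp add: R1_def algebra_simps)
  also have "ln 2 + Digamma a = ln m - 1 / m + R2"
    using m by (simp add: R2_def a_def ln_div)
  also have "Polygamma 1 a = 2 / m + R3" by (simp add: R3_def a_def)
  also have "\<i> * of_real (w * (ln m - 1 / m + R2)) - of_real (w\<^sup>2 / 2 * (2 / m + R3)) + R1
    = Complex (- (w\<^sup>2 / m)) (w * (ln m - 1 / m)) + ?R"
    by (simp add: complex_eq_iff algebra_simps)
  finally have 1: "chi_char m w = exp (Complex (- (w\<^sup>2 / m)) (w * (ln m - 1 / m)) + ?R)" .
  have "norm R1 \<le> 8 * \<bar>w\<bar> ^ 3 / (real m)\<^sup>2"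
    using ln_Gamma_approx[OF a, of w] by (simp add: R1_def a_def power_divide)
  moreover have "norm (\<i> * of_real (w * R2) :: complex) \<le> 4 * \<bar>w\<bar> / (real m)\<^sup>2"
  proof -
    have "\<bar>R2\<bar> \<le> 4 / (real m)\<^sup>2" using Digamma_approx[OF a] by (simp add: R2_def a_def power_divide)
    then have "\<bar>w\<bar> * \<bar>R2\<bar> \<le> \<bar>w\<bar> * (4 / (real m)\<^sup>2)" by (intro mult_left_mono) auto
    then show ?thesis by (simp add: norm_mult abs_mult mult.commute)
  qed
  moreover have "norm (of_real (w\<^sup>2 / 2 * R3) :: complex) \<le> 4 * w\<^sup>2 / (real m)\<^sup>2"
  proof -
    have "\<bar>R3\<bar> \<le> 8 / (real m)\<^sup>2" using Polygamma_1_approx[OF a] by (simp add: R3_def a_def power_divide)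
    then have "w\<^sup>2 / 2 * \<bar>R3\<bar> \<le> w\<^sup>2 / 2 * (8 / (real m)\<^sup>2)" by (intro mult_left_mono) auto
    then show ?thesis by (simp add: norm_of_real abs_mult del: of_real_mult)
  qed
  ultimately have "norm ?R \<le> 8 * \<bar>w\<bar> ^ 3 / (real m)\<^sup>2 + 4 * \<bar>w\<bar> / (real m)\<^sup>2 + 4 * w\<^sup>2 / (real m)\<^sup>2"
    using norm_triangle_ineq[of R1 "\<i> * of_real (w * R2)"] norm_triangle_ineq4[of "R1 + \<i> * of_real (w * R2)" "of_real (w\<^sup>2 / 2 * R3)"]
    by linarith
  also have "\<dots> = (4 * \<bar>w\<bar> + 4 * w\<^sup>2 + 8 * \<bar>w\<bar> ^ 3) / (real m)\<^sup>2" by (simp add: add_divide_distrib)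
  finally show ?thesis using 1 by blast
qed

section \<open>Asymptotics\<close>

definition log_row_sum :: "nat \<Rightarrow> real \<Rightarrow> real" where
  "log_row_sum p x = (\<Sum>i=1..p. ln (x - real i) - 1 / (x - real i))"

definition inverse_row_sum :: "nat \<Rightarrow> real \<Rightarrow> real" where
  "inverse_row_sum p x = (\<Sum>i=1..p. 1 / (x - real i))"

definition lr_mean :: "nat \<Rightarrow> nat \<Rightarrow> (nat \<Rightarrow> nat) \<Rightarrow> real" where
  "lr_mean p q N = (let n = real (\<Sum>j=1..q. N j) in
     p * (n / 2 * ln n - (\<Sum>j=1..q. N j / 2 * ln (N j)))
     + (\<Sum>j=1..q. N j / 2 * log_row_sum p (N j)) - n / 2 * log_row_sum p n)"

text \<open>The exponent of \<open>lr_char\<close> contains \<open>- s^2 * lr_var\<close>, so this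
  is half a variance; accordingly it is compared with half of \<open>sigma_tilde_sq\<close>.\<close>

definition lr_var :: "nat \<Rightarrow> nat \<Rightarrow> (nat \<Rightarrow> nat) \<Rightarrow> real" where
  "lr_var p q N = (let n = real (\<Sum>j=1..q. N j) in
     (\<Sum>j=1..q. (N j / 2)\<^sup>2 * inverse_row_sum p (N j)) - (n / 2)\<^sup>2 * inverse_row_sum p n)"

text \<open>Every Gamma quotient is expanded by \<open>chi_char_approx\<close>. With
  \<open>w = s * N / 2\<close> and at least \<open>\<epsilon> * N\<close> degrees of freedom its
  remainder is at most \<open>?B N\<close>; \<open>p + 2 \<le> N j\<close> keeps the degrees of
  freedom at least \<open>2\<close>.\<close>

lemma lr_char_expansion:
  fixes n :: nat and s \<epsilon> :: real
  assumes q: "0 < q" and \<epsilon>: "0 < \<epsilon>"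
    and N: "\<And>j. j \<in> {1..q} \<Longrightarrow> p + 2 \<le> N j \<and> \<epsilon> * N j \<le> real (N j) - p"
    and n: "n = (\<Sum>j=1..q. N j)"
  shows "\<exists>R. lr_char p q N s = exp (Complex (- (s\<^sup>2 * lr_var p q N)) (s * lr_mean p q N) + R)
    \<and> norm R \<le> 2 / \<epsilon>\<^sup>2 * (2 * \<bar>s\<bar> * q + real p * real q * s\<^sup>2 + real p * real n * \<bar>s\<bar> ^ 3)"
proof -
  let ?J = "{1..q}" and ?I = "{1..p}"
  define e where "e m w = Complex (- (w\<^sup>2 / m)) (w * (ln m - 1 / m))" for m w :: real
  let ?w = "\<lambda>j. s * (N j / 2)"
  let ?B = "\<lambda>x::real. (2 * \<bar>s\<bar> / x + s\<^sup>2 + \<bar>s\<bar> ^ 3 * x) / \<epsilon>\<^sup>2"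
  have sw: "(\<Sum>j\<in>?J. ?w j) = s * (n / 2)" by (simp add: n sum_distrib_left sum_divide_distrib)
  have approx: "\<exists>R. chi_char (x - i) (s * (real x / 2)) = exp (e (real x - real i) (s * (real x / 2)) + R) \<and> norm R \<le> ?B x"
    if x: "p + 2 \<le> x" "\<epsilon> * x \<le> real x - p" and i: "i \<in> ?I" for x i
  proof -
    have m: "2 \<le> x - i" and r: "real (x - i) = real x - real i" using x i by auto
    obtain R where R: "chi_char (x - i) (s * (real x / 2)) = exp (e (x - i) (s * (real x / 2)) + R)"
      "norm R \<le> (4 * \<bar>s * (real x / 2)\<bar> + 4 * (s * (real x / 2))\<^sup>2 + 8 * \<bar>s * (real x / 2)\<bar> ^ 3) / (real (x - i))\<^sup>2"
      using chi_char_approx[OF m, of "s * (real x / 2)"] unfolding e_def by blast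
    have x0: "0 < real x" using x by simp
    have "\<epsilon> * x \<le> real (x - i)" using x i r by auto
    then have sq: "(\<epsilon> * x)\<^sup>2 \<le> (real (x - i))\<^sup>2" using \<epsilon> x0 by (intro power_mono) auto
    have "norm R \<le> (4 * \<bar>s * (real x / 2)\<bar> + 4 * (s * (real x / 2))\<^sup>2 + 8 * \<bar>s * (real x / 2)\<bar> ^ 3) / (\<epsilon> * x)\<^sup>2"
      using R(2) by (rule order_trans) (rule divide_left_mono[OF sq], use \<epsilon> x0 m in auto)
    also have "\<dots> = ?B x"
      using x0 \<epsilon> by (simp add: abs_mult power_mult_distrib power_divide divide_simps)
        (simp add: power2_eq_square power3_eq_cube algebra_simps)
    finally show ?thesis using R(1) r by auto
  qed
  have "\<forall>j\<in>?J. \<forall>i\<in>?I. \<exists>R. chi_char (N j - i) (?w j) = exp (e (real (N j) - real i) (?w j) + R) \<and> norm R \<le> ?B (N j)"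
    using approx N by blast
  then obtain R where R: "\<And>i j. j \<in> ?J \<Longrightarrow> i \<in> ?I \<Longrightarrow> chi_char (N j - i) (?w j) = exp (e (real (N j) - real i) (?w j) + R j i)"
    "\<And>i j. j \<in> ?J \<Longrightarrow> i \<in> ?I \<Longrightarrow> norm (R j i) \<le> ?B (N j)"
    by metis
  have q1: "1 \<in> ?J" using q by simp
  have N1n: "N 1 \<le> n" unfolding n using q1 by (intro member_le_sum) auto
  have np: "p + 2 \<le> n" using N[OF q1] N1n by simp
  \<comment> \<open>The total inherits the ratio condition: summing it over the groups gives
    \<open>n - q * p\<close>, at most \<open>n - p\<close>.\<close>
  have "\<epsilon> * n \<le> (\<Sum>j\<in>?J. real (N j) - p)"
    unfolding n of_nat_sum sum_distrib_left using N by (intro sum_mono) auto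
  also have "\<dots> = n - real q * p" by (simp add: n sum_subtractf)
  also have "\<dots> \<le> real n - p" using q mult_right_mono[of 1 "real q" "real p"] by simp
  finally have n\<epsilon>: "\<epsilon> * n \<le> real n - p" .
  have "\<forall>i\<in>?I. \<exists>R. chi_char (n - i) (s * (n / 2)) = exp (e (real n - real i) (s * (n / 2)) + R) \<and> norm R \<le> ?B n"
    using approx[OF np n\<epsilon>] by blast
  then obtain T where T: "\<And>i. i \<in> ?I \<Longrightarrow> chi_char (n - i) (s * (n / 2)) = exp (e (real n - real i) (s * (n / 2)) + T i)"
    "\<And>i. i \<in> ?I \<Longrightarrow> norm (T i) \<le> ?B n"
    by metis
  define E where "E i = (\<Sum>j\<in>?J. e (real (N j) - real i) (?w j)) - e (real n - real i) (s * (n / 2))" for i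
  define Q where "Q = (\<Sum>i\<in>?I. (\<Sum>j\<in>?J. R j i) - T i)"
  let ?c = "p * (n / 2 * ln n - (\<Sum>j=1..q. N j / 2 * ln (N j)))"
  have rf: "row_factor ?J N n ?w i = exp (E i + ((\<Sum>j\<in>?J. R j i) - T i))" if i: "i \<in> ?I" for i
  proof -
    have "row_factor ?J N n ?w i = (\<Prod>j\<in>?J. exp (e (real (N j) - real i) (?w j) + R j i)) / exp (e (real n - real i) (s * (n / 2)) + T i)"
      unfolding row_factor_def sw T(1)[OF i] using R(1)[OF _ i] by simp
    also have "\<dots> = exp ((\<Sum>j\<in>?J. e (real (N j) - real i) (?w j) + R j i) - (e (real n - real i) (s * (n / 2)) + T i))"
      by (simp add: exp_sum exp_diff)
    finally show ?thesis by (simp add: E_def sum.distrib algebra_simps)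
  qed
  have "lr_char p q N s = exp (\<i> * of_real (s * ?c)) * (\<Prod>i\<in>?I. exp (E i + ((\<Sum>j\<in>?J. R j i) - T i)))"
    unfolding lr_char_def n[symmetric] using rf by simp
  also have "\<dots> = exp ((\<i> * of_real (s * ?c) + (\<Sum>i\<in>?I. E i)) + Q)"
    by (simp add: exp_sum[symmetric] exp_add[symmetric] Q_def sum.distrib add.assoc)
  also have "\<i> * of_real (s * ?c) + (\<Sum>i\<in>?I. E i) = Complex (- (s\<^sup>2 * lr_var p q N)) (s * lr_mean p q N)"
  proof -
    have "Re (\<Sum>i\<in>?I. E i) = (\<Sum>i\<in>?I. (\<Sum>j\<in>?J. - (s\<^sup>2 * (N j / 2)\<^sup>2 * (1 / (real (N j) - i)))) + s\<^sup>2 * (n / 2)\<^sup>2 * (1 / (real n - i)))"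
      by (simp add: E_def e_def power_mult_distrib power_divide)
    also have "\<dots> = - (s\<^sup>2 * ((\<Sum>j\<in>?J. (N j / 2)\<^sup>2 * inverse_row_sum p (N j)) - (n / 2)\<^sup>2 * inverse_row_sum p n))"
      unfolding sum.distrib inverse_row_sum_def sum_distrib_left right_diff_distrib minus_diff_eq sum_negf
      by (subst sum.swap) (simp add: mult.assoc)
    finally have re: "Re (\<Sum>i\<in>?I. E i) = - (s\<^sup>2 * lr_var p q N)" by (simp add: lr_var_def n Let_def)
    have "Im (\<Sum>i\<in>?I. E i) = (\<Sum>i\<in>?I. (\<Sum>j\<in>?J. s * (N j / 2) * (ln (real (N j) - i) - 1 / (real (N j) - i))) - s * (n / 2) * (ln (real n - i) - 1 / (real n - i)))"
      by (simp add: E_def e_def)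
    also have "\<dots> = (\<Sum>j\<in>?J. \<Sum>i\<in>?I. s * (N j / 2) * (ln (real (N j) - i) - 1 / (real (N j) - i))) - (\<Sum>i\<in>?I. s * (n / 2) * (ln (real n - i) - 1 / (real n - i)))"
      by (simp only: sum_subtractf) (subst sum.swap, rule refl)
    also have "\<dots> = s * ((\<Sum>j\<in>?J. N j / 2 * log_row_sum p (N j)) - n / 2 * log_row_sum p n)"
      unfolding right_diff_distrib[of s "\<Sum>j\<in>?J. N j / 2 * log_row_sum p (N j)"]
      by (simp only: log_row_sum_def sum_distrib_left[symmetric] mult.assoc)
    finally have im: "Im (\<Sum>i\<in>?I. E i) = s * ((\<Sum>j\<in>?J. N j / 2 * log_row_sum p (N j)) - n / 2 * log_row_sum p n)" .
    show ?thesis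
    proof (rule complex_eqI)
      show "Re (\<i> * of_real (s * ?c) + (\<Sum>i\<in>?I. E i)) = Re (Complex (- (s\<^sup>2 * lr_var p q N)) (s * lr_mean p q N))"
        using re by simp
      have "Im (\<i> * of_real (s * ?c) + (\<Sum>i\<in>?I. E i)) = s * ?c + s * ((\<Sum>j\<in>?J. N j / 2 * log_row_sum p (N j)) - n / 2 * log_row_sum p n)"
        unfolding plus_complex.sel im by simp
      also have "\<dots> = s * lr_mean p q N" unfolding lr_mean_def Let_def n[symmetric] by (simp add: algebra_simps)
      finally show "Im (\<i> * of_real (s * ?c) + (\<Sum>i\<in>?I. E i)) = Im (Complex (- (s\<^sup>2 * lr_var p q N)) (s * lr_mean p q N))"
        by simp
    qed
  qed
  finally have 1: "lr_char p q N s = exp (Complex (- (s\<^sup>2 * lr_var p q N)) (s * lr_mean p q N) + Q)" .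
  have "norm Q \<le> (\<Sum>i\<in>?I. (\<Sum>j\<in>?J. ?B (N j)) + ?B n)"
    unfolding Q_def
  proof (rule sum_norm_le)
    fix i assume i: "i \<in> ?I"
    have "norm ((\<Sum>j\<in>?J. R j i) - T i) \<le> norm (\<Sum>j\<in>?J. R j i) + norm (T i)" by (rule norm_triangle_ineq4)
    also have "\<dots> \<le> (\<Sum>j\<in>?J. ?B (N j)) + ?B n"
      using R(2)[OF _ i] T(2)[OF i] by (intro add_mono sum_norm_le) auto
    finally show "norm ((\<Sum>j\<in>?J. R j i) - T i) \<le> (\<Sum>j\<in>?J. ?B (N j)) + ?B n" .
  qed
  also have "\<dots> = (\<Sum>j\<in>?J. p * ?B (N j)) + p * ?B n" by (simp add: distrib_left sum_distrib_left)
  also have "\<dots> \<le> (\<Sum>j\<in>?J. (2 * \<bar>s\<bar> + p * s\<^sup>2 + p * \<bar>s\<bar> ^ 3 * N j) / \<epsilon>\<^sup>2) + (2 * \<bar>s\<bar> * q + real p * real q * s\<^sup>2 + real p * real n * \<bar>s\<bar> ^ 3) / \<epsilon>\<^sup>2"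
  proof (rule add_mono[OF sum_mono])
    \<comment> \<open>Because \<open>p \<le> x\<close>, the terms with \<open>1 / x\<close> from all
      \<open>p\<close> rows together count only once per group.\<close>
    have b: "p * ?B x \<le> (2 * \<bar>s\<bar> + p * s\<^sup>2 + p * \<bar>s\<bar> ^ 3 * x) / \<epsilon>\<^sup>2" if "p \<le> x" "0 < x" for x :: real
    proof -
      have "p * (2 * \<bar>s\<bar> / x) \<le> 2 * \<bar>s\<bar>"
        using that mult_right_mono[of "real p" x "2 * \<bar>s\<bar>"] by (simp add: divide_simps mult_ac)
      then have "p * (2 * \<bar>s\<bar> / x + s\<^sup>2 + \<bar>s\<bar> ^ 3 * x) \<le> 2 * \<bar>s\<bar> + p * s\<^sup>2 + p * \<bar>s\<bar> ^ 3 * x"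
        by (simp add: algebra_simps)
      from divide_right_mono[OF this, of "\<epsilon>\<^sup>2"] show ?thesis by simp
    qed
    show "p * ?B (N j) \<le> (2 * \<bar>s\<bar> + p * s\<^sup>2 + p * \<bar>s\<bar> ^ 3 * N j) / \<epsilon>\<^sup>2" if "j \<in> ?J" for j
      using N[OF that] by (intro b) auto
    have "p * ?B n \<le> (2 * \<bar>s\<bar> + p * s\<^sup>2 + p * \<bar>s\<bar> ^ 3 * n) / \<epsilon>\<^sup>2" using np by (intro b) auto
    also have "\<dots> \<le> (2 * \<bar>s\<bar> * q + real p * real q * s\<^sup>2 + real p * real n * \<bar>s\<bar> ^ 3) / \<epsilon>\<^sup>2"
    proof (rule divide_right_mono)
      have q': "1 \<le> real q" using q by simp
      have "2 * \<bar>s\<bar> \<le> 2 * \<bar>s\<bar> * q" "p * s\<^sup>2 \<le> p * s\<^sup>2 * q"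
        using mult_left_mono[OF q', of "2 * \<bar>s\<bar>"] mult_left_mono[OF q', of "p * s\<^sup>2"] by auto
      then show "2 * \<bar>s\<bar> + p * s\<^sup>2 + p * \<bar>s\<bar> ^ 3 * n \<le> 2 * \<bar>s\<bar> * q + real p * real q * s\<^sup>2 + real p * real n * \<bar>s\<bar> ^ 3"
        by (simp add: mult_ac)
    qed simp
    finally show "p * ?B n \<le> (2 * \<bar>s\<bar> * q + real p * real q * s\<^sup>2 + real p * real n * \<bar>s\<bar> ^ 3) / \<epsilon>\<^sup>2" .
  qed
  also have "(\<Sum>j\<in>?J. (2 * \<bar>s\<bar> + p * s\<^sup>2 + p * \<bar>s\<bar> ^ 3 * N j) / \<epsilon>\<^sup>2) = (2 * \<bar>s\<bar> * q + real p * real q * s\<^sup>2 + real p * real n * \<bar>s\<bar> ^ 3) / \<epsilon>\<^sup>2"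
    unfolding sum_divide_distrib[symmetric] by (simp add: sum.distrib n sum_distrib_left algebra_simps)
  finally have "norm Q \<le> (2 * \<bar>s\<bar> * q + real p * real q * s\<^sup>2 + real p * real n * \<bar>s\<bar> ^ 3) / \<epsilon>\<^sup>2
      + (2 * \<bar>s\<bar> * q + real p * real q * s\<^sup>2 + real p * real n * \<bar>s\<bar> ^ 3) / \<epsilon>\<^sup>2" .
  moreover have "x / y + x / y = 2 / y * x" for x y :: real by simp
  ultimately have "norm Q \<le> 2 / \<epsilon>\<^sup>2 * (2 * \<bar>s\<bar> * q + real p * real q * s\<^sup>2 + real p * real n * \<bar>s\<bar> ^ 3)"
    by (simp only:)
  with 1 show ?thesis by (intro exI[of _ Q] conjI)
qed

section \<open>Sums over the rows and their closed forms\<close>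

lemma ln_ratio_step_bounds:
  fixes x :: real assumes "1 < x"
  shows "\<bar>1 / x - ln (x / (x - 1))\<bar> \<le> 1 / (x - 1)\<^sup>2"
proof -
  have "ln (x / (x - 1)) \<le> x / (x - 1) - 1" using assms by (intro ln_le_minus_one) auto
  also have "\<dots> = 1 / (x - 1)" using assms by (simp add: field_simps)
  finally have u: "ln (x / (x - 1)) \<le> 1 / (x - 1)" .
  have "ln ((x - 1) / x) \<le> (x - 1) / x - 1" using assms by (intro ln_le_minus_one) auto
  also have "\<dots> = - (1 / x)" using assms by (simp add: field_simps)
  finally have l: "1 / x \<le> ln (x / (x - 1))" using assms by (simp add: ln_divide_pos)
  have "1 / (x - 1) - 1 / x = 1 / ((x - 1) * x)" using assms by (simp add: field_simps)
  also have "\<dots> \<le> 1 / (x - 1)\<^sup>2" unfolding power2_eq_square using assms by (intro divide_left_mono mult_left_mono) auto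
  finally show ?thesis using u l by (simp add: abs_le_iff)
qed

text \<open>The logarithm telescopes into the integrals of \<open>1 / t\<close> from
  \<open>x - i - 1\<close> to \<open>x - i\<close>, each close to \<open>1 / (x - i)\<close>. This
  is the origin of the logarithms in \<open>sigma_tilde_sq\<close>.\<close>

lemma inverse_row_sum_approx:
  fixes x :: real assumes x: "p + 1 < x"
  shows "\<bar>inverse_row_sum p x - ln ((x - 1) / (x - p - 1))\<bar> \<le> p / (x - p - 1)\<^sup>2"
proof -
  have tel: "ln ((x - 1) / (x - p - 1)) = (\<Sum>i=1..p. ln ((x - real i) / (x - real i - 1)))"
    using x
  proof (induction p)
    case (Suc p)
    then have "ln ((x - 1) / (x - Suc p - 1)) = ln ((x - 1) / (x - p - 1)) + ln ((x - Suc p) / (x - Suc p - 1))"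
      by (simp add: ln_divide_pos algebra_simps)
    then show ?case using Suc by simp
  qed simp
  have "\<bar>inverse_row_sum p x - ln ((x - 1) / (x - p - 1))\<bar> = \<bar>\<Sum>i=1..p. 1 / (x - real i) - ln ((x - real i) / (x - real i - 1))\<bar>"
    by (simp add: inverse_row_sum_def tel sum_subtractf)
  also have "\<dots> \<le> (\<Sum>i=1..p. 1 / (x - p - 1)\<^sup>2)"
  proof (rule order_trans[OF sum_abs sum_mono])
    fix i :: nat assume i: "i \<in> {1..p}"
    have "\<bar>1 / (x - real i) - ln ((x - real i) / (x - real i - 1))\<bar> \<le> 1 / (x - real i - 1)\<^sup>2"
      using i x by (intro ln_ratio_step_bounds) auto
    also have "\<dots> \<le> 1 / (x - p - 1)\<^sup>2"
      using i x by (intro divide_left_mono power_mono mult_pos_pos) auto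
    finally show "\<bar>1 / (x - real i) - ln ((x - real i) / (x - real i - 1))\<bar> \<le> 1 / (x - p - 1)\<^sup>2" .
  qed
  finally show ?thesis by simp
qed

text \<open>Used for the total only: multiplied by \<open>x / p\<close> at \<open>x = n\<close>,
  both bounds tend to \<open>1\<close> when \<open>p = o(n)\<close>.\<close>

lemma inverse_row_sum_bounds:
  fixes x :: real assumes x: "p < x"
  shows "p / x \<le> inverse_row_sum p x" "inverse_row_sum p x \<le> p / (x - p)"
proof -
  have "(\<Sum>i=1..p. 1 / x) \<le> inverse_row_sum p x"
    unfolding inverse_row_sum_def using x by (intro sum_mono divide_left_mono mult_pos_pos) auto
  then show "p / x \<le> inverse_row_sum p x" by simp
  have "inverse_row_sum p x \<le> (\<Sum>i=1..p. 1 / (x - p))"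
    unfolding inverse_row_sum_def using x by (intro sum_mono divide_left_mono mult_pos_pos) auto
  then show "inverse_row_sum p x \<le> p / (x - p)" by simp
qed

text \<open>
  At \<open>y = x - i\<close>, the summand of \<^term>\<open>log_row_sum p x + p\<close> minus the increment of \<open>stirling_diff\<close>
  that is to approximate it.
\<close>

definition row_defect :: "real \<Rightarrow> real" where
  "row_defect y = ln y - 1 / y + 1 - (y - 1 / 2) * ln (y - 1) + (y - 3 / 2) * ln (y - 2)"

text \<open>The shifts \<open>1 / 2\<close> and \<open>3 / 2\<close> are those for which the
  logarithmic, the constant and the \<open>1 / y\<close> terms of the expansion all cancel.\<close>

lemma row_defect_bound: "\<exists>C Y. 0 \<le> C \<and> 2 < Y \<and> (\<forall>y\<ge>Y. \<bar>row_defect y\<bar> \<le> C / y\<^sup>2)"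
proof -
  have "(\<lambda>y. ln y - 1 / y + 1 - (y - 1 / 2) * ln (y - 1) + (y - 3 / 2) * ln (y - 2)) \<in> O(\<lambda>y::real. 1 / y\<^sup>2)"
    by real_asymp
  then obtain C where C: "0 < C" "\<forall>\<^sub>F y in at_top. norm (row_defect y) \<le> C * norm (1 / y\<^sup>2)"
    unfolding row_defect_def[abs_def] by (rule landau_o.bigE)
  then obtain Y where Y: "\<And>y. y \<ge> Y \<Longrightarrow> norm (row_defect y) \<le> C * norm (1 / y\<^sup>2)"
    by (auto simp: eventually_at_top_linorder)
  show ?thesis
    by (rule exI[of _ C], rule exI[of _ "max Y 3"]) (use C(1) Y in auto)
qed

text \<open>Minus \<open>p\<close>, this is Stirling's approximation to
  \<open>ln_Gamma (x - 1) - ln_Gamma (x - p - 1)\<close>, the sum of \<open>ln (x - i - 1)\<close>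
  over the rows. It is also the shape in which the groups enter \<open>s_tilde\<close>.\<close>

definition stirling_diff :: "real \<Rightarrow> real \<Rightarrow> real" where
  "stirling_diff p x = (x - 3 / 2) * ln (x - 2) - (x - p - 3 / 2) * ln (x - p - 2)"

text \<open>The difference telescopes into values of \<open>row_defect\<close> at
  \<open>x - i\<close>, each at most \<open>C / (\<epsilon> * x)^2\<close>.\<close>

lemma log_row_sum_approx:
  fixes x Y C \<epsilon> :: real
  assumes C: "\<And>y. y \<ge> Y \<Longrightarrow> \<bar>row_defect y\<bar> \<le> C / y\<^sup>2" "0 \<le> C" "2 < Y"
    and x: "Y \<le> x - p" "0 < \<epsilon>" "\<epsilon> * x \<le> x - p"
  shows "\<bar>log_row_sum p x - stirling_diff p x + p\<bar> \<le> C / \<epsilon>\<^sup>2 * p / x\<^sup>2"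
proof -
  have tel: "log_row_sum k x - stirling_diff k x + k = (\<Sum>i=1..k. row_defect (x - real i))" for k :: nat
  proof (induction k)
    case 0
    then show ?case by (simp add: log_row_sum_def stirling_diff_def)
  next
    case (Suc k)
    have "stirling_diff (Suc k) x - stirling_diff k x
       = (x - Suc k - 1 / 2) * ln (x - Suc k - 1) - (x - Suc k - 3 / 2) * ln (x - Suc k - 2)"
      by (simp add: stirling_diff_def algebra_simps)
    moreover have "log_row_sum (Suc k) x = log_row_sum k x + (ln (x - Suc k) - 1 / (x - Suc k))"
      by (simp add: log_row_sum_def)
    ultimately show ?case using Suc by (simp add: row_defect_def)
  qed
  have x0: "0 < x" using x C(3) by simp
  have "\<bar>log_row_sum p x - stirling_diff p x + p\<bar> \<le> (\<Sum>i=1..p. C / (\<epsilon> * x)\<^sup>2)"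
    unfolding tel
  proof (rule order_trans[OF sum_abs sum_mono])
    fix i :: nat assume i: "i \<in> {1..p}"
    have "\<bar>row_defect (x - real i)\<bar> \<le> C / (x - real i)\<^sup>2" using i x by (intro C(1)) auto
    also have "\<dots> \<le> C / (\<epsilon> * x)\<^sup>2"
      using i x x0 C by (intro divide_left_mono power_mono mult_pos_pos) (auto simp: zero_less_mult_iff)
    finally show "\<bar>row_defect (x - real i)\<bar> \<le> C / (\<epsilon> * x)\<^sup>2" .
  qed
  also have "\<dots> = C / \<epsilon>\<^sup>2 * p / x\<^sup>2" by (simp add: power_mult_distrib)
  finally show ?thesis .
qed

text \<open>The common shape of the terms of \<open>s_tilde\<close> that belong to the total,
  evaluated at slightly different \<open>x\<close>.\<close>

definition shrink :: "real \<Rightarrow> real \<Rightarrow> real" where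
  "shrink p x = (x - p) * ln ((x - p) / x)"

text \<open>The derivative \<open>ln (1 - p / z) + p / z\<close> is of second order in
  \<open>p / z\<close>; the mean value theorem does the rest.\<close>

lemma shrink_diff_bound:
  assumes p: "0 \<le> p" and m: "0 < m" "2 * p \<le> m" and x: "m \<le> x" and y: "m \<le> y"
  shows "\<bar>shrink p x - shrink p y\<bar> \<le> 2 * \<bar>x - y\<bar> * (p / m)\<^sup>2"
proof -
  have d: "(shrink p has_real_derivative ln (1 - p / z) + p / z) (at z)" if "m \<le> z" for z
  proof -
    have z: "0 < z" "0 < z - p" using that p m by auto
    have "(shrink p has_real_derivative 1 * ln ((z - p) / z) + (z - p) * (1 / ((z - p) / z) * ((1 * z - (z - p) * 1) / (z * z)))) (at z)"
      unfolding shrink_def[abs_def] using z by (auto intro!: derivative_eq_intros)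
    also have "1 * ln ((z - p) / z) + (z - p) * (1 / ((z - p) / z) * ((1 * z - (z - p) * 1) / (z * z))) = ln (1 - p / z) + p / z"
    proof -
      have "(z - p) / z = 1 - p / z" using z by (simp add: diff_divide_distrib)
      moreover have "(z - p) * (1 / ((z - p) / z) * ((1 * z - (z - p) * 1) / (z * z))) = p / z"
        using z by (simp add: divide_simps)
      ultimately show ?thesis by (simp only: mult_1_left)
    qed
    finally show ?thesis .
  qed
  have b: "\<bar>ln (1 - p / z) + p / z\<bar> \<le> 2 * (p / m)\<^sup>2" if "m \<le> z" for z
  proof -
    have u: "0 \<le> p / z" "p / m \<le> 1 / 2" using that p m by (auto simp: divide_simps)
    have u': "p / z \<le> p / m" using that p m by (intro divide_left_mono) auto
    have "\<bar>ln (1 + (- (p / z))) - (- (p / z))\<bar> \<le> 2 * (- (p / z))\<^sup>2"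
      by (rule abs_ln_one_plus_x_minus_x_bound, unfold abs_minus_cancel abs_of_nonneg[OF u(1)]) (use u(2) u' in linarith)
    also have "\<dots> \<le> 2 * (p / m)\<^sup>2" unfolding power2_minus using u u' by (intro mult_left_mono power_mono) auto
    finally show ?thesis by simp
  qed
  have main: "\<bar>shrink p y - shrink p x\<bar> \<le> 2 * (y - x) * (p / m)\<^sup>2" if xy: "x < y" "m \<le> x" for x y
  proof -
    obtain z where z: "x < z" "z < y" "shrink p y - shrink p x = (y - x) * (ln (1 - p / z) + p / z)"
      using MVT2[OF xy(1), of "shrink p" "\<lambda>z. ln (1 - p / z) + p / z"] d xy(2) by auto
    have "\<bar>shrink p y - shrink p x\<bar> = (y - x) * \<bar>ln (1 - p / z) + p / z\<bar>"
      using z xy by (simp add: abs_mult)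
    also have "\<dots> \<le> (y - x) * (2 * (p / m)\<^sup>2)" using z xy by (intro mult_left_mono b) auto
    also have "\<dots> = 2 * (y - x) * (p / m)\<^sup>2" by (simp only: mult_ac)
    finally show ?thesis .
  qed
  show ?thesis
    using main[of x y] main[of y x] x y by (cases x y rule: linorder_cases) (auto simp: abs_minus_commute)
qed

lemma abs_ln_one_plus_le:
  fixes z :: real assumes "\<bar>z\<bar> \<le> 1 / 2" shows "\<bar>ln (1 + z)\<bar> \<le> 2 * \<bar>z\<bar>"
proof -
  have "\<bar>ln (1 + z) - z\<bar> \<le> 2 * z\<^sup>2" by (rule abs_ln_one_plus_x_minus_x_bound[OF assms])
  also have "2 * z\<^sup>2 \<le> \<bar>z\<bar>"
    using mult_right_mono[OF assms, of "2 * \<bar>z\<bar>"] by (simp add: power2_eq_square abs_mult[symmetric])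
  finally show ?thesis by linarith
qed

text \<open>Per factor \<open>n / 2\<close>, the mismatch between the total part of
  \<open>s_tilde\<close> and \<open>stirling_diff p n\<close>, grouped into brackets in which the
  leading terms cancel.\<close>

definition centring_defect :: "real \<Rightarrow> real \<Rightarrow> real \<Rightarrow> real" where
  "centring_defect n p q = p * (ln (n - q) + ln (n + q - 3) - 2 * ln (n - 2))
     + (shrink p (n - 2) - shrink p (n - q)) + (shrink p (n / 2 - 1) - shrink p (n / 2 + q / 2 - 3 / 2))
     + 1 / 2 * ln ((n - p - 2) / (n - 2))"

text \<open>The brackets are of order \<open>p / n\<close>, \<open>p * q^2 / n^2\<close> and
  \<open>p^2 * q / n^2\<close>. After multiplication by \<open>n / 2\<close>, the bound
  \<open>p * q \<le> n\<close> makes all of them linear in \<open>p\<close> and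
  \<open>q\<close>.\<close>

lemma centring_defect_bound:
  fixes n p q :: real
  assumes n: "100 \<le> n" and p: "1 \<le> p" "8 * p \<le> n" and q: "1 \<le> q" "8 * q \<le> n" and pq: "p * q \<le> n"
  shows "n / 2 * \<bar>centring_defect n p q\<bar> \<le> 69 * p + 2 * q"
proof -
  have m: "0 < n / 4" "2 * p \<le> n / 4" using n p by auto
  \<comment> \<open>All arguments are at least \<open>n / 4\<close>, so the constant is
    \<open>2 * 4^2 = 32\<close>.\<close>
  have s: "\<bar>shrink p x - shrink p y\<bar> \<le> 32 * \<bar>x - y\<bar> * p\<^sup>2 / n\<^sup>2" if "n / 4 \<le> x" "n / 4 \<le> y" for x y
    using shrink_diff_bound[OF _ m that] p n by (simp add: power_divide)
  have s1: "\<bar>shrink p (n - 2) - shrink p (n - q)\<bar> \<le> 32 * (3 * q) * p\<^sup>2 / n\<^sup>2"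
  proof -
    have "\<bar>shrink p (n - 2) - shrink p (n - q)\<bar> \<le> 32 * \<bar>n - 2 - (n - q)\<bar> * p\<^sup>2 / n\<^sup>2"
      using n q by (intro s) auto
    also have "\<dots> \<le> 32 * (3 * q) * p\<^sup>2 / n\<^sup>2"
      using q by (intro divide_right_mono mult_right_mono) auto
    finally show ?thesis .
  qed
  have s2: "\<bar>shrink p (n / 2 - 1) - shrink p (n / 2 + q / 2 - 3 / 2)\<bar> \<le> 32 * q * p\<^sup>2 / n\<^sup>2"
  proof -
    have "\<bar>shrink p (n / 2 - 1) - shrink p (n / 2 + q / 2 - 3 / 2)\<bar> \<le> 32 * \<bar>n / 2 - 1 - (n / 2 + q / 2 - 3 / 2)\<bar> * p\<^sup>2 / n\<^sup>2"
      using n q by (intro s) auto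
    also have "\<dots> \<le> 32 * q * p\<^sup>2 / n\<^sup>2"
      using q by (intro divide_right_mono mult_right_mono) auto
    finally show ?thesis .
  qed
  have s3: "\<bar>1 / 2 * ln ((n - p - 2) / (n - 2))\<bar> \<le> 2 * p / n"
  proof -
    have e: "(n - p - 2) / (n - 2) = 1 + (- (p / (n - 2)))" using n by (simp add: field_simps)
    have u: "p / (n - 2) \<le> 2 * p / n" using n p by (simp add: divide_simps)
    have "2 * p / n \<le> 1 / 2" using n p by (simp add: divide_simps)
    then have "\<bar>ln (1 + (- (p / (n - 2))))\<bar> \<le> 2 * \<bar>- (p / (n - 2))\<bar>"
      using u n p by (intro abs_ln_one_plus_le) auto
    also have "\<dots> = 2 * (p / (n - 2))" using n p by simp
    finally show ?thesis unfolding e using u by simp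
  qed
  have s4: "\<bar>p * (ln (n - q) + ln (n + q - 3) - 2 * ln (n - 2))\<bar> \<le> (8 * p * n + 4 * p * q\<^sup>2) / n\<^sup>2"
  proof -
    \<comment> \<open>\<open>1 + z\<close> is \<open>(n - q) * (n + q - 3) / (n - 2)^2\<close>. The
      products \<open>n * q\<close> cancel, so only \<open>q^2\<close> and terms linear in
      \<open>n\<close> and \<open>q\<close> remain in the numerator.\<close>
    define z where "z = (n - q\<^sup>2 + 3 * q - 4) / (n - 2)\<^sup>2"
    have n2: "0 < (n - 2)\<^sup>2" using n by simp
    have "2 * (n - 2)\<^sup>2 - n\<^sup>2 = n * (n - 8) + 8" by (simp add: power2_eq_square algebra_simps)
    moreover have "0 \<le> n * (n - 8)" using n by (intro mult_nonneg_nonneg) auto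
    ultimately have nn: "n\<^sup>2 / 2 \<le> (n - 2)\<^sup>2" by simp
    have "\<bar>n - q\<^sup>2 + 3 * q - 4\<bar> \<le> 2 * n + q\<^sup>2"
      unfolding abs_le_iff using n q zero_le_power2[of q] by linarith
    then have "\<bar>z\<bar> \<le> (2 * n + q\<^sup>2) / (n - 2)\<^sup>2"
      unfolding z_def by (simp add: divide_right_mono)
    also have "\<dots> \<le> (2 * n + q\<^sup>2) / (n\<^sup>2 / 2)"
      using nn n n2 by (intro divide_left_mono) auto
    finally have zb: "\<bar>z\<bar> \<le> (4 * n + 2 * q\<^sup>2) / n\<^sup>2" by (simp add: mult.commute)
    have "(8 * q)\<^sup>2 \<le> n\<^sup>2" using q by (intro power_mono) auto
    then have "64 * q\<^sup>2 \<le> n\<^sup>2" by (simp add: power_mult_distrib)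
    moreover have "100 * n \<le> n\<^sup>2" using n by (simp add: power2_eq_square)
    ultimately have "4 * n + 2 * q\<^sup>2 \<le> n\<^sup>2 / 2" using n by linarith
    then have "(4 * n + 2 * q\<^sup>2) / n\<^sup>2 \<le> 1 / 2" using n by (simp add: divide_simps)
    then have "\<bar>ln (1 + z)\<bar> \<le> 2 * \<bar>z\<bar>" using zb by (intro abs_ln_one_plus_le) linarith
    also have "1 + z = (n - q) * (n + q - 3) / (n - 2)\<^sup>2"
      using n2 unfolding z_def by (simp add: divide_simps) (simp add: power2_eq_square algebra_simps)
    also have "ln ((n - q) * (n + q - 3) / (n - 2)\<^sup>2) = ln (n - q) + ln (n + q - 3) - 2 * ln (n - 2)"
      using n q by (simp add: ln_divide_pos ln_mult_pos ln_realpow)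
    finally have "\<bar>ln (n - q) + ln (n + q - 3) - 2 * ln (n - 2)\<bar> \<le> 2 * ((4 * n + 2 * q\<^sup>2) / n\<^sup>2)" using zb by linarith
    then have "p * \<bar>ln (n - q) + ln (n + q - 3) - 2 * ln (n - 2)\<bar> \<le> p * (2 * ((4 * n + 2 * q\<^sup>2) / n\<^sup>2))"
      using p by (intro mult_left_mono) auto
    also have "\<dots> = (8 * p * n + 4 * p * q\<^sup>2) / n\<^sup>2" by (simp add: algebra_simps)
    finally show ?thesis using p by (simp add: abs_mult)
  qed
  have "\<bar>centring_defect n p q\<bar> \<le> (8 * p * n + 4 * p * q\<^sup>2) / n\<^sup>2 + 32 * (3 * q) * p\<^sup>2 / n\<^sup>2 + 32 * q * p\<^sup>2 / n\<^sup>2 + 2 * p / n"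
  proof -
    have tri: "\<bar>a + b + c + d\<bar> \<le> A + B + C + D"
      if "\<bar>a\<bar> \<le> A" "\<bar>b\<bar> \<le> B" "\<bar>c\<bar> \<le> C" "\<bar>d\<bar> \<le> D" for a b c d A B C D :: real
      using that by linarith
    show ?thesis unfolding centring_defect_def by (rule tri[OF s4 s1 s2 s3])
  qed
  then have "n / 2 * \<bar>centring_defect n p q\<bar> \<le> n / 2 * ((8 * p * n + 4 * p * q\<^sup>2) / n\<^sup>2 + 32 * (3 * q) * p\<^sup>2 / n\<^sup>2 + 32 * q * p\<^sup>2 / n\<^sup>2 + 2 * p / n)"
    using n by (intro mult_left_mono) auto
  also have "\<dots> = 5 * p + 2 * q * (p * q / n) + 64 * p * (p * q / n)"
    using n by (simp add: divide_simps) (simp add: power2_eq_square algebra_simps)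
  also have "\<dots> \<le> 5 * p + 2 * q * 1 + 64 * p * 1"
    using pq p q n by (intro add_mono mult_left_mono) (auto simp: divide_simps)
  finally show ?thesis by simp
qed

text \<open>An exact identity; the size conditions keep the arguments of the logarithms positive.
  The summands \<open>p\<close> in the brackets balance because the \<open>N j\<close> add up to
  \<open>n\<close>.\<close>

lemma lr_mean_minus_s_tilde:
  fixes n p q :: nat
  assumes n: "n = (\<Sum>j=1..q. N j)" and big: "2 < real n - p" "q < n" "2 < n" "1 \<le> q"
    and pq: "real p + q < n" "2 * real p + 2 < n"
    and N: "\<And>j. j \<in> {1..q} \<Longrightarrow> 2 < real (N j) - p"
  shows "lr_mean p q N - s_tilde n p q (\<lambda>j. N j)
    = (\<Sum>j=1..q. N j / 2 * (log_row_sum p (N j) - stirling_diff p (N j) + p))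
      - n / 2 * (log_row_sum p n - stirling_diff p n + p) + n / 2 * centring_defect n p q"
proof -
  let ?T = "p * ln ((real n / 2 - 1) / (real n / 2 + q / 2 - 3 / 2))
         + (real n - q - p) * ln ((real n - q - p) / (real n - q))
         + (real n / 2 - p - 1) * ln ((real n / 2 - 1) / (real n / 2 - p - 1))
         + (real n / 2 - p + q / 2 - 3 / 2)
             * ln ((real n / 2 - p + q / 2 - 3 / 2) / (real n / 2 + q / 2 - 3 / 2))"
  have r: "real n > 0" using big by simp
  have sj: "N j / 2 * ((real (N j) - p - 3 / 2) * ln ((real (N j) - 2) / (real (N j) - p - 2))
         + p * ln ((real (N j) - 2) / (real n - q)) - p * ln (N j))
     = N j / 2 * stirling_diff p (N j) - N j / 2 * (p * ln (real n - q)) - N j / 2 * (p * ln (N j))" if "j \<in> {1..q}" for j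
  proof -
    have e: "ln ((real (N j) - 2) / (real (N j) - p - 2)) = ln (real (N j) - 2) - ln (real (N j) - p - 2)"
      "ln ((real (N j) - 2) / (real n - q)) = ln (real (N j) - 2) - ln (real n - q)"
      using N[OF that] big by (auto intro!: ln_divide_pos)
    show ?thesis unfolding e stirling_diff_def by (simp add: algebra_simps)
  qed
  have nsum: "(\<Sum>j=1..q. N j / 2 * c) = n / 2 * c" for c :: real
    by (simp add: n sum_distrib_right sum_divide_distrib)
  have st: "s_tilde n p q (\<lambda>j. N j) = (\<Sum>j=1..q. N j / 2 * stirling_diff p (N j)) - n / 2 * (p * ln (real n - q))
      - (\<Sum>j=1..q. N j / 2 * (p * ln (N j))) + n / 2 * (?T + p * ln n)"
  proof -
    have "s_tilde n p q (\<lambda>j. N j) = (\<Sum>j=1..q. N j / 2 * stirling_diff p (N j) - N j / 2 * (p * ln (real n - q)) - N j / 2 * (p * ln (N j)))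
      + n / 2 * (?T + p * ln n)"
      unfolding s_tilde_def
      by (rule arg_cong2[where f = "(+)"], rule sum.cong[OF refl sj], assumption) (simp only: add_ac)
    then show ?thesis by (simp only: sum_subtractf nsum)
  qed
  have lm: "lr_mean p q N = p * (n / 2 * ln n) - (\<Sum>j=1..q. N j / 2 * (p * ln (N j))) + (\<Sum>j=1..q. N j / 2 * log_row_sum p (N j)) - n / 2 * log_row_sum p n"
    unfolding lr_mean_def Let_def n[symmetric] by (simp add: right_diff_distrib sum_distrib_left mult_ac)
  have cd: "centring_defect n p q = p * ln (real n - q) - stirling_diff p n - ?T"
  proof -
    have e1: "ln ((real n / 2 - 1) / (real n / 2 + q / 2 - 3 / 2)) = ln (real n - 2) - ln (real n + q - 3)"
    proof -
      have "(real n / 2 - 1) / (real n / 2 + q / 2 - 3 / 2) = (real n - 2) / (real n + q - 3)"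
        using big by (simp add: divide_simps) (simp add: algebra_simps)
      then show ?thesis using big by (simp add: ln_divide_pos)
    qed
    have e2: "(real n - q - p) * ln ((real n - q - p) / (real n - q)) = shrink p (real n - q)"
      by (simp add: shrink_def algebra_simps)
    have e3: "(real n / 2 - p - 1) * ln ((real n / 2 - 1) / (real n / 2 - p - 1)) = - shrink p (real n / 2 - 1)"
    proof -
      have a: "0 < real n / 2 - 1" "0 < real n / 2 - p - 1" using pq big by auto
      have e: "real n / 2 - 1 - p = real n / 2 - p - 1" by simp
      show ?thesis unfolding shrink_def e using a by (simp add: ln_divide_pos algebra_simps)
    qed
    have e4: "(real n / 2 - p + q / 2 - 3 / 2) * ln ((real n / 2 - p + q / 2 - 3 / 2) / (real n / 2 + q / 2 - 3 / 2)) = shrink p (real n / 2 + q / 2 - 3 / 2)"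
    proof -
      have e: "real n / 2 + q / 2 - 3 / 2 - p = real n / 2 - p + q / 2 - 3 / 2" by simp
      show ?thesis unfolding shrink_def e ..
    qed
    have e5: "stirling_diff p n = p * ln (real n - 2) - shrink p (real n - 2) - 1 / 2 * ln ((real n - p - 2) / (real n - 2))"
    proof -
      have a: "0 < real n - 2" "0 < real n - p - 2" using big by auto
      have e: "real n - 2 - p = real n - p - 2" by simp
      show ?thesis unfolding shrink_def stirling_diff_def e using a by (simp add: ln_divide_pos algebra_simps)
    qed
    show ?thesis unfolding centring_defect_def e1 e2 e3 e4 e5 by (simp add: algebra_simps)
  qed
  have E: "(\<Sum>j=1..q. N j / 2 * (log_row_sum p (N j) - stirling_diff p (N j) + p))
    = (\<Sum>j=1..q. N j / 2 * log_row_sum p (N j)) - (\<Sum>j=1..q. N j / 2 * stirling_diff p (N j)) + n / 2 * p"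
    by (simp only: distrib_left right_diff_distrib sum.distrib sum_subtractf nsum)
  show ?thesis unfolding st lm cd E by (simp add: algebra_simps)
qed

text \<open>Each group, however large, has an error of at most
  \<open>C / (2 * \<epsilon>^2)\<close>, since \<open>N j / 2\<close> meets
  \<open>p / (N j)^2\<close>. The groups thus cost \<open>O(q)\<close>, the total
  \<open>O(1)\<close> and the centring defect \<open>O(p + q)\<close>.\<close>

lemma lr_mean_approx:
  fixes n p q :: nat and Y C \<epsilon> :: real
  assumes n: "n = (\<Sum>j=1..q. N j)" "100 \<le> n" and p: "1 \<le> p" "8 * p \<le> n" and q: "1 \<le> q" "8 * q \<le> n" and pq: "p * q \<le> n"
    and C: "\<And>y. y \<ge> Y \<Longrightarrow> \<bar>row_defect y\<bar> \<le> C / y\<^sup>2" "0 \<le> C" "2 < Y"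
    and \<epsilon>: "0 < \<epsilon>" and N: "\<And>j. j \<in> {1..q} \<Longrightarrow> Y \<le> real (N j) - p \<and> \<epsilon> * N j \<le> real (N j) - p"
    and Nn: "Y \<le> real n - p" "\<epsilon> * n \<le> real n - p"
  shows "\<bar>lr_mean p q N - s_tilde n p q (\<lambda>j. N j)\<bar> \<le> (C / \<epsilon>\<^sup>2 + 2) * q + 69 * p"
proof -
  let ?E = "\<lambda>x::real. log_row_sum p x - stirling_diff p x + p"
  let ?K = "C / \<epsilon>\<^sup>2"
  have K: "0 \<le> ?K" using C by simp
  have Eb: "\<bar>x / 2 * ?E x\<bar> \<le> ?K / 2" if x: "Y \<le> x - p" "\<epsilon> * x \<le> x - p" for x :: real
  proof -
    have x0: "0 < x" "p \<le> x" using x C by auto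
    have "\<bar>x / 2 * ?E x\<bar> = x / 2 * \<bar>?E x\<bar>" using x0 by (simp add: abs_mult)
    also have "\<dots> \<le> x / 2 * (?K * p / x\<^sup>2)" 
      using x0 by (intro mult_left_mono log_row_sum_approx[where Y = Y] C x \<epsilon>) auto
    also have "\<dots> = ?K / 2 * (p / x)" using x0 by (simp add: power2_eq_square)
    also have "\<dots> \<le> ?K / 2 * 1" using x0 K by (intro mult_left_mono) auto
    finally show ?thesis by simp
  qed
  have s: "\<bar>\<Sum>j=1..q. N j / 2 * ?E (N j)\<bar> \<le> q * (?K / 2)"
  proof -
    have "\<bar>\<Sum>j=1..q. N j / 2 * ?E (N j)\<bar> \<le> (\<Sum>j=1..q. ?K / 2)"
      by (rule order_trans[OF sum_abs sum_mono]) (use N Eb in auto)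
    then show ?thesis by simp
  qed
  have t: "\<bar>n / 2 * ?E n\<bar> \<le> q * (?K / 2)"
  proof (rule order_trans[OF Eb[OF Nn]])
    show "?K / 2 \<le> q * (?K / 2)" using mult_right_mono[of 1 "real q" "?K / 2"] q K by simp
  qed
  have "real (p * q) \<le> real n" using pq by (rule of_nat_mono)
  then have c: "\<bar>n / 2 * centring_defect n p q\<bar> \<le> 69 * p + 2 * q"
    using centring_defect_bound[of n p q] n(2) p q by (simp add: abs_mult)
  have eq: "lr_mean p q N - s_tilde n p q (\<lambda>j. N j) = (\<Sum>j=1..q. N j / 2 * ?E (N j)) - n / 2 * ?E n + n / 2 * centring_defect n p q"
  proof (rule lr_mean_minus_s_tilde[OF n(1)])
    show "2 < real (N j) - p" if "j \<in> {1..q}" for j using N[OF that] C(3) by simp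
  qed (use n(2) p q of_nat_mono[OF p(2), where 'a = real] of_nat_mono[OF q(2), where 'a = real] of_nat_mono[OF n(2), where 'a = real] in simp_all)
  have "\<bar>lr_mean p q N - s_tilde n p q (\<lambda>j. N j)\<bar> \<le> q * (?K / 2) + q * (?K / 2) + (69 * p + 2 * q)"
  proof -
    have tri: "\<bar>a - b + c\<bar> \<le> A + B + D" if "\<bar>a\<bar> \<le> A" "\<bar>b\<bar> \<le> B" "\<bar>c\<bar> \<le> D" for a b c A B D :: real
      using that by linarith
    show ?thesis unfolding eq using tri[OF s t c] by simp
  qed
  also have "\<dots> = (?K + 2) * q + 69 * p" by (simp add: algebra_simps)
  finally show ?thesis .
qed

text \<open>A group contributes the error \<open>1 / (4 * \<epsilon>^2 * n)\<close>. For the total,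
  \<open>n * inverse_row_sum p n / p\<close> is \<open>1 + O(p / n)\<close>, which explains the bare
  constant \<open>- 1 / 2\<close> in \<open>sigma_tilde_sq\<close>.\<close>

lemma lr_var_approx:
  fixes n p q :: nat and \<epsilon> :: real
  assumes n: "n = (\<Sum>j=1..q. N j)" and p: "1 \<le> p" "2 * p \<le> n" and \<epsilon>: "0 < \<epsilon>"
    and N: "\<And>j. j \<in> {1..q} \<Longrightarrow> \<epsilon> * N j \<le> real (N j) - p - 1 \<and> 0 < N j"
  shows "\<bar>lr_var p q N / (real p * n) - sigma_tilde_sq n p q N / 2\<bar> \<le> q / (4 * \<epsilon>\<^sup>2 * n) + real p / (2 * real n)"
proof -
  let ?L = "\<lambda>j. ln ((real (N j) - 1) / (real (N j) - p - 1))"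
  have n0: "0 < real n" "0 < real p" using p by auto
  have e: "lr_var p q N / (real p * n) - sigma_tilde_sq n p q N / 2
    = (\<Sum>j=1..q. (real (N j))\<^sup>2 / (4 * real p * n) * (inverse_row_sum p (N j) - ?L j)) - 1 / 4 * (n * inverse_row_sum p n / p - 1)"
  proof -
    have "lr_var p q N / (real p * n) = (\<Sum>j=1..q. (real (N j))\<^sup>2 / (4 * real p * n) * inverse_row_sum p (N j)) - n * inverse_row_sum p n / p / 4"
      unfolding lr_var_def Let_def n[symmetric] using n0
      by (simp add: diff_divide_distrib sum_divide_distrib power_divide power2_eq_square mult_ac)
    moreover have "sigma_tilde_sq n p q N / 2 = (\<Sum>j=1..q. (real (N j))\<^sup>2 / (4 * real p * n) * ?L j) - 1 / 4"
    proof -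
      have "(\<Sum>j=1..q. (real (N j))\<^sup>2 / (4 * real p * n) * ?L j) = (\<Sum>j=1..q. (real (N j))\<^sup>2 / (real p * n) * ?L j) / 4"
        unfolding sum_divide_distrib by (intro sum.cong refl) simp
      then show ?thesis unfolding sigma_tilde_sq_def by simp
    qed
    moreover have "(\<Sum>j=1..q. (real (N j))\<^sup>2 / (4 * real p * n) * (inverse_row_sum p (N j) - ?L j))
      = (\<Sum>j=1..q. (real (N j))\<^sup>2 / (4 * real p * n) * inverse_row_sum p (N j)) - (\<Sum>j=1..q. (real (N j))\<^sup>2 / (4 * real p * n) * ?L j)"
      by (simp only: right_diff_distrib sum_subtractf)
    moreover have "(A - h / 4) - (B - 1 / 4) = (A - B) - 1 / 4 * (h - 1)" for A B h :: real
      by (simp add: field_simps)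
    ultimately show ?thesis by (simp only:)
  qed
  have a: "\<bar>\<Sum>j=1..q. (real (N j))\<^sup>2 / (4 * real p * n) * (inverse_row_sum p (N j) - ?L j)\<bar> \<le> (\<Sum>j=1..q. 1 / (4 * \<epsilon>\<^sup>2 * n))"
  proof (rule order_trans[OF sum_abs sum_mono])
    fix j assume j: "j \<in> {1..q}"
    have Nj: "0 < real (N j)" and Ne: "\<epsilon> * N j \<le> real (N j) - p - 1" using N[OF j] by auto
    have pos: "0 < \<epsilon> * N j" using \<epsilon> Nj by simp
    have "\<bar>inverse_row_sum p (N j) - ?L j\<bar> \<le> p / (real (N j) - p - 1)\<^sup>2"
      using Ne pos by (intro inverse_row_sum_approx) auto
    also have "\<dots> \<le> p / (\<epsilon> * N j)\<^sup>2"
    proof (rule divide_left_mono)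
      show "(\<epsilon> * N j)\<^sup>2 \<le> (real (N j) - p - 1)\<^sup>2" using Ne pos by (intro power_mono) auto
      have "0 < real (N j) - p - 1" using Ne pos by simp
      then show "0 < (real (N j) - p - 1)\<^sup>2 * (\<epsilon> * N j)\<^sup>2" 
        by (rule mult_pos_pos[OF zero_less_power zero_less_power[OF pos]])
    qed simp
    finally have "(real (N j))\<^sup>2 / (4 * real p * n) * \<bar>inverse_row_sum p (N j) - ?L j\<bar> \<le> (real (N j))\<^sup>2 / (4 * real p * n) * (p / (\<epsilon> * N j)\<^sup>2)"
      by (rule mult_left_mono) simp
    also have "\<dots> = 1 / (4 * \<epsilon>\<^sup>2 * n)" using Nj n0 by (simp add: power_mult_distrib)
    finally show "\<bar>(real (N j))\<^sup>2 / (4 * real p * n) * (inverse_row_sum p (N j) - ?L j)\<bar> \<le> 1 / (4 * \<epsilon>\<^sup>2 * n)"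
      by (simp add: abs_mult)
  qed
  have b: "\<bar>1 / 4 * (n * inverse_row_sum p n / p - 1)\<bar> \<le> real p / (2 * real n)"
  proof -
    have pn: "real p < real n" using p by simp
    have h: "real n / 2 \<le> real n - p" using of_nat_mono[OF p(2), where 'a = real] by simp
    define H where "H = n * inverse_row_sum p n / p"
    have 1: "1 \<le> H"
      using inverse_row_sum_bounds(1)[OF pn] n0 by (simp add: H_def field_simps)
    have "H \<le> n * (p / (real n - p)) / p"
      unfolding H_def using inverse_row_sum_bounds(2)[OF pn] n0 by (intro divide_right_mono mult_left_mono) auto
    also have "\<dots> = n / (real n - p)" using n0 by simp
    also have "n / (real n - p) = 1 + p / (real n - p)" using pn by (simp add: field_simps)
    also have "p / (real n - p) \<le> p / (real n / 2)" using h n0 pn by (intro divide_left_mono) auto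
    finally have 2: "H \<le> 1 + p / (real n / 2)" by simp
    define u where "u = p / (real n / 2)"
    have 3: "real p / (2 * real n) = u / 4" by (simp add: u_def)
    show ?thesis unfolding H_def[symmetric] 3 using 1 2[folded u_def] by simp
  qed
  have "(\<Sum>j=1..q. 1 / (4 * \<epsilon>\<^sup>2 * n)) = q / (4 * \<epsilon>\<^sup>2 * n)" by simp
  with a have a': "\<bar>\<Sum>j=1..q. (real (N j))\<^sup>2 / (4 * real p * n) * (inverse_row_sum p (N j) - ?L j)\<bar> \<le> q / (4 * \<epsilon>\<^sup>2 * n)"
    by (simp only:)
  show ?thesis unfolding e by (rule order_trans[OF abs_triangle_ineq4 add_mono[OF a' b]])
qed

section \<open>Limits of characteristic functions\<close>

lemma char_normal_density:
  assumes "0 < \<sigma>"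
  shows "char (density lborel (normal_density 0 \<sigma>)) t = exp (of_real (- (\<sigma>\<^sup>2 * t\<^sup>2 / 2)))"
proof -
  have "char (density lborel (normal_density 0 \<sigma>)) t = (\<integral>x. normal_density 0 \<sigma> x *\<^sub>R iexp (t * x) \<partial>lborel)"
    unfolding char_def by (rule integral_density) auto
  also have "\<dots> = \<bar>\<sigma>\<bar> *\<^sub>R (\<integral>y. normal_density 0 \<sigma> (0 + \<sigma> * y) *\<^sub>R iexp (t * (0 + \<sigma> * y)) \<partial>lborel)"
    using assms by (intro lborel_integral_real_affine) simp
  also have "\<dots> = (\<integral>y. \<bar>\<sigma>\<bar> *\<^sub>R (normal_density 0 \<sigma> (0 + \<sigma> * y) *\<^sub>R iexp (t * (0 + \<sigma> * y))) \<partial>lborel)"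
    by (simp only: integral_scaleR_right)
  also have "\<dots> = (\<integral>y. std_normal_density y *\<^sub>R iexp ((t * \<sigma>) * y) \<partial>lborel)"
  proof (rule Bochner_Integration.integral_cong[OF refl])
    fix y
    have "\<bar>\<sigma>\<bar> * normal_density 0 \<sigma> (\<sigma> * y) = std_normal_density y"
      using assms by (simp add: normal_density_def real_sqrt_mult power_mult_distrib)
    then show "\<bar>\<sigma>\<bar> *\<^sub>R (normal_density 0 \<sigma> (0 + \<sigma> * y) *\<^sub>R iexp (t * (0 + \<sigma> * y))) = std_normal_density y *\<^sub>R iexp ((t * \<sigma>) * y)"
      by (simp add: mult.assoc del: of_real_mult)
  qed
  also have "\<dots> = char std_normal_distribution (t * \<sigma>)"
    unfolding char_def by (rule integral_density[symmetric]) auto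
  also have "\<dots> = exp (of_real (- (\<sigma>\<^sup>2 * t\<^sup>2 / 2)))"
    by (simp add: char_std_normal_distribution exp_of_real power_mult_distrib mult.commute
        del: of_real_minus of_real_divide of_real_mult of_real_power)
  finally show ?thesis .
qed

text \<open>The remainder is known only to exist for each \<open>n\<close>, so a choice of it is
  made. Working inside \<open>exp\<close> avoids a branch of the complex logarithm.\<close>

lemma tendsto_exp_approx:
  fixes f :: "nat \<Rightarrow> complex"
  assumes "eventually (\<lambda>n. \<exists>R. f n = exp (Z n + R) \<and> norm R \<le> B n) sequentially"
    and Z: "Z \<longlonglongrightarrow> L" and B: "B \<longlonglongrightarrow> 0"
  shows "f \<longlonglongrightarrow> exp L"
proof -
  define R where "R n = (SOME R. f n = exp (Z n + R) \<and> norm R \<le> B n)" for n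
  have ev: "eventually (\<lambda>n. f n = exp (Z n + R n) \<and> norm (R n) \<le> B n) sequentially"
    using assms(1) unfolding R_def by eventually_elim (rule someI_ex)
  have "R \<longlonglongrightarrow> 0"
    using ev by (intro Lim_null_comparison[OF _ B]) (auto elim: eventually_mono)
  then have "(\<lambda>n. exp (Z n + R n)) \<longlonglongrightarrow> exp (L + 0)" by (intro tendsto_intros Z)
  moreover have "eventually (\<lambda>n. exp (Z n + R n) = f n) sequentially"
    using ev by (auto elim: eventually_mono)
  ultimately show ?thesis using tendsto_cong by fastforce
qed

section \<open>The central limit theorem\<close>

theorem theorem3p2:
  fixes p q :: "nat \<Rightarrow> nat"
    and N :: "nat \<Rightarrow> nat \<Rightarrow> nat"
    and \<Omega> :: "nat \<Rightarrow> 'a measure"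
    and X :: "nat \<Rightarrow> nat \<Rightarrow> nat \<Rightarrow> 'a \<Rightarrow> real vec"
    and \<mu> :: "nat \<Rightarrow> nat \<Rightarrow> real vec"
    and \<Sigma> :: "nat \<Rightarrow> nat \<Rightarrow> real mat"
    and \<sigma> :: real
    and n\<^sub>0 :: nat
  assumes p_pos: "\<And>n. n \<ge> n\<^sub>0 \<Longrightarrow> p n > 0"
    and q_pos: "\<And>n. n \<ge> n\<^sub>0 \<Longrightarrow> q n > 0"
    and N_large: "\<And>n j. n \<ge> n\<^sub>0 \<Longrightarrow> j \<in> {1..q n} \<Longrightarrow> N n j > p n + 1"
    and N_total: "\<And>n. n \<ge> n\<^sub>0 \<Longrightarrow> (\<Sum>j=1..q n. N n j) = n"
    and prob_space: "\<And>n. n \<ge> n\<^sub>0 \<Longrightarrow> prob_space (\<Omega> n)"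
    and mu_dim: "\<And>n j. n \<ge> n\<^sub>0 \<Longrightarrow> j \<in> {1..q n} \<Longrightarrow> \<mu> n j \<in> carrier_vec (p n)"
    and Sigma_pd: "\<And>n j. n \<ge> n\<^sub>0 \<Longrightarrow> j \<in> {1..q n} \<Longrightarrow> positive_definite_mat (p n) (\<Sigma> n j)"
    and X_normal: "\<And>n j i. n \<ge> n\<^sub>0 \<Longrightarrow> j \<in> {1..q n} \<Longrightarrow> i \<in> {1..N n j} \<Longrightarrow>
      distributed (\<Omega> n) (lborel_vec (p n)) (X n j i) (mvnormal_density (p n) (\<mu> n j) (\<Sigma> n j))"
    and X_indep: "\<And>n. n \<ge> n\<^sub>0 \<Longrightarrow>
      prob_space.indep_vars (\<Omega> n) (\<lambda>_. borel_vec (p n)) (\<lambda>(j, i). X n j i)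
        (SIGMA j:{1..q n}. {1..N n j})"
    and p_tendsto: "filterlim p at_top sequentially"
    and q_small: "(\<lambda>n. real (q n)) \<in> o(\<lambda>n. sqrt (real (p n) * real n))"
    and p_small: "(\<lambda>n. real (p n)) \<in> o(\<lambda>n. real n)"
    and ratio: "limsup (\<lambda>n. SUP j\<in>{1..q n}. ereal (real (p n) / real (N n j))) < 1"
    and sigma_pos: "\<sigma> > 0"
    and sigma_lim: "(\<lambda>n. sigma_tilde_sq n (p n) (q n) (N n)) \<longlonglongrightarrow> \<sigma>\<^sup>2"
    and H0: "\<And>n j k. n \<ge> n\<^sub>0 \<Longrightarrow> j \<in> {1..q n} \<Longrightarrow> k \<in> {1..q n} \<Longrightarrow>
      \<mu> n j = \<mu> n k \<and> \<Sigma> n j = \<Sigma> n k"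
  shows "weak_conv_m
    (\<lambda>n. distr (\<Omega> n) borel (\<lambda>\<omega>.
       (ln (likelihood_ratio (p n) (q n) (N n) (\<lambda>j i. X n j i \<omega>))
          - s_tilde (real n) (real (p n)) (q n) (\<lambda>j. real (N n j)))
       / sqrt (real (p n) * real n)))
    (density lborel (normal_density 0 \<sigma>))"
proof -
  define r where "r n = sqrt (real (p n) * real n)" for n
  define st where "st n = s_tilde (real n) (real (p n)) (q n) (\<lambda>j. real (N n j))" for n
  define LR where "LR n \<omega> = likelihood_ratio (p n) (q n) (N n) (\<lambda>j i. X n j i \<omega>)" for n \<omega>
  define Y where "Y n \<omega> = (ln (LR n \<omega>) - st n) / r n" for n \<omega>
  define mn where "mn n = lr_mean (p n) (q n) (N n)" for n
  define v where "v n = lr_var (p n) (q n) (N n)" for n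
  let ?M = "\<lambda>n. distr (\<Omega> n) borel (Y n)"
  have qr: "(\<lambda>n. real (q n) / r n) \<longlonglongrightarrow> 0"
    unfolding r_def by (rule smalloD_tendsto[OF q_small])
  have pn: "(\<lambda>n. real (p n) / real n) \<longlonglongrightarrow> 0"
    by (rule smalloD_tendsto[OF p_small])
  have ev0: "eventually (\<lambda>n. n \<ge> n\<^sub>0 \<and> n \<ge> 100) sequentially"
    by (intro eventually_conj eventually_ge_at_top)
  \<comment> \<open>\<open>p / r\<close> is the square root of \<open>p / n\<close>.\<close>
  have pr: "(\<lambda>n. real (p n) / r n) \<longlonglongrightarrow> 0"
  proof -
    have "(\<lambda>n. sqrt (real (p n) / real n)) \<longlonglongrightarrow> sqrt 0" by (intro tendsto_real_sqrt pn)
    moreover have "sqrt (real (p n) / real n) = real (p n) / r n" if "n \<ge> n\<^sub>0 \<and> n \<ge> 100" for n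
      using that p_pos[of n] by (simp add: r_def real_sqrt_mult real_sqrt_divide divide_simps)
    ultimately show ?thesis
      using Lim_transform_eventually[OF _ eventually_mono[OF ev0]] by fastforce
  qed
  have rpos: "0 < r n" if "n \<ge> n\<^sub>0 \<and> n \<ge> 100" for n using that p_pos[of n] by (simp add: r_def)
  have r2: "(r n)\<^sup>2 = real (p n) * real n" for n by (simp add: r_def)
  have qn: "(\<lambda>n. real (q n) / real n) \<longlonglongrightarrow> 0"
  proof -
    have "(\<lambda>n. real (q n) / r n * (real (p n) / r n)) \<longlonglongrightarrow> 0 * 0" by (intro tendsto_mult qr pr)
    moreover have "real (q n) / r n * (real (p n) / r n) = real (q n) / real n" if n: "n \<ge> n\<^sub>0 \<and> n \<ge> 100" for n
    proof -
      have "real (q n) / r n * (real (p n) / r n) = real (q n) * real (p n) / (r n)\<^sup>2" by (simp add: power2_eq_square)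
      then show ?thesis using n p_pos[of n] by (simp add: r2)
    qed
    ultimately show ?thesis
      using Lim_transform_eventually[OF _ eventually_mono[OF ev0]] by fastforce
  qed
  have r1: "(\<lambda>n. 1 / r n) \<longlonglongrightarrow> 0"
  proof (rule Lim_null_comparison[OF _ qr])
    show "\<forall>\<^sub>F n in sequentially. norm (1 / r n) \<le> real (q n) / r n"
      using ev0
    proof eventually_elim
      case (elim n)
      then show ?case using rpos[OF elim] q_pos[of n] by (simp add: divide_right_mono)
    qed
  qed
  obtain C Y0 where C: "0 \<le> C" "2 < Y0" "\<And>y. y \<ge> Y0 \<Longrightarrow> \<bar>row_defect y\<bar> \<le> C / y\<^sup>2"
    using row_defect_bound by blast
  \<comment> \<open>The margin is \<open>2 * \<epsilon>\<close>: one half stays as the ratio bound,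
    the other is at least \<open>\<epsilon> * p\<close>, which eventually exceeds
    \<open>Y0 + 3\<close> and absorbs the \<open>- 1\<close> and the threshold
    \<open>Y0\<close>.\<close>
  obtain \<epsilon> :: real where \<epsilon>: "0 < \<epsilon>" "\<epsilon> \<le> 1"
    and evN: "eventually (\<lambda>n. \<forall>j\<in>{1..q n}. 2 * \<epsilon> * N n j \<le> real (N n j) - p n) sequentially"
  proof -
    obtain c where c: "limsup (\<lambda>n. SUP j\<in>{1..q n}. ereal (real (p n) / real (N n j))) < c" "c < 1"
      using ratio dense by blast
    obtain c' where c': "c = ereal c'"
    proof (cases c)
      case (real x) then show ?thesis using that by simp
    next
      case PInf then show ?thesis using c by simp
    next
      case MInf then show ?thesis using c by simp
    qed
    define d where "d = max c' 0"
    have d: "0 \<le> d" "d < 1" using c c' by (auto simp: d_def)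
    have "eventually (\<lambda>n. (SUP j\<in>{1..q n}. ereal (real (p n) / real (N n j))) < c) sequentially"
      by (rule Limsup_lessD[OF c(1)])
    then have "eventually (\<lambda>n. \<forall>j\<in>{1..q n}. 2 * ((1 - d) / 2) * N n j \<le> real (N n j) - p n) sequentially"
      using ev0
    proof eventually_elim
      case (elim n)
      show ?case
      proof
        fix j assume j: "j \<in> {1..q n}"
        have "ereal (real (p n) / real (N n j)) \<le> (SUP j\<in>{1..q n}. ereal (real (p n) / real (N n j)))"
          using j by (rule SUP_upper)
        also have "\<dots> < ereal c'" using elim c' by simp
        finally have "real (p n) / real (N n j) < d" by (simp add: d_def)
        moreover have "0 < real (N n j)" using N_large[of n j] elim j by simp
        ultimately have "real (p n) \<le> d * real (N n j)" by (simp add: divide_simps)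
        then have le: "(1 - d) * N n j \<le> real (N n j) - p n" by (simp add: left_diff_distrib)
        have e: "2 * ((1 - d) / 2) = 1 - d" by simp
        show "2 * ((1 - d) / 2) * N n j \<le> real (N n j) - p n"
          unfolding e by (rule le)
      qed
    qed
    then show ?thesis using d by (intro that[of "(1 - d) / 2"]) auto
  qed
  have evp: "eventually (\<lambda>n. (Y0 + 3) / \<epsilon> \<le> real (p n)) sequentially"
    using filterlim_compose[OF filterlim_real_sequentially p_tendsto] by (simp add: filterlim_at_top)
  \<comment> \<open>All conditions that the estimates impose on a single \<open>n\<close>.\<close>
  define good where "good n \<longleftrightarrow> n \<ge> n\<^sub>0 \<and> n \<ge> 100 \<and> 1 \<le> p n \<and> 1 \<le> q n \<and> 8 * p n \<le> n \<and> 8 * q n \<le> n \<and> p n * q n \<le> n \<and>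
    (\<forall>j\<in>{1..q n}. Y0 \<le> real (N n j) - p n \<and> \<epsilon> * N n j \<le> real (N n j) - p n - 1 \<and> p n + 2 \<le> N n j) \<and>
    Y0 \<le> real n - p n \<and> \<epsilon> * n \<le> real n - p n" for n
  have evgood: "eventually good sequentially"
  proof -
    have "eventually (\<lambda>n. real (p n) / real n < 1 / 8) sequentially" "eventually (\<lambda>n. real (q n) / real n < 1 / 8) sequentially"
      using order_tendstoD(2)[OF pn, of "1 / 8"] order_tendstoD(2)[OF qn, of "1 / 8"] by auto
    with ev0 evN evp show ?thesis
    proof eventually_elim
      case (elim n)
      have n: "n \<ge> n\<^sub>0" "n \<ge> 100" using elim by auto
      have np: "0 < real n" using n by simp
      have sum: "(\<Sum>j=1..q n. N n j) = n" using N_total n by blast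
      have Yp: "Y0 + 3 \<le> \<epsilon> * p n" using elim \<epsilon> by (simp add: divide_simps mult.commute)
      have Nj: "Y0 \<le> real (N n j) - p n \<and> \<epsilon> * N n j \<le> real (N n j) - p n - 1 \<and> p n + 2 \<le> N n j" if j: "j \<in> {1..q n}" for j
      proof -
        have l: "p n + 2 \<le> N n j" using N_large[OF n(1) j] by simp
        then have "\<epsilon> * p n \<le> \<epsilon> * N n j" using \<epsilon> by (intro mult_left_mono) auto
        moreover have "2 * \<epsilon> * N n j \<le> real (N n j) - p n" using elim j by blast
        ultimately show ?thesis using Yp C(2) l by linarith
      qed
      have "p n * q n = (\<Sum>j=1..q n. p n)" by simp
      also have "\<dots> \<le> (\<Sum>j=1..q n. N n j)" using Nj by (intro sum_mono) fastforce
      finally have pq: "p n * q n \<le> n" using sum by simp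
      have p8: "8 * real (p n) \<le> n" and q8: "8 * real (q n) \<le> n" using elim np by (auto simp: divide_simps)
      have q1: "1 \<in> {1..q n}" using q_pos[OF n(1)] by simp
      have "N n 1 \<le> (\<Sum>j=1..q n. N n j)" using q1 by (intro member_le_sum) auto
      then have "Y0 \<le> real n - p n" using Nj[OF q1] sum by simp
      moreover have "\<epsilon> * n \<le> real n - p n"
      proof -
        have sn: "(\<Sum>j=1..q n. real (N n j)) = real n" using arg_cong[OF sum, of real] by simp
        have "\<epsilon> * n = (\<Sum>j=1..q n. \<epsilon> * N n j)" by (simp only: sum_distrib_left[symmetric] sn)
        also have "\<dots> \<le> (\<Sum>j=1..q n. real (N n j) - p n)" using Nj by (intro sum_mono) fastforce
        also have "\<dots> = n - real (q n) * p n" unfolding sum_subtractf sn by simp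
        also have "\<dots> \<le> real n - p n" using q_pos[OF n(1)] mult_right_mono[of 1 "real (q n)" "real (p n)"] by simp
        finally show ?thesis .
      qed
      ultimately show ?case
        unfolding good_def using n Nj pq p8 q8 p_pos[OF n(1)] q_pos[OF n(1)] by auto
    qed
  qed
  have goodD: "n \<ge> n\<^sub>0" "n \<ge> 100" "1 \<le> p n" "1 \<le> q n" "8 * p n \<le> n" "8 * q n \<le> n" "p n * q n \<le> n"
    "Y0 \<le> real n - p n" "\<epsilon> * n \<le> real n - p n" if "good n" for n
    using that by (simp_all add: good_def)
  have goodN: "Y0 \<le> real (N n j) - p n" "\<epsilon> * N n j \<le> real (N n j) - p n - 1" "p n + 2 \<le> N n j"
    if "good n" "j \<in> {1..q n}" for n j
    using that unfolding good_def by blast+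
  have mean_lim: "(\<lambda>n. (mn n - st n) / r n) \<longlonglongrightarrow> 0"
  proof (rule Lim_null_comparison)
    show "(\<lambda>n. (C / \<epsilon>\<^sup>2 + 2) * (real (q n) / r n) + 69 * (real (p n) / r n)) \<longlonglongrightarrow> 0"
      by (rule tendsto_eq_intros qr pr refl | simp)+
    show "\<forall>\<^sub>F n in sequentially. norm ((mn n - st n) / r n) \<le> (C / \<epsilon>\<^sup>2 + 2) * (real (q n) / r n) + 69 * (real (p n) / r n)"
      using evgood
    proof eventually_elim
      case (elim n)
      have "\<bar>mn n - st n\<bar> \<le> (C / \<epsilon>\<^sup>2 + 2) * q n + 69 * p n"
        unfolding mn_def st_def
      proof (rule lr_mean_approx[where Y = Y0 and C = C and \<epsilon> = \<epsilon>])
        show "Y0 \<le> real (N n j) - p n \<and> \<epsilon> * N n j \<le> real (N n j) - p n" if "j \<in> {1..q n}" for j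
          using goodN[OF elim that] by simp
      qed (use goodD[OF elim] C \<epsilon> N_total[of n] in simp_all)
      then have "\<bar>mn n - st n\<bar> / r n \<le> ((C / \<epsilon>\<^sup>2 + 2) * q n + 69 * p n) / r n"
        using rpos[of n] goodD[OF elim] by (intro divide_right_mono) simp_all
      then show ?case using rpos[of n] goodD[OF elim] by (simp add: abs_divide add_divide_distrib)
    qed
  qed
  have var_lim: "(\<lambda>n. v n / (r n)\<^sup>2) \<longlonglongrightarrow> \<sigma>\<^sup>2 / 2"
  proof -
    have "(\<lambda>n. v n / (r n)\<^sup>2 - sigma_tilde_sq n (p n) (q n) (N n) / 2) \<longlonglongrightarrow> 0"
    proof (rule Lim_null_comparison)
      show "(\<lambda>n. 1 / (4 * \<epsilon>\<^sup>2) * (real (q n) / n) + 1 / 2 * (real (p n) / n)) \<longlonglongrightarrow> 0"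
        by (rule tendsto_eq_intros qn pn refl | simp)+
      show "\<forall>\<^sub>F n in sequentially. norm (v n / (r n)\<^sup>2 - sigma_tilde_sq n (p n) (q n) (N n) / 2)
        \<le> 1 / (4 * \<epsilon>\<^sup>2) * (real (q n) / n) + 1 / 2 * (real (p n) / n)"
        using evgood
      proof eventually_elim
        case (elim n)
        have "\<bar>lr_var (p n) (q n) (N n) / (real (p n) * n) - sigma_tilde_sq n (p n) (q n) (N n) / 2\<bar>
          \<le> q n / (4 * \<epsilon>\<^sup>2 * n) + real (p n) / (2 * real n)"
        proof (rule lr_var_approx)
          show "\<epsilon> * N n j \<le> real (N n j) - p n - 1 \<and> 0 < N n j" if "j \<in> {1..q n}" for j
            using goodN[OF elim that] by simp
        qed (use goodD[OF elim] \<epsilon> N_total[of n] in simp_all)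
        then show ?case by (simp add: v_def r2)
      qed
    qed
    moreover have "(\<lambda>n. sigma_tilde_sq n (p n) (q n) (N n) / 2) \<longlonglongrightarrow> \<sigma>\<^sup>2 / 2"
      by (intro tendsto_intros sigma_lim) simp
    ultimately have "(\<lambda>n. (v n / (r n)\<^sup>2 - sigma_tilde_sq n (p n) (q n) (N n) / 2) + sigma_tilde_sq n (p n) (q n) (N n) / 2) \<longlonglongrightarrow> 0 + \<sigma>\<^sup>2 / 2"
      by (rule tendsto_add)
    then show ?thesis by simp
  qed
  have law: "LR n \<in> borel_measurable (\<Omega> n)"
    "(\<integral>\<omega>. exp (\<i> * of_real (s * ln (LR n \<omega>))) \<partial>\<Omega> n) = lr_char (p n) (q n) (N n) s" if n: "n \<ge> n\<^sub>0" for n s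
  proof -
    have q1: "1 \<in> {1..q n}" using q_pos[OF n] by simp
    have Nj: "\<And>j. j \<in> {1..q n} \<Longrightarrow> p n < N n j" using N_large[OF n] by fastforce
    \<comment> \<open>The null hypothesis: every group has the parameters of group
      \<open>1\<close>.\<close>
    have X1: "distributed (\<Omega> n) (lborel_vec (p n)) (X n j i) (mvnormal_density (p n) (\<mu> n 1) (\<Sigma> n 1))"
      if "j \<in> {1..q n}" "i \<in> {1..N n j}" for j i
      using X_normal[OF n that] H0[OF n that(1) q1] by simp
    note L = likelihood_ratio_law[OF prob_space[OF n] p_pos[OF n] q_pos[OF n] Nj Sigma_pd[OF n q1] mu_dim[OF n q1] X1 X_indep[OF n]]
    show "LR n \<in> borel_measurable (\<Omega> n)"
      unfolding LR_def[abs_def] by (rule L(1))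
    show "(\<integral>\<omega>. exp (\<i> * of_real (s * ln (LR n \<omega>))) \<partial>\<Omega> n) = lr_char (p n) (q n) (N n) s"
      unfolding LR_def by (rule L(2))
  qed
  have mY: "Y n \<in> borel_measurable (\<Omega> n)" if "n \<ge> n\<^sub>0" for n
    unfolding Y_def[abs_def] using law(1)[OF that] by measurable
  have charM: "char (?M n) t = exp (- (\<i> * of_real (t * st n / r n))) * lr_char (p n) (q n) (N n) (t / r n)" if n: "n \<ge> n\<^sub>0" for n t
  proof -
    have "char (?M n) t = (\<integral>\<omega>. iexp (t * Y n \<omega>) \<partial>\<Omega> n)"
      unfolding char_def by (rule integral_distr[OF mY[OF n]]) auto
    also have "\<dots> = (\<integral>\<omega>. exp (- (\<i> * of_real (t * st n / r n))) * exp (\<i> * of_real (t / r n * ln (LR n \<omega>))) \<partial>\<Omega> n)"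
      by (intro Bochner_Integration.integral_cong refl)
        (simp add: Y_def exp_add[symmetric] diff_divide_distrib right_diff_distrib)
    also have "\<dots> = exp (- (\<i> * of_real (t * st n / r n))) * lr_char (p n) (q n) (N n) (t / r n)"
      unfolding integral_mult_right_zero law(2)[OF n] ..
    finally show ?thesis .
  qed
  have char_lim: "(\<lambda>n. char (?M n) t) \<longlonglongrightarrow> char (density lborel (normal_density 0 \<sigma>)) t" for t
  proof -
    \<comment> \<open>With \<open>s = t / r\<close> and \<open>r^2 = p * n\<close>, the three error
      terms of \<open>lr_char_expansion\<close> become multiples of \<open>q / r\<close>,
      \<open>q / n\<close> and \<open>1 / r\<close>.\<close>
    let ?Z = "\<lambda>n. Complex (- (t\<^sup>2 * (v n / (r n)\<^sup>2))) (t * ((mn n - st n) / r n))"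
    let ?B = "\<lambda>n. 2 / \<epsilon>\<^sup>2 * (2 * \<bar>t\<bar> * (real (q n) / r n) + t\<^sup>2 * (real (q n) / n) + \<bar>t\<bar> ^ 3 * (1 / r n))"
    have "(\<lambda>n. char (?M n) t) \<longlonglongrightarrow> exp (Complex (- (t\<^sup>2 * (\<sigma>\<^sup>2 / 2))) (t * 0))"
    proof (rule tendsto_exp_approx)
      show "?Z \<longlonglongrightarrow> Complex (- (t\<^sup>2 * (\<sigma>\<^sup>2 / 2))) (t * 0)"
        by (intro tendsto_Complex tendsto_minus tendsto_mult tendsto_const var_lim mean_lim)
      show "?B \<longlonglongrightarrow> 0"
        by (rule tendsto_eq_intros qr qn r1 refl | simp)+
      show "\<forall>\<^sub>F n in sequentially. \<exists>R. char (?M n) t = exp (?Z n + R) \<and> norm R \<le> ?B n"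
        using evgood
      proof eventually_elim
        case (elim n)
        have n: "n \<ge> n\<^sub>0" "n \<ge> 100" using goodD[OF elim] by simp_all
        have rp: "0 < r n" using rpos n by blast
        let ?s = "t / r n"
        have Nj: "p n + 2 \<le> N n j \<and> \<epsilon> * N n j \<le> real (N n j) - p n" if "j \<in> {1..q n}" for j
          using goodN[OF elim that] by simp
        obtain R where R: "lr_char (p n) (q n) (N n) ?s = exp (Complex (- (?s\<^sup>2 * v n)) (?s * mn n) + R)"
          "norm R \<le> 2 / \<epsilon>\<^sup>2 * (2 * \<bar>?s\<bar> * q n + real (p n) * real (q n) * ?s\<^sup>2 + real (p n) * real n * \<bar>?s\<bar> ^ 3)"
          using lr_char_expansion[OF q_pos[OF n(1)] \<epsilon>(1) Nj N_total[OF n(1), symmetric], of ?s] unfolding v_def mn_def by blast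
        have "char (?M n) t = exp (- (\<i> * of_real (t * st n / r n)) + (Complex (- (?s\<^sup>2 * v n)) (?s * mn n) + R))"
          unfolding charM[OF n(1)] R(1) exp_add ..
        also have "- (\<i> * of_real (t * st n / r n)) + (Complex (- (?s\<^sup>2 * v n)) (?s * mn n) + R) = ?Z n + R"
          by (simp add: complex_eq_iff power_divide diff_divide_distrib right_diff_distrib)
        finally have 1: "char (?M n) t = exp (?Z n + R)" .
        have e1: "2 * \<bar>?s\<bar> * q n = 2 * \<bar>t\<bar> * (real (q n) / r n)" using rp by (simp add: abs_divide)
        have e2: "real (p n) * real (q n) * ?s\<^sup>2 = t\<^sup>2 * (real (q n) / n)"
          using p_pos[OF n(1)] by (simp add: power_divide r2)
        have e3: "real (p n) * real n * \<bar>?s\<bar> ^ 3 = \<bar>t\<bar> ^ 3 * (1 / r n)"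
        proof -
          have "real (p n) * real n * \<bar>?s\<bar> ^ 3 = (r n)\<^sup>2 * \<bar>?s\<bar> ^ 3" by (simp only: r2)
          also have "\<dots> = \<bar>t\<bar> ^ 3 * (1 / r n)" using rp by (simp add: abs_divide power_divide power2_eq_square power3_eq_cube)
          finally show ?thesis .
        qed
        show ?case using 1 R(2) unfolding e1 e2 e3 by blast
      qed
    qed
    also have "exp (Complex (- (t\<^sup>2 * (\<sigma>\<^sup>2 / 2))) (t * 0)) = char (density lborel (normal_density 0 \<sigma>)) t"
      unfolding char_normal_density[OF sigma_pos] by (intro arg_cong[where f = exp]) (simp add: complex_eq_iff)
    finally show ?thesis .
  qed
  \<comment> \<open>The continuity theorem asks for probability measures at every index, which are
    available only from \<open>n\<^sub>0\<close> on; hence the shift.\<close>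
  have "weak_conv_m (\<lambda>n. ?M (n + n\<^sub>0)) (density lborel (normal_density 0 \<sigma>))"
  proof (rule levy_continuity)
    show "real_distribution (?M (n + n\<^sub>0))" for n
    proof -
      interpret prob_space "\<Omega> (n + n\<^sub>0)" by (rule prob_space) simp
      show ?thesis by (rule real_distribution_distr) (rule mY, simp)
    qed
    show "real_distribution (density lborel (normal_density 0 \<sigma>))"
      using prob_space_normal_density[OF sigma_pos] by (simp add: real_distribution_def real_distribution_axioms_def)
    show "(\<lambda>n. char (?M (n + n\<^sub>0)) t) \<longlonglongrightarrow> char (density lborel (normal_density 0 \<sigma>)) t" for t
      by (rule LIMSEQ_ignore_initial_segment[OF char_lim])
  qed
  then have "weak_conv_m ?M (density lborel (normal_density 0 \<sigma>))"
    unfolding weak_conv_m_def weak_conv_def by (auto intro: LIMSEQ_offset)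
  then show ?thesis unfolding Y_def[abs_def] LR_def st_def r_def .
qed

end
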